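(* Let $m\ge 1$ and let $\psi_1,\ldots,\psi_m:\mathbb{N}\to(0,\infty)$ be non-increasing functions such that \[ \psi_i(q)=o(q^{-2})\ \text{ as } q\to\infty,\qquad i=1,\dots,m, \] and \[ \sum_{q=1}^{\infty} q\,\psi_i(q)<\infty,\qquad i=1,\ldots,m. \] Then \[ \dim_H\bigl(E(\psi_1)\times\cdots\times E(\psi_m)\bigr)=m-1+\min_{1\le i\le m}\dim_H E(\psi_i). \] Consequently \[ \dim_P\bigl(E(\psi_1)\times\cdots\times E(\psi_m)\bigr)=m. \]
   Context: $\mathbb{N}=\{1,2,\ldots\}$. For a function $\psi:\mathbb{N}\to(0,\infty)$ let \[ W(\psi)=\left\{x\in[0,1):\left|x-\frac pq\right|<\psi(q)\text{ for infinitely many }(p,q)\in\mathbb{Z}\times\mathbb{N}\right\}, \qquad E(\psi)=W(\psi)\setminus\bigcup_{0<c<1}W(c\psi), \] where $c\psi$ denotes the function $q\mapsto c\,\psi(q)$. $\dim_H$ and $\dim_P$ denote Hausdorff and packing dimension; the product set is a subset of $\mathbb{R}^m$ with its usual metric. *)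

theory Defs
  imports "HOL-Analysis.Analysis" "HOL-Library.Landau_Symbols"
begin

section \<open>Hausdorff dimension\<close>

text \<open>
  The quantity \<open>|U|\<^sup>s\<close> summed over a cover. For \<open>s = 0\<close> every nonempty set, including a
  singleton, contributes \<open>1\<close> (note that \<open>0 powr 0 = 0\<close> in HOL); the empty set contributes \<open>0\<close>,
  so that covers by sequences of sets include the finite covers.
\<close>

definition diam_powr :: "real \<Rightarrow> 'a::metric_space set \<Rightarrow> ennreal" where
  "diam_powr s U =
     (if U = {} then 0 else if s = 0 then 1 else ennreal (diameter U powr s))"

text \<open>Boundedness is required because \<^const>\<open>diameter\<close> is only meaningful for bounded sets.\<close>

definition hausdorff_premeasure :: "real \<Rightarrow> real \<Rightarrow> 'a::metric_space set \<Rightarrow> ennreal" where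
  "hausdorff_premeasure s \<delta> A =
     (INF U \<in> {U :: nat \<Rightarrow> 'a set. A \<subseteq> (\<Union>n. U n) \<and> (\<forall>n. bounded (U n) \<and> diameter (U n) \<le> \<delta>)}.
        \<Sum>n. diam_powr s (U n))"

text \<open>The premeasure increases as \<open>\<delta>\<close> decreases to \<open>0\<close>, so the limit is a supremum.\<close>

definition hausdorff_measure :: "real \<Rightarrow> 'a::metric_space set \<Rightarrow> ennreal" where
  "hausdorff_measure s A = (SUP \<delta>\<in>{0<..}. hausdorff_premeasure s \<delta> A)"

definition hausdorff_dim :: "'a::metric_space set \<Rightarrow> ennreal" where
  "hausdorff_dim A = Inf {ennreal s | s. 0 \<le> s \<and> hausdorff_measure s A = 0}"


section \<open>Packing dimension\<close>

text \<open>
  A \<open>\<delta>\<close>-packing of \<open>A\<close>: a countable collection of pairwise disjoint closed balls with centres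
  in \<open>A\<close> and radii in \<open>(0, \<delta>]\<close>, given by its set of pairs (centre, radius).
\<close>

definition is_packing :: "real \<Rightarrow> 'a::metric_space set \<Rightarrow> ('a \<times> real) set \<Rightarrow> bool" where
  "is_packing \<delta> A B \<longleftrightarrow>
     countable B \<and> B \<subseteq> A \<times> {0<..\<delta>} \<and> disjoint_family_on (\<lambda>(x, r). cball x r) B"

text \<open>In Euclidean space \<open>2 * r\<close> is the diameter of the ball.\<close>

definition packing_premeasure :: "real \<Rightarrow> 'a::metric_space set \<Rightarrow> ennreal" where
  "packing_premeasure s A =
     (INF \<delta>\<in>{0<..}. SUP B\<in>{B. is_packing \<delta> A B}. \<Sum>\<^sub>\<infinity>(x, r)\<in>B. ennreal ((2 * r) powr s))"

text \<open>The packing premeasure is not countably subadditive, hence this second step.\<close>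

definition packing_measure :: "real \<Rightarrow> 'a::metric_space set \<Rightarrow> ennreal" where
  "packing_measure s A =
     (INF F \<in> {F :: nat \<Rightarrow> 'a set. A \<subseteq> (\<Union>n. F n)}. \<Sum>n. packing_premeasure s (F n))"

definition packing_dim :: "'a::metric_space set \<Rightarrow> ennreal" where
  "packing_dim A = Inf {ennreal s | s. 0 \<le> s \<and> packing_measure s A = 0}"


section \<open>Well approximable and exactly approximable numbers\<close>

text \<open>
  Approximation functions are defined on the positive integers; they are represented by
  functions on \<^typ>\<open>nat\<close> whose value at \<open>0\<close> is never used. The set counts pairs
  \<open>(p, q)\<close>, not necessarily coprime.
\<close>

definition W_set :: "(nat \<Rightarrow> real) \<Rightarrow> real set" where
  "W_set \<psi> = {x \<in> {0..<1}.
     infinite {(p :: int, q :: nat). q \<ge> 1 \<and> \<bar>x - of_int p / of_nat q\<bar> < \<psi> q}}"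

definition E_set :: "(nat \<Rightarrow> real) \<Rightarrow> real set" where
  "E_set \<psi> = W_set \<psi> - (\<Union>c\<in>{0<..<1}. W_set (\<lambda>q. c * \<psi> q))"

end

theory Submission
  imports Defs
begin

text \<open>
  Upper bounds: the product lies in a slab \<open>E(\<psi>\<^sub>i) \<times> [0,1]\<^sup>m\<^sup>-\<^sup>1\<close>, and the natural cover by balls around rationals
  shows that \<open>\<psi>\<^sub>i(N)\<^sup>s N\<^sup>2 \<ge> 1\<close> for infinitely many \<open>N\<close> whenever \<open>s < dim\<^sub>H E(\<psi>\<^sub>i)\<close>.

  Lower bounds: each coordinate carries a decreasing sequence of finite families of intervals, and at
  every stage a single coordinate is refined. An interval is replaced by equally many intervals
  \<open>p/q + [(1-\<epsilon>)\<psi>(q), (1-\<epsilon>/2)\<psi>(q)]\<close> with \<open>N/16 < q \<le> N\<close>, where \<open>N\<close> is huge and \<open>\<psi>(N)\<^sup>s N\<^sup>2 \<ge> 1\<close>. Such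
  intervals are plentiful because, by convergence of \<open>\<Sum> q \<psi>(q)\<close>, the points too close to a rational of
  larger denominator have small measure, while \<open>\<psi>(q) = o(q\<^sup>-\<^sup>2)\<close> protects against the smaller ones.
  At a scale \<open>r\<close> the just refined coordinate has at most a fraction \<open>r\<^sup>s\<^sup>-\<^sup>\<eta>\<close> of its intervals in an \<open>r\<close>-ball, and
  every other coordinate at most \<open>r\<^sup>1\<^sup>-\<^sup>\<eta>\<close>; at the scale \<open>r = N\<^sup>-\<^sup>2\<close> itself the bound \<open>r\<^sup>1\<^sup>-\<^sup>\<eta>\<close> holds for all coordinates.
  Counting boxes gives the Hausdorff dimension without a limit measure, and with Baire's
  theorem the packing dimension.
\<close>

section \<open>Null sets, covers and upper bounds\<close>

text \<open>The delicate scales of a coordinate lie between the size \<psi>(N) of its new intervals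
  and their spacing N^-2: there a tiny ball can hold a whole interval, so the proportion in a ball
  stops shrinking linearly. If two coordinates were refined at comparable N, both would lose
  exponent at the same scales. Refining one at a time, with each N chosen after all density
  constants \<open>B\<close> are known, leaves at most one losing coordinate at every scale and lets
  the constants disappear into r^-\<eta>.

  Equal numbers of successors matter because the proportion of intervals meeting a window then never
  grows under refinement: an estimate found at any level holds at all later ones.

  Exactness also concerns denominators that have not been reached yet. The invariant
  \<open>good_family\<close> reserves room for them: fractions with later denominators spoil at most
  one eighth of each interval, and a refinement hands the same fraction on.

  The packing formula is not read off from the Hausdorff formula. It comes from the same
  construction with \<open>s = 0\<close>, when the largeness condition holds for all N \<ge> 1,
  because the estimate at r = N^-2 does not involve s.\<close>

lemma ennreal_eq_0I:
  fixes x :: ennreal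
  assumes "\<And>e::real. e > 0 \<Longrightarrow> x \<le> ennreal e"
  shows "x = 0"
proof -
  have "x \<le> 0" by (rule ennreal_le_epsilon) (use assms in simp)
  then show ?thesis by simp
qed

lemma hausdorff_premeasure_le:
  assumes "A \<subseteq> (\<Union>n. U n)" "\<And>n. bounded (U n)" "\<And>n. diameter (U n) \<le> \<delta>"
  shows "hausdorff_premeasure s \<delta> A \<le> (\<Sum>n. diam_powr s (U n))"
  unfolding hausdorff_premeasure_def using assms by (intro INF_lower) auto

lemma hausdorff_premeasure_mono:
  "A \<subseteq> B \<Longrightarrow> hausdorff_premeasure s \<delta> A \<le> hausdorff_premeasure s \<delta> B"
  unfolding hausdorff_premeasure_def by (intro INF_superset_mono) auto

lemma hausdorff_measure_eq_0_iff:
  "hausdorff_measure s A = 0 \<longleftrightarrow> (\<forall>\<delta>>0. hausdorff_premeasure s \<delta> A = 0)"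
  unfolding hausdorff_measure_def
  using SUP_bot_conv(1)[of "\<lambda>\<delta>. hausdorff_premeasure s \<delta> A" "{0<..}"] by (auto simp: bot_ennreal)

lemma hausdorff_measure_mono:
  "A \<subseteq> B \<Longrightarrow> hausdorff_measure s A \<le> hausdorff_measure s B"
  unfolding hausdorff_measure_def by (intro SUP_mono) (auto intro: hausdorff_premeasure_mono)

lemma suminf_half_powers:
  assumes "(e::real) \<ge> 0" shows "(\<Sum>n. ennreal (e * (1/2) ^ Suc n)) = ennreal e"
proof -
  have "(\<lambda>n. e * (1/2) ^ Suc n) sums (e * 1)" by (rule sums_mult[OF power_half_series])
  then show ?thesis using assms by (subst suminf_ennreal_eq[where x = e]) auto
qed

lemma hausdorff_premeasure_UN:
  assumes "\<delta> > 0"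
  shows "hausdorff_premeasure s \<delta> (\<Union>n::nat. A n) \<le> (\<Sum>n. hausdorff_premeasure s \<delta> (A n))"
proof (rule ennreal_le_epsilon)
  fix e :: real assume fin: "(\<Sum>n. hausdorff_premeasure s \<delta> (A n)) < top" and e: "0 < e"
  have "\<exists>U. A n \<subseteq> (\<Union>k. U k) \<and> (\<forall>k. bounded (U k) \<and> diameter (U k) \<le> \<delta>) \<and>
     (\<Sum>k. diam_powr s (U k)) \<le> hausdorff_premeasure s \<delta> (A n) + ennreal (e * (1/2) ^ Suc n)" for n
  proof -
    have "hausdorff_premeasure s \<delta> (A n) \<noteq> top"
      using ennreal_suminf_lessD[OF fin, of n] by auto
    moreover have "0 < ennreal (e * (1/2) ^ Suc n)"
      using e by simp
    ultimately have "hausdorff_premeasure s \<delta> (A n) < hausdorff_premeasure s \<delta> (A n) + ennreal (e * (1/2) ^ Suc n)"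
      by (simp add: ennreal_add_left_cancel_less[of _ 0, simplified] less_top)
    then obtain U where U: "U \<in> {U. A n \<subseteq> (\<Union>n. U n) \<and> (\<forall>n. bounded (U n) \<and> diameter (U n) \<le> \<delta>)}"
      "(\<Sum>k. diam_powr s (U k)) < hausdorff_premeasure s \<delta> (A n) + ennreal (e * (1/2) ^ Suc n)"
      unfolding hausdorff_premeasure_def by (subst (asm) INF_less_iff) auto
    then show ?thesis by (intro exI[of _ U]) auto
  qed
  then obtain U where U: "\<And>n. A n \<subseteq> (\<Union>k. U n k)" "\<And>n k. bounded (U n k)" "\<And>n k. diameter (U n k) \<le> \<delta>"
    "\<And>n. (\<Sum>k. diam_powr s (U n k)) \<le> hausdorff_premeasure s \<delta> (A n) + ennreal (e * (1/2) ^ Suc n)"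
    by metis
  define V where "V = (\<lambda>i. case_prod U (prod_decode i))"
  have "hausdorff_premeasure s \<delta> (\<Union>n. A n) \<le> (\<Sum>i. diam_powr s (V i))"
  proof (rule hausdorff_premeasure_le)
    show "(\<Union>n. A n) \<subseteq> (\<Union>i. V i)"
    proof safe
      fix x n assume "x \<in> A n"
      then obtain k where "x \<in> U n k" using U(1) by blast
      then have "x \<in> V (prod_encode (n, k))" by (simp add: V_def)
      then show "x \<in> (\<Union>i. V i)" by blast
    qed
  qed (auto simp: V_def U split: prod.split)
  also have "\<dots> = (\<Sum>i. (\<lambda>(n,k). diam_powr s (U n k)) (prod_decode i))"
    by (intro suminf_cong) (auto simp: V_def split: prod.split)
  also have "\<dots> = (\<Sum>n. \<Sum>k. diam_powr s (U n k))"
    by (rule suminf_ennreal_2dimen) auto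
  also have "\<dots> \<le> (\<Sum>n. hausdorff_premeasure s \<delta> (A n) + ennreal (e * (1/2) ^ Suc n))"
    by (intro suminf_le U) auto
  also have "\<dots> = (\<Sum>n. hausdorff_premeasure s \<delta> (A n)) + (\<Sum>n. ennreal (e * (1/2) ^ Suc n))"
    by (rule suminf_add[symmetric]) auto
  also have "(\<Sum>n. ennreal (e * (1/2) ^ Suc n)) = ennreal e"
    using e by (intro suminf_half_powers) simp
  finally show "hausdorff_premeasure s \<delta> (\<Union>n. A n) \<le> (\<Sum>n. hausdorff_premeasure s \<delta> (A n)) + ennreal e" .
qed

lemma hausdorff_premeasure_finite_cover:
  assumes "finite I" "A \<subseteq> (\<Union>i\<in>I. V i)" "\<And>i. i \<in> I \<Longrightarrow> bounded (V i)" "\<And>i. i \<in> I \<Longrightarrow> diameter (V i) \<le> \<delta>" "\<delta> \<ge> 0"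
  shows "hausdorff_premeasure s \<delta> A \<le> (\<Sum>i\<in>I. diam_powr s (V i))"
proof -
  obtain h where h: "bij_betw h {0..<card I} I" using ex_bij_betw_nat_finite[OF assms(1)] by auto
  define U where "U n = (if n < card I then V (h n) else {})" for n
  have "hausdorff_premeasure s \<delta> A \<le> (\<Sum>n. diam_powr s (U n))"
  proof (rule hausdorff_premeasure_le)
    show "A \<subseteq> (\<Union>n. U n)"
    proof
      fix x assume "x \<in> A"
      then obtain i where i: "i \<in> I" "x \<in> V i" using assms(2) by auto
      then obtain n where "n < card I" "h n = i" using h unfolding bij_betw_def by (metis atLeastLessThan_iff imageE)
      then show "x \<in> (\<Union>n. U n)" using i by (auto simp: U_def)
    qed
  qed (use assms(3-5) bij_betwE[OF h] in \<open>auto simp: U_def\<close>)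
  also have "\<dots> = (\<Sum>n\<in>{0..<card I}. diam_powr s (U n))"
    by (rule suminf_finite) (auto simp: U_def diam_powr_def)
  also have "\<dots> = (\<Sum>n\<in>{0..<card I}. diam_powr s (V (h n)))" by (auto simp: U_def)
  also have "\<dots> = (\<Sum>i\<in>I. diam_powr s (V i))" by (rule sum.reindex_bij_betw[OF h])
  finally show ?thesis .
qed

lemma powr_slack:
  fixes d \<delta> c s :: real
  assumes "0 \<le> d" "d < \<delta>" "c > 0" "s \<ge> 0"
  shows "\<exists>\<rho>. d < \<rho> \<and> \<rho> < \<delta> \<and> \<rho> powr s \<le> (if s = 0 then 1 else d powr s) + c"
proof (cases "s = 0")
  case True
  then show ?thesis using assms by (intro exI[of _ "(d+\<delta>)/2"]) auto
next
  case False
  \<comment> \<open>At the first entry of the minimum the power has grown by exactly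
    \<open>c\<close>; the second entry keeps \<rho> below \<delta>.\<close>
  define \<rho> where "\<rho> = min ((d powr s + c) powr (1/s)) ((d+\<delta>)/2)"
  have "d = (d powr s) powr (1/s)" using False assms by (simp add: powr_powr)
  also have "\<dots> < (d powr s + c) powr (1/s)"
    using False assms by (intro powr_less_mono2) auto
  finally have 1: "d < \<rho>" using assms by (simp add: \<rho>_def)
  have "\<rho> powr s \<le> ((d powr s + c) powr (1/s)) powr s"
    using 1 assms by (intro powr_mono2) (auto simp: \<rho>_def)
  also have "\<dots> = d powr s + c" using False assms by (simp add: powr_powr add_nonneg_nonneg)
  finally have 2: "\<rho> powr s \<le> d powr s + c" .
  have "\<rho> < \<delta>" using assms by (simp add: \<rho>_def min_less_iff_disj)
  then show ?thesis using 1 2 False by (intro exI[of _ \<rho>]) simp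
qed

text \<open>Later covers need positive radii, while \<open>diam_powr\<close> weighs a singleton by
  0, or by 1 when s = 0. The strictly larger numbers \<open>\<rho> n\<close> serve for all s alike,
  and the enlargement costs a total of at most e/4.\<close>

lemma hausdorff_null_cover:
  fixes A :: "'a::metric_space set"
  assumes "hausdorff_measure s A = 0" "s \<ge> 0" "\<delta> > 0" "(e::real) > 0"
  shows "\<exists>U \<rho>. A \<subseteq> (\<Union>n::nat. U n) \<and> (\<forall>n. bounded (U n) \<and> diameter (U n) < \<rho> n \<and> 0 < \<rho> n \<and> \<rho> n < \<delta>) \<and>
    (\<Sum>n. if U n = {} then 0 else ennreal (\<rho> n powr s)) < ennreal e"
proof -
  \<comment> \<open>Half of \<delta> leaves room for \<rho> between the diameter and \<delta>. Two
    quarters of e, one for the cover and one for the enlargement, stay strictly below e.\<close>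
  have "hausdorff_premeasure s (\<delta>/2) A = 0" using assms by (simp add: hausdorff_measure_eq_0_iff)
  then have "hausdorff_premeasure s (\<delta>/2) A < ennreal (e/4)" using assms by simp
  then obtain U where U: "A \<subseteq> (\<Union>n. U n)" "\<And>n. bounded (U n)" "\<And>n. diameter (U n) \<le> \<delta>/2"
      "(\<Sum>k. diam_powr s (U k)) < ennreal (e/4)"
      unfolding hausdorff_premeasure_def by (subst (asm) INF_less_iff) auto
  have "\<exists>\<rho>. diameter (U n) < \<rho> \<and> \<rho> < \<delta> \<and>
     \<rho> powr s \<le> (if s = 0 then 1 else diameter (U n) powr s) + e/4 * (1/2)^Suc n" for n
    by (rule powr_slack) (use assms U(2) U(3)[of n] in \<open>auto intro: diameter_ge_0\<close>)
  then obtain \<rho> where \<rho>: "\<And>n. diameter (U n) < \<rho> n" "\<And>n. \<rho> n < \<delta>"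
    "\<And>n. \<rho> n powr s \<le> (if s = 0 then 1 else diameter (U n) powr s) + e/4 * (1/2)^Suc n"
    by metis
  have "(\<Sum>n. if U n = {} then 0 else ennreal (\<rho> n powr s)) \<le> (\<Sum>n. diam_powr s (U n) + ennreal (e/4 * (1/2) ^ Suc n))"
  proof (intro suminf_le)
    fix n
    have "ennreal (\<rho> n powr s) \<le> ennreal (if s = 0 then 1 else diameter (U n) powr s) + ennreal (e/4 * (1/2) ^ Suc n)"
      using \<rho>(3)[of n] assms
      by (subst ennreal_plus[symmetric]) (auto intro!: ennreal_leI simp del: ennreal_plus)
    then show "(if U n = {} then 0 else ennreal (\<rho> n powr s)) \<le> diam_powr s (U n) + ennreal (e/4 * (1/2) ^ Suc n)"
      by (auto simp: diam_powr_def split: if_splits)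
  qed auto
  also have "\<dots> = (\<Sum>n. diam_powr s (U n)) + (\<Sum>n. ennreal (e/4 * (1/2) ^ Suc n))"
    by (rule suminf_add[symmetric]) auto
  also have "(\<Sum>n. ennreal (e/4 * (1/2) ^ Suc n)) = ennreal (e/4)"
    using assms by (intro suminf_half_powers) simp
  also have "(\<Sum>n. diam_powr s (U n)) + ennreal (e/4) \<le> ennreal (e/4) + ennreal (e/4)"
    using U(4) by (intro add_right_mono) simp
  also have "\<dots> < ennreal e" using assms by (subst ennreal_plus[symmetric]) (auto intro!: ennreal_lessI simp del: ennreal_plus)
  finally have "(\<Sum>n. if U n = {} then 0 else ennreal (\<rho> n powr s)) < ennreal e" .
  moreover have "0 < \<rho> n" for n using \<rho>(1)[of n] diameter_ge_0[OF U(2), of n] by linarith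
  ultimately show ?thesis using U(1,2) \<rho>(1,2) by (intro exI[of _ U] exI[of _ \<rho>]) auto
qed

lemma diam_powr_le:
  assumes "bounded V" "diameter V \<le> d" "0 < d" "0 \<le> s"
  shows "diam_powr s V \<le> ennreal (d powr s)"
  using assms by (auto simp: diam_powr_def intro!: ennreal_leI powr_mono2 diameter_ge_0)

text \<open>Above a covering set of size \<rho>, about \<rho>^-(m-1) boxes of side \<rho> cover the
  remaining m - 1 coordinates, and the extra exponent m - 1 pays for exactly that many.\<close>

lemma hausdorff_measure_slab:
  fixes E :: "real set" and i :: "'m::finite"
  assumes E: "hausdorff_measure s E = 0" and s: "s \<ge> 0"
  shows "hausdorff_measure (s + real (CARD('m) - 1)) {x :: real^'m. x $ i \<in> E \<and> (\<forall>j. x $ j \<in> {0..1})} = 0"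
    (is "hausdorff_measure ?\<sigma> ?A = 0")
  unfolding hausdorff_measure_eq_0_iff
proof (intro allI impI)
  fix \<delta> :: real assume \<delta>: "\<delta> > 0"
  define m where "m = CARD('m)"
  have m: "m \<ge> 1" by (simp add: m_def Suc_le_eq)
  \<comment> \<open>The power of 2 comes from k \<le> 2/\<rho> cells per coordinate, the power of m
    from bounding the diameter of a box by m \<rho> in the l1 norm.\<close>
  define C where "C = 2 ^ (m - 1) * real m powr ?\<sigma>"
  have C: "C > 0" using m by (simp add: C_def)
  have "hausdorff_premeasure ?\<sigma> \<delta> ?A \<le> ennreal e" if e: "e > 0" for e
  proof -
    \<comment> \<open>The bound 1 gives 1 \<le> 1/\<rho> and so k \<le> 2/\<rho>; the bound
      \<delta>/m keeps the diameters m \<rho> of the boxes below \<delta>.\<close>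
    have pos: "min 1 (\<delta> / m) > 0" "e / C > 0" using \<delta> m e C by auto
    obtain U \<rho> where
      U: "E \<subseteq> (\<Union>n. U n)" "\<And>n::nat. bounded (U n)" "\<And>n. diameter (U n) < \<rho> n"
    "\<And>n. 0 < \<rho> n" "\<And>n. \<rho> n < min 1 (\<delta> / m)"
    and sum: "(\<Sum>n. if U n = {} then 0 else ennreal (\<rho> n powr s)) < ennreal (e / C)" using hausdorff_null_cover[OF E s pos] by auto
    define A where "A n = {x :: real^'m. x $ i \<in> U n \<and> (\<forall>j. x $ j \<in> {0..1})}" for n
    have An: "hausdorff_premeasure ?\<sigma> \<delta> (A n) \<le> ennreal C * (if U n = {} then 0 else ennreal (\<rho> n powr s))" for n
    proof (cases "U n = {}")
      case True
      have "hausdorff_premeasure ?\<sigma> \<delta> (A n) \<le> (\<Sum>i\<in>({}::nat set). diam_powr ?\<sigma> ({} :: (real^'m) set))"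
        using True \<delta> by (intro hausdorff_premeasure_finite_cover[where V = "\<lambda>_. {}"]) (auto simp: A_def)
      then show ?thesis by simp
    next
      case False
      define k where "k = nat \<lfloor>1 / \<rho> n\<rfloor> + 1"
      have k: "real k \<le> 2 / \<rho> n"
      proof -
        have "1 \<le> 1 / \<rho> n" using U(4,5)[of n] by auto
        then show ?thesis unfolding k_def by (simp add: of_nat_nat) linarith
      qed
      define I where "I = PiE (UNIV - {i}) (\<lambda>_. {..<k})"
      define V where "V f = {x::real^'m. x $ i \<in> U n \<and> (\<forall>j. j \<noteq> i \<longrightarrow> x $ j \<in> {real (f j) * \<rho> n..(real (f j) + 1) * \<rho> n})}" for f
      have cardI: "card I = k ^ (m - 1)" by (simp add: I_def card_PiE m_def card_Diff_singleton)
      have dist: "dist x y \<le> m * \<rho> n" if "x \<in> V f" "y \<in> V f" for x y f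
      proof -
        have "\<bar>x $ j - y $ j\<bar> \<le> \<rho> n" for j
        proof (cases "j = i")
          case True
          then show ?thesis using that diameter_bounded_bound[OF U(2), of "x$i" n "y$i"] U(3)[of n]
            by (auto simp: V_def dist_real_def)
        next
          case False
          then have "x $ j \<in> {real (f j) * \<rho> n..(real (f j) + 1) * \<rho> n}" "y $ j \<in> {real (f j) * \<rho> n..(real (f j) + 1) * \<rho> n}"
            using that by (auto simp: V_def)
          then show ?thesis by (auto simp: algebra_simps abs_le_iff)
        qed
        then have "(\<Sum>j\<in>UNIV. \<bar>(x - y) $ j\<bar>) \<le> (\<Sum>j\<in>(UNIV::'m set). \<rho> n)" by (intro sum_mono) auto
        then show ?thesis using norm_le_l1_cart[of "x - y"] by (simp add: dist_norm m_def)
      qed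
      have bd: "bounded (V f)" for f
        using dist by (auto simp: bounded_two_points)
      have diam: "diameter (V f) \<le> m * \<rho> n" for f
        using dist U(4)[of n] by (intro diameter_le) (auto simp: dist_norm less_imp_le)
      have "hausdorff_premeasure ?\<sigma> \<delta> (A n) \<le> (\<Sum>f\<in>I. diam_powr ?\<sigma> (V f))"
      proof (rule hausdorff_premeasure_finite_cover)
        show "finite I" by (simp add: I_def finite_PiE)
        show "A n \<subseteq> (\<Union>f\<in>I. V f)"
        proof
          fix x assume x: "x \<in> A n"
          define f where "f = restrict (\<lambda>j. nat \<lfloor>x $ j / \<rho> n\<rfloor>) (UNIV - {i})"
          have *: "x $ j \<in> {0..1}" for j using x by (auto simp: A_def)
          have "x $ j / \<rho> n \<le> 1 / \<rho> n" for j using *[of j] U(4)[of n] by (simp add: divide_right_mono)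
          then have "nat \<lfloor>x $ j / \<rho> n\<rfloor> \<le> nat \<lfloor>1 / \<rho> n\<rfloor>" for j
            by (intro nat_mono floor_mono)
          then have "nat \<lfloor>x $ j / \<rho> n\<rfloor> < k" for j by (simp add: k_def less_Suc_eq_le)
          then have "f \<in> I" by (auto simp: f_def I_def)
          moreover have "x \<in> V f"
          proof -
            have "x $ j \<in> {real (f j) * \<rho> n..(real (f j) + 1) * \<rho> n}" if "j \<noteq> i" for j
            proof -
              have "x $ j / \<rho> n \<ge> 0" using *[of j] U(4)[of n] by auto
              then have "real (f j) = of_int \<lfloor>x $ j / \<rho> n\<rfloor>" using that by (simp add: f_def)
              then have "real (f j) \<le> x $ j / \<rho> n" "x $ j / \<rho> n \<le> real (f j) + 1" by linarith+
              then show ?thesis using U(4)[of n] by (simp add: field_simps)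
            qed
            then show ?thesis using x by (auto simp: V_def A_def)
          qed
          ultimately show "x \<in> (\<Union>f\<in>I. V f)" by blast
        qed
        show "diameter (V f) \<le> \<delta>" for f
        proof -
          have "m * \<rho> n \<le> \<delta>" using U(5)[of n] m by (auto simp: field_simps)
          then show ?thesis using diam[of f] by linarith
        qed
      qed (use bd \<delta> in auto)
      also have "\<dots> \<le> (\<Sum>f\<in>I. ennreal ((m * \<rho> n) powr ?\<sigma>))"
        using bd diam m U(4)[of n] s by (intro sum_mono diam_powr_le) auto
      also have "\<dots> = ennreal (real k ^ (m - 1) * (m * \<rho> n) powr ?\<sigma>)"
        by (simp add: cardI ennreal_mult' ennreal_of_nat_eq_real_of_nat)
      also have "\<dots> \<le> ennreal (C * \<rho> n powr s)"
      proof (intro ennreal_leI)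
        have "real k ^ (m - 1) * (m * \<rho> n) powr ?\<sigma> \<le> (2 / \<rho> n) ^ (m - 1) * (m * \<rho> n) powr ?\<sigma>"
          using k by (intro mult_right_mono power_mono) auto
        also have "\<dots> = C * \<rho> n powr s"
        proof -
          have "\<rho> n powr ?\<sigma> = \<rho> n powr s * \<rho> n ^ (m - 1)"
            unfolding powr_add m_def using U(4)[of n] by (subst powr_realpow) auto
          then have "(m * \<rho> n) powr ?\<sigma> = real m powr ?\<sigma> * (\<rho> n powr s * \<rho> n ^ (m - 1))"
            using U(4)[of n] by (simp add: powr_mult del: of_nat_diff)
          then show ?thesis using U(4)[of n] by (simp add: C_def power_divide del: of_nat_diff)
        qed
        finally show "real k ^ (m - 1) * (m * \<rho> n) powr ?\<sigma> \<le> C * \<rho> n powr s" .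
      qed
      finally show ?thesis using False C by (simp add: ennreal_mult[symmetric])
    qed
    have "?A \<subseteq> (\<Union>n. A n)" using U(1) by (auto simp: A_def)
    then have "hausdorff_premeasure ?\<sigma> \<delta> ?A \<le> hausdorff_premeasure ?\<sigma> \<delta> (\<Union>n. A n)"
      by (rule hausdorff_premeasure_mono)
    also have "\<dots> \<le> (\<Sum>n. hausdorff_premeasure ?\<sigma> \<delta> (A n))"
      by (rule hausdorff_premeasure_UN[OF \<delta>])
    also have "\<dots> \<le> (\<Sum>n. ennreal C * (if U n = {} then 0 else ennreal (\<rho> n powr s)))"
      by (intro suminf_le An) auto
    also have "\<dots> = ennreal C * (\<Sum>n. if U n = {} then 0 else ennreal (\<rho> n powr s))"
      by (rule ennreal_suminf_cmult)
    also have "\<dots> \<le> ennreal C * ennreal (e / C)"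
      using sum by (intro mult_left_mono) auto
    also have "\<dots> = ennreal e" using C e by (simp add: ennreal_mult[symmetric])
    finally show ?thesis by simp
  qed
  then show "hausdorff_premeasure ?\<sigma> \<delta> ?A = 0" by (rule ennreal_eq_0I)
qed

section \<open>Covers by balls around rationals\<close>

lemma finite_nearby_numerators:
  "finite {p::int. \<bar>x - of_int p / of_nat q\<bar> < (c::real)}" if "q \<ge> 1"
proof (rule finite_subset)
  show "{p::int. \<bar>x - of_int p / of_nat q\<bar> < c} \<subseteq> {\<lfloor>q * (x - c)\<rfloor>..\<lceil>q * (x + c)\<rceil>}"
  proof
    fix p :: int assume "p \<in> {p::int. \<bar>x - of_int p / of_nat q\<bar> < c}"
    then have "x - c < of_int p / q" "of_int p / q < x + c" by (auto simp: abs_less_iff)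
    then have "q * (x - c) < p" "p < q * (x + c)" using that by (simp_all add: field_simps)
    then show "p \<in> {\<lfloor>q * (x - c)\<rfloor>..\<lceil>q * (x + c)\<rceil>}" by (auto; linarith)
  qed
qed simp

lemma W_set_unbounded_denominators:
  assumes "x \<in> W_set \<psi>"
  shows "\<exists>q\<ge>Q. q \<ge> 1 \<and> (\<exists>p::int. \<bar>x - of_int p / of_nat q\<bar> < \<psi> q)"
proof (rule ccontr)
  assume *: "\<not> ?thesis"
  have "{(p :: int, q :: nat). q \<ge> 1 \<and> \<bar>x - of_int p / of_nat q\<bar> < \<psi> q} \<subseteq>
    (\<Union>q\<in>{1..<Q}. {p. \<bar>x - of_int p / of_nat q\<bar> < \<psi> q} \<times> {q})"
    using * by (auto simp: not_le)
  moreover have "finite (\<Union>q\<in>{1..<Q}. {p::int. \<bar>x - of_int p / of_nat q\<bar> < \<psi> q} \<times> {q})"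
    by (intro finite_UN_I finite_cartesian_product finite_nearby_numerators) auto
  ultimately show False using assms finite_subset by (fastforce simp: W_set_def)
qed

text \<open>The Borel-Cantelli argument for Hausdorff measure: the balls around p/q with q \<ge> n
  cover the set for every n, and their cost is a tail of a convergent series.\<close>

lemma hausdorff_measure_W_set:
  assumes pos: "\<And>q. q \<ge> 1 \<Longrightarrow> \<psi> q > 0" and lim: "(\<lambda>q. real q * \<psi> q) \<longlonglongrightarrow> 0"
    and s: "s \<ge> 0" and summ: "summable (\<lambda>q. real q * \<psi> q powr s)"
  shows "hausdorff_measure s (W_set \<psi>) = 0"
  unfolding hausdorff_measure_eq_0_iff
proof (intro allI impI)
  fix \<delta> :: real assume \<delta>: "\<delta> > 0"
  \<comment> \<open>The factors account for q + 1 \<le> 2q numerators and for the diameter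
    2\<psi>(q) of a ball.\<close>
  define g where "g q = 2 * 2 powr s * (real q * \<psi> q powr s)" for q
  have g: "summable g" unfolding g_def by (intro summable_mult summ)
  have g0: "g q \<ge> 0" for q by (simp add: g_def)
  have "hausdorff_premeasure s \<delta> (W_set \<psi>) \<le> ennreal e" if e: "e > 0" for e
  proof -
    have "eventually (\<lambda>n. \<bar>\<Sum>i. g (i + n)\<bar> < e) sequentially"
      using suminf_exist_split2[OF g] e by (auto simp: tendsto_iff)
    moreover have "eventually (\<lambda>q. real q * \<psi> q < min 1 (\<delta> / 2)) sequentially"
      using lim \<delta> by (intro order_tendstoD) auto
    ultimately have "eventually (\<lambda>n. \<bar>\<Sum>i. g (i + n)\<bar> < e \<and> (\<forall>q\<ge>n. real q * \<psi> q < min 1 (\<delta> / 2)) \<and> n \<ge> 1) sequentially"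
      using eventually_ge_at_top[of 1] by (auto simp: eventually_all_ge_at_top eventually_conj_iff)
    then obtain n where n: "\<bar>\<Sum>i. g (i + n)\<bar> < e" "\<And>q. q \<ge> n \<Longrightarrow> real q * \<psi> q < min 1 (\<delta> / 2)" "n \<ge> 1"
      by (auto simp: eventually_sequentially)
    define A where "A k = {x. 0 \<le> x \<and> x < 1 \<and> (\<exists>p::int. \<bar>x - of_int p / of_nat (k + n)\<bar> < \<psi> (k + n))}" for k
    have Ak: "hausdorff_premeasure s \<delta> (A k) \<le> ennreal (g (k + n))" for k
    proof -
      define q where "q = k + n"
      have q: "q \<ge> 1" "real q * \<psi> q < 1" "real q * \<psi> q < \<delta> / 2" "\<psi> q > 0"
        using n(2)[of q] n(3) pos by (auto simp: q_def)
      have "1 * \<psi> q \<le> real q * \<psi> q" using q by (intro mult_right_mono) auto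
      then have \<psi>\<delta>: "2 * \<psi> q \<le> \<delta>" using q by linarith
      have "hausdorff_premeasure s \<delta> (A k) \<le> (\<Sum>p\<in>{0..int q}. diam_powr s (ball (of_int p / real q) (\<psi> q)))"
      proof (rule hausdorff_premeasure_finite_cover)
        show "A k \<subseteq> (\<Union>p\<in>{0..int q}. ball (of_int p / real q) (\<psi> q))"
        proof
          fix x assume "x \<in> A k"
          then obtain p :: int where p: "0 \<le> x" "x < 1" "\<bar>x - of_int p / real q\<bar> < \<psi> q"
            by (auto simp: A_def q_def)
          have "of_int p / real q < 1 + \<psi> q" "of_int p / real q > - \<psi> q" using p by linarith+
          \<comment> \<open>Since q \<psi>(q) < 1, only the numerators 0, ..., q can reach a point
            of the unit interval.\<close>
          then have "of_int p < real q + 1" "of_int p > (-1::real)"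
            using q by (auto simp: field_simps)
          then have "p \<in> {0..int q}" by auto
          then show "x \<in> (\<Union>p\<in>{0..int q}. ball (of_int p / real q) (\<psi> q))" using p
            by (auto simp: dist_real_def abs_minus_commute)
        qed
      qed (use q \<psi>\<delta> \<delta> in auto)
      also have "\<dots> \<le> (\<Sum>p\<in>{0..int q}. ennreal ((2 * \<psi> q) powr s))"
        using q s by (intro sum_mono diam_powr_le) auto
      also have "\<dots> = ennreal (real (q + 1) * (2 * \<psi> q) powr s)"
        by (simp add: ennreal_mult' ennreal_of_nat_eq_real_of_nat add.commute)
      also have "\<dots> \<le> ennreal (g q)"
      proof (intro ennreal_leI)
        have "real (q + 1) * (2 * \<psi> q) powr s \<le> (2 * real q) * (2 * \<psi> q) powr s"
          using q by (intro mult_right_mono) auto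
        also have "\<dots> = g q" using q by (simp add: g_def powr_mult)
        finally show "real (q + 1) * (2 * \<psi> q) powr s \<le> g q" .
      qed
      finally show ?thesis by (simp add: q_def)
    qed
    have "W_set \<psi> \<subseteq> (\<Union>k. A k)"
    proof
      fix x assume x: "x \<in> W_set \<psi>"
      obtain q p where "q \<ge> n" "\<bar>x - of_int p / of_nat q\<bar> < \<psi> q"
        using W_set_unbounded_denominators[OF x, of n] by auto
      then have "x \<in> A (q - n)" using x by (auto simp: A_def W_set_def)
      then show "x \<in> (\<Union>k. A k)" by blast
    qed
    then have "hausdorff_premeasure s \<delta> (W_set \<psi>) \<le> hausdorff_premeasure s \<delta> (\<Union>k. A k)"
      by (rule hausdorff_premeasure_mono)
    also have "\<dots> \<le> (\<Sum>k. hausdorff_premeasure s \<delta> (A k))"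
      by (rule hausdorff_premeasure_UN[OF \<delta>])
    also have "\<dots> \<le> (\<Sum>k. ennreal (g (k + n)))"
      by (intro suminf_le Ak) auto
    also have "\<dots> = ennreal (\<Sum>k. g (k + n))"
      using g g0 by (intro suminf_ennreal2 summable_ignore_initial_segment) auto
    also have "\<dots> \<le> ennreal e" using n(1) by (intro ennreal_leI) auto
    finally show ?thesis by simp
  qed
  then show "hausdorff_premeasure s \<delta> (W_set \<psi>) = 0" by (rule ennreal_eq_0I)
qed

text \<open>Volume comparison: disjoint balls with centres in a bounded set have bounded total
  volume, so the sum of r^d is bounded in dimension d, and the surplus exponent contributes
  \<delta>^(s-d), which tends to 0.\<close>

lemma packing_premeasure_bounded_set:
  fixes A :: "'a::euclidean_space set" and s :: real
  assumes "bounded A" "s > DIM('a)"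
  shows "packing_premeasure s A = 0"
proof -
  obtain R where R: "R > 0" "A \<subseteq> cball 0 R" using assms(1) by (auto simp: bounded_pos subset_iff)
  define C where "C = unit_ball_vol DIM('a) * (R + 1) ^ DIM('a)"
  define K where "K = 2 powr s * (R + 1) ^ DIM('a)"
  have vol0: "unit_ball_vol (real DIM('a)) > 0" by (intro unit_ball_vol_pos) simp
  have bound: "(\<Sum>\<^sub>\<infinity>(x, r)\<in>B. ennreal ((2 * r) powr s)) \<le> ennreal (\<delta> powr (s - DIM('a)) * K)"
    if \<delta>: "0 < \<delta>" "\<delta> \<le> 1" and B: "is_packing \<delta> A B" for \<delta> B
  proof (rule infsum_le_finite_sums)
    fix F assume F: "finite F" "F \<subseteq> B"
    have F': "x \<in> A" "0 < r" "r \<le> \<delta>" if "(x, r) \<in> F" for x r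
      using that F B by (auto simp: is_packing_def)
    have "disjoint_family_on (\<lambda>(x, r). cball x r) F"
      using B F unfolding is_packing_def by (blast intro: disjoint_family_on_mono)
    then have "(\<Sum>xr\<in>F. emeasure lborel (case xr of (x, r) \<Rightarrow> cball x r)) = emeasure lborel (\<Union>xr\<in>F. case xr of (x, r) \<Rightarrow> cball x r)"
      using F by (intro sum_emeasure) (auto split: prod.splits)
    also have "\<dots> \<le> emeasure lborel (cball (0::'a) (R + 1))"
    proof (intro emeasure_mono)
      show "(\<Union>xr\<in>F. case xr of (x, r) \<Rightarrow> cball x r) \<subseteq> cball 0 (R + 1)"
      proof safe
        fix x r y assume xr: "(x, r) \<in> F" "y \<in> cball x r"
        have "norm y \<le> norm x + dist x y" using norm_triangle_sub[of y x] by (simp add: dist_norm norm_minus_commute)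
        moreover have "norm x \<le> R" using F'(1)[OF xr(1)] R by auto
        ultimately show "y \<in> cball 0 (R + 1)" using F'(3)[OF xr(1)] xr(2) \<delta> by auto
      qed
    qed simp
    also have "\<dots> = ennreal C" using R by (simp add: emeasure_cball C_def)
    also have "(\<Sum>xr\<in>F. emeasure lborel (case xr of (x, r) \<Rightarrow> cball x r)) = (\<Sum>(x,r)\<in>F. ennreal (unit_ball_vol DIM('a) * r ^ DIM('a)))"
      by (intro sum.cong) (auto simp: emeasure_cball F' less_imp_le)
    also have "\<dots> = ennreal (\<Sum>(x,r)\<in>F. unit_ball_vol DIM('a) * r ^ DIM('a))"
      using vol0 by (subst sum_ennreal[symmetric]) (auto simp: case_prod_beta F' less_imp_le intro!: sum.cong mult_nonneg_nonneg zero_le_power)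
    finally have "(\<Sum>(x,r)\<in>F. unit_ball_vol DIM('a) * r ^ DIM('a)) \<le> C"
      using R vol0 by (subst (asm) ennreal_le_iff) (auto simp: C_def)
    then have "unit_ball_vol DIM('a) * (\<Sum>(x,r)\<in>F. r ^ DIM('a)) \<le> unit_ball_vol DIM('a) * (R + 1) ^ DIM('a)"
      by (simp add: C_def sum_distrib_left case_prod_beta)
    then have vol: "(\<Sum>(x,r)\<in>F. r ^ DIM('a)) \<le> (R + 1) ^ DIM('a)" using vol0 by simp
    have "(2 * r) powr s \<le> 2 powr s * \<delta> powr (s - DIM('a)) * r ^ DIM('a)" if "(x, r) \<in> F" for x r
    proof -
      have "(2 * r) powr s = 2 powr s * (r powr (s - DIM('a)) * r powr DIM('a))"
        using F'[OF that] by (simp add: powr_mult powr_add[symmetric])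
      also have "\<dots> \<le> 2 powr s * (\<delta> powr (s - DIM('a)) * r powr DIM('a))"
        using F'[OF that] assms by (intro mult_left_mono mult_right_mono powr_mono2) auto
      finally show ?thesis using F'[OF that] by (simp add: powr_realpow)
    qed
    then have "(\<Sum>(x,r)\<in>F. (2 * r) powr s) \<le> (\<Sum>(x,r)\<in>F. 2 powr s * \<delta> powr (s - DIM('a)) * r ^ DIM('a))"
      by (intro sum_mono) auto
    also have "\<dots> = 2 powr s * \<delta> powr (s - DIM('a)) * (\<Sum>(x,r)\<in>F. r ^ DIM('a))"
      by (simp add: sum_distrib_left case_prod_beta)
    also have "\<dots> \<le> 2 powr s * \<delta> powr (s - DIM('a)) * (R + 1) ^ DIM('a)"
      by (intro mult_left_mono vol) auto
    also have "\<dots> = \<delta> powr (s - DIM('a)) * K" by (simp add: K_def)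
    finally show "(\<Sum>(x,r)\<in>F. ennreal ((2 * r) powr s)) \<le> ennreal (\<delta> powr (s - DIM('a)) * K)"
      by (simp add: case_prod_beta sum_ennreal ennreal_leI)
  qed (rule nonneg_summable_on_complete, simp)
  have "packing_premeasure s A \<le> ennreal e" if e: "e > 0" for e
  proof -
    have "((\<lambda>\<delta>. \<delta> powr (s - DIM('a)) * K) \<longlongrightarrow> 0 powr (s - DIM('a)) * K) (at_right 0)"
      using assms by (intro tendsto_intros) (auto simp: eventually_at_filter)
    then have "eventually (\<lambda>\<delta>. \<delta> powr (s - DIM('a)) * K < e) (at_right 0)"
      by (rule order_tendstoD) (use e in simp)
    moreover have "eventually (\<lambda>\<delta>::real. 0 < \<delta> \<and> \<delta> < 1) (at_right 0)"
      by (rule eventually_mono[OF eventually_at_right_real[of 0 1]]) auto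
    ultimately have "eventually (\<lambda>\<delta>. \<delta> powr (s - DIM('a)) * K < e \<and> 0 < \<delta> \<and> \<delta> < 1) (at_right 0)"
      by (rule eventually_conj)
    then obtain \<delta> where \<delta>: "0 < \<delta>" "\<delta> < 1" "\<delta> powr (s - DIM('a)) * K < e"
      using eventually_happens'[OF trivial_limit_at_right_real] by blast
    have "packing_premeasure s A \<le> (SUP B\<in>{B. is_packing \<delta> A B}. \<Sum>\<^sub>\<infinity>(x, r)\<in>B. ennreal ((2 * r) powr s))"
      unfolding packing_premeasure_def using \<delta> by (intro INF_lower) auto
    also have "\<dots> \<le> ennreal (\<delta> powr (s - DIM('a)) * K)" using \<delta> by (intro SUP_least bound) auto
    also have "\<dots> \<le> ennreal e" using \<delta> by (intro ennreal_leI) auto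
    finally show ?thesis by simp
  qed
  then show ?thesis by (rule ennreal_eq_0I)
qed

lemma packing_dim_bounded_le:
  fixes A :: "'a::euclidean_space set"
  assumes "bounded A"
  shows "packing_dim A \<le> of_nat DIM('a)"
proof -
  have null: "packing_measure s A = 0" if "s > DIM('a)" for s :: real
  proof -
    define F where "F n = (if n = 0 then A else {})" for n :: nat
    have "packing_measure s A \<le> (\<Sum>n. packing_premeasure s (F n))"
      unfolding packing_measure_def by (intro INF_lower) (auto simp: F_def split: if_splits)
    moreover have "packing_premeasure s (F n) = 0" for n
      using assms that by (intro packing_premeasure_bounded_set) (auto simp: F_def)
    ultimately show ?thesis by simp
  qed
  have "packing_dim A \<le> ennreal DIM('a) + ennreal e" if "e > 0" for e
  proof -
    have "packing_dim A \<le> ennreal (DIM('a) + e)"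
      unfolding packing_dim_def using null[of "DIM('a) + e"] that
      by (intro Inf_lower CollectI exI[of _ "DIM('a) + e"]) auto
    then show ?thesis using that by simp
  qed
  then have "packing_dim A \<le> ennreal DIM('a)" by (rule ennreal_le_epsilon)
  then show ?thesis by (simp add: ennreal_of_nat_eq_real_of_nat)
qed

section \<open>Cantor towers\<close>

text \<open>The same number of successors below every member makes normalised counting consistent
  from level to level; it takes the place of a mass distribution.\<close>

definition refines :: "nat \<Rightarrow> real set set \<Rightarrow> real set set \<Rightarrow> bool" where
  "refines n F F' \<longleftrightarrow> (\<forall>J'\<in>F'. \<exists>J\<in>F. J' \<subseteq> J) \<and> (\<forall>J\<in>F. card {J'\<in>F'. J' \<subseteq> J} = n)"

definition meeting :: "real set set \<Rightarrow> real \<Rightarrow> real \<Rightarrow> real set set" where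
  "meeting F c r = {J\<in>F. J \<inter> {c-r..c+r} \<noteq> {}}"

definition cantor_family :: "real set set \<Rightarrow> bool" where
  "cantor_family F \<longleftrightarrow> finite F \<and> F \<noteq> {} \<and> disjoint F \<and> (\<forall>J\<in>F. compact J \<and> J \<noteq> {})"

lemma cantor_familyD:
  assumes "cantor_family F"
  shows "finite F" "F \<noteq> {}" "disjoint F" "J \<in> F \<Longrightarrow> compact J" "J \<in> F \<Longrightarrow> J \<noteq> {}"
    "card F > 0"
  using assms by (auto simp: cantor_family_def card_gt_0_iff)

text \<open>Needed for the coordinates that are left alone at a stage: they pass on with one
  successor each.\<close>

lemma refines_refl: "cantor_family F \<Longrightarrow> refines 1 F F"
proof -
  assume F: "cantor_family F"
  have "{J'\<in>F. J' \<subseteq> J} = {J}" if "J \<in> F" for J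
  proof -
    have "J' = J" if "J' \<in> F" "J' \<subseteq> J" for J'
    proof (rule ccontr)
      assume "J' \<noteq> J"
      then have "J' \<inter> J = {}" using cantor_familyD(3)[OF F] that \<open>J \<in> F\<close> by (auto simp: disjoint_def)
      then show False using cantor_familyD(5)[OF F that(1)] that by auto
    qed
    then show ?thesis using that by auto
  qed
  then show ?thesis by (auto simp: refines_def)
qed

lemma refines_unique_parent:
  assumes "cantor_family F" "J1 \<in> F" "J2 \<in> F" "J' \<noteq> {}" "J' \<subseteq> J1" "J' \<subseteq> J2"
  shows "J1 = J2"
  using assms(2-6) cantor_familyD(3)[OF assms(1)] unfolding disjoint_def by blast

lemma refines_card_subset:
  assumes F: "cantor_family F" and F': "cantor_family F'" and ref: "refines n F F'" and G: "G \<subseteq> F"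
  shows "card {J'\<in>F'. \<exists>J\<in>G. J' \<subseteq> J} = n * card G"
proof -
  have "{J'\<in>F'. \<exists>J\<in>G. J' \<subseteq> J} = (\<Union>J\<in>G. {J'\<in>F'. J' \<subseteq> J})" by auto
  also have "card \<dots> = (\<Sum>J\<in>G. card {J'\<in>F'. J' \<subseteq> J})"
  proof (rule card_UN_disjoint)
    show "finite G" using G cantor_familyD(1)[OF F] finite_subset by blast
    show "\<forall>J\<in>G. finite {J'\<in>F'. J' \<subseteq> J}" using cantor_familyD(1)[OF F'] by auto
    show "\<forall>J1\<in>G. \<forall>J2\<in>G. J1 \<noteq> J2 \<longrightarrow> {J'\<in>F'. J' \<subseteq> J1} \<inter> {J'\<in>F'. J' \<subseteq> J2} = {}"
    proof (intro ballI impI, rule ccontr)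
      fix J1 J2 assume J: "J1 \<in> G" "J2 \<in> G" "J1 \<noteq> J2" "{J'\<in>F'. J' \<subseteq> J1} \<inter> {J'\<in>F'. J' \<subseteq> J2} \<noteq> {}"
      then obtain J' where J': "J' \<in> F'" "J' \<subseteq> J1" "J' \<subseteq> J2" by auto
      then show False using refines_unique_parent[OF F, of J1 J2 J'] J G cantor_familyD(5)[OF F'] by blast
    qed
  qed
  also have "\<dots> = n * card G" using ref G by (subst sum.cong[OF refl, of _ _ "\<lambda>_. n"]) (auto simp: refines_def)
  finally show ?thesis .
qed

lemma refines_card:
  assumes F: "cantor_family F" and F': "cantor_family F'" and ref: "refines n F F'"
  shows "card F' = n * card F"
proof -
  have "{J'\<in>F'. \<exists>J\<in>F. J' \<subseteq> J} = F'" using ref by (auto simp: refines_def)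
  then show ?thesis using refines_card_subset[OF F F' ref order.refl] by simp
qed

lemma refines_pos:
  assumes F: "cantor_family F" and F': "cantor_family F'" and ref: "refines n F F'"
  shows "n > 0"
  using refines_card[OF assms] cantor_familyD(6)[OF F'] by (cases n) auto

lemma refines_trans:
  assumes F: "cantor_family F" and F': "cantor_family F'" and F'': "cantor_family F''"
    and ref: "refines n F F'" "refines n' F' F''"
  shows "refines (n' * n) F F''"
  unfolding refines_def
proof (intro conjI ballI)
  fix J'' assume "J'' \<in> F''"
  then show "\<exists>J\<in>F. J'' \<subseteq> J" using ref unfolding refines_def by (meson order_trans)
next
  fix J assume J: "J \<in> F"
  have "{J''\<in>F''. J'' \<subseteq> J} = {J''\<in>F''. \<exists>J'\<in>{J'\<in>F'. J' \<subseteq> J}. J'' \<subseteq> J'}"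
  proof (intro equalityI subsetI)
    fix J'' assume J'': "J'' \<in> {J''\<in>F''. J'' \<subseteq> J}"
    then obtain J' where J': "J' \<in> F'" "J'' \<subseteq> J'" using ref(2) by (auto simp: refines_def)
    then obtain J1 where J1: "J1 \<in> F" "J' \<subseteq> J1" using ref(1) by (auto simp: refines_def)
    have "J1 = J" using refines_unique_parent[OF F, of J1 J J''] J1 J J' J'' cantor_familyD(5)[OF F''] by auto
    then show "J'' \<in> {J''\<in>F''. \<exists>J'\<in>{J'\<in>F'. J' \<subseteq> J}. J'' \<subseteq> J'}" using J' J1 J'' by auto
  qed auto
  also have "card \<dots> = n' * card {J'\<in>F'. J' \<subseteq> J}"
    by (rule refines_card_subset[OF F' F'' ref(2)]) auto
  also have "\<dots> = n' * n" using ref(1) J by (simp add: refines_def)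
  finally show "card {J''\<in>F''. J'' \<subseteq> J} = n' * n" .
qed

text \<open>The parent of an interval meeting the window meets it too, and all parents have
  \<open>n\<close> successors, so the proportion \<beta> is inherited. This makes an estimate at one
  level permanent.\<close>

lemma refines_meeting:
  assumes F: "cantor_family F" and F': "cantor_family F'" and ref: "refines n F F'"
    and le: "real (card (meeting F c r)) \<le> \<beta> * real (card F)"
  shows "real (card (meeting F' c r)) \<le> \<beta> * real (card F')"
proof -
  have "meeting F' c r \<subseteq> {J'\<in>F'. \<exists>J\<in>meeting F c r. J' \<subseteq> J}"
  proof
    fix J' assume J': "J' \<in> meeting F' c r"
    then have "J' \<in> F'" by (simp add: meeting_def)
    then obtain J where "J \<in> F" "J' \<subseteq> J" using ref unfolding refines_def by blast
    then show "J' \<in> {J'\<in>F'. \<exists>J\<in>meeting F c r. J' \<subseteq> J}" using J' by (auto simp: meeting_def)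
  qed
  then have "card (meeting F' c r) \<le> card {J'\<in>F'. \<exists>J\<in>meeting F c r. J' \<subseteq> J}"
    using cantor_familyD(1)[OF F'] by (intro card_mono) auto
  also have "\<dots> = n * card (meeting F c r)"
    by (rule refines_card_subset[OF F F' ref]) (auto simp: meeting_def)
  finally have "real (card (meeting F' c r)) \<le> real n * real (card (meeting F c r))"
    by (metis of_nat_le_iff of_nat_mult)
  also have "\<dots> \<le> real n * (\<beta> * real (card F))" using le by (intro mult_left_mono) auto
  finally show ?thesis by (simp add: refines_card[OF F F' ref] mult_ac)
qed

section \<open>Limit sets of towers, studied by counting boxes\<close>

locale cantor_tower =
  fixes S :: "nat \<Rightarrow> 'm::finite \<Rightarrow> real set set"
  assumes family: "cantor_family (S t i)"
    and ref1: "\<exists>n. refines n (S t i) (S (Suc t) i)"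
begin

lemma ref: "t \<le> T \<Longrightarrow> \<exists>n. refines n (S t i) (S T i)"
proof (induction rule: dec_induct)
  case base
  show ?case using refines_refl[OF family] by blast
next
  case (step T)
  then show ?case using ref1[of T i] refines_trans[OF family family family] by blast
qed

definition limit :: "'m \<Rightarrow> real set" where "limit i = (\<Inter>t. \<Union>(S t i))"

definition limit_set :: "(real^'m) set" where "limit_set = {x. \<forall>i. x $ i \<in> limit i}"

lemma compact_level: "compact (\<Union>(S t i))"
  using cantor_familyD[OF family] by (intro compact_Union) auto

lemma level_antimono: "t \<le> T \<Longrightarrow> \<Union>(S T i) \<subseteq> \<Union>(S t i)"
  using ref[of t T i] by (auto simp: refines_def) (meson subsetD)

lemma compact_limit: "compact (limit i)"
proof -
  have "limit i = \<Union>(S 0 i) \<inter> (\<Inter>t. \<Union>(S t i))" unfolding limit_def by auto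
  then show ?thesis using compact_level compact_imp_closed by (metis closed_INT compact_Int_closed)
qed

lemma compact_limit_set: "compact limit_set"
proof -
  have "closed limit_set"
  proof -
    have "limit_set = (\<Inter>i. (\<lambda>x. x $ i) -` limit i)" by (auto simp: limit_set_def)
    moreover have "closed ((\<lambda>x::real^'m. x $ i) -` limit i)" for i
      using compact_limit compact_imp_closed by (intro closed_vimage continuous_intros) auto
    ultimately show ?thesis by auto
  qed
  moreover have "bounded limit_set"
  proof -
    have "\<exists>B. \<forall>x\<in>limit i. norm x \<le> B" for i
      using compact_imp_bounded[OF compact_limit[of i]] by (auto simp: bounded_iff)
    then obtain B where B: "\<And>i x. x \<in> limit i \<Longrightarrow> norm x \<le> B i" by metis
    have "norm x \<le> (\<Sum>i\<in>UNIV. B i)" if "x \<in> limit_set" for x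
    proof -
      have "norm x \<le> (\<Sum>i\<in>UNIV. \<bar>x $ i\<bar>)" by (rule norm_le_l1_cart)
      also have "\<dots> \<le> (\<Sum>i\<in>UNIV. B i)" using B that by (intro sum_mono) (force simp: limit_set_def)
      finally show ?thesis .
    qed
    then show ?thesis by (auto simp: bounded_iff)
  qed
  ultimately show ?thesis by (simp add: compact_eq_bounded_closed)
qed

text \<open>Every member has a successor at each level because \<open>n > 0\<close>; a chain of
  successors is a nested sequence of nonempty compact sets.\<close>

lemma limit_meets_member:
  assumes "J \<in> S t i"
  shows "J \<inter> limit i \<noteq> {}"
proof -
  have "\<exists>C. C 0 = J \<and> (\<forall>k. C k \<in> S (t + k) i) \<and> (\<forall>k. C (Suc k) \<subseteq> C k)"
  proof -
    \<comment> \<open>The clause for k = 0 pins the start of the chain to \<open>J\<close>, since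
      \<open>dependent_nat_choice\<close> leaves the first term free.\<close>
    have "\<exists>C. \<forall>k. (C k \<in> S (t + k) i \<and> (k = 0 \<longrightarrow> C k = J)) \<and> C (Suc k) \<subseteq> C k"
    proof (rule dependent_nat_choice)
      fix C k assume C: "C \<in> S (t + k) i \<and> (k = 0 \<longrightarrow> C = J)"
      obtain n where n: "refines n (S (t + k) i) (S (Suc (t + k)) i)" using ref1 by blast
      have "n > 0" by (rule refines_pos[OF family family n])
      then have "card {J'\<in>S (Suc (t + k)) i. J' \<subseteq> C} > 0" using n C by (auto simp: refines_def)
      then have "{J'\<in>S (Suc (t + k)) i. J' \<subseteq> C} \<noteq> {}" by (metis card.empty less_irrefl)
      then show "\<exists>C'. (C' \<in> S (t + Suc k) i \<and> (Suc k = 0 \<longrightarrow> C' = J)) \<and> C' \<subseteq> C" by auto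
    qed (use assms in auto)
    then show ?thesis by blast
  qed
  then obtain C where C: "C 0 = J" "\<And>k. C k \<in> S (t + k) i" "\<And>k. C (Suc k) \<subseteq> C k" by blast
  have anti: "C m \<subseteq> C n" if "n \<le> m" for m n using lift_Suc_antimono_le[of C, OF C(3) that] .
  have "(\<Inter>k. C k) \<noteq> {}"
    using C cantor_familyD(4,5)[OF family] anti by (intro compact_nest) blast+
  then obtain y where y: "\<And>k. y \<in> C k" by blast
  have "y \<in> \<Union>(S T i)" for T
  proof -
    have "y \<in> \<Union>(S (t + T) i)" using y C(2) by blast
    then show ?thesis using level_antimono[of T "t + T" i] by auto
  qed
  then have "y \<in> limit i" by (auto simp: limit_def)
  then show ?thesis using y[of 0] C(1) by auto
qed

lemma limit_set_meets_box:
  assumes "\<And>i. g i \<in> S t i"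
  shows "\<exists>y\<in>limit_set. \<forall>i. y $ i \<in> g i"
proof -
  have "\<forall>i. \<exists>y. y \<in> g i \<inter> limit i" using limit_meets_member[OF assms] by blast
  then obtain y where "\<And>i. y i \<in> g i \<inter> limit i" by metis
  then show ?thesis by (intro bexI[of _ "\<chi> i. y i"]) (auto simp: limit_set_def)
qed

lemma limit_set_nonempty: "limit_set \<noteq> {}"
proof -
  have *: "(SOME J. J \<in> S 0 i) \<in> S 0 i" for i
    using cantor_familyD(2)[OF family] by (simp add: some_in_eq)
  show ?thesis using limit_set_meets_box[OF *] by auto
qed

text \<open>By \<open>card_boxes_meeting\<close>, a cube of half-side \<open>r\<close> meets at most
  the proportion \<beta> of the boxes of level \<open>T\<close>: the counting form of a bound
  \<mu>(cube) \<le> \<beta>. Only the product is bounded, so that a poor estimate in one coordinate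
  can be offset by the others.\<close>

definition thin :: "nat \<Rightarrow> real \<Rightarrow> real \<Rightarrow> bool" where
  "thin T r \<beta> \<longleftrightarrow> (\<forall>c. (\<Prod>i\<in>UNIV. real (card (meeting (S T i) (c i) r))) \<le> \<beta> * (\<Prod>i\<in>UNIV. real (card (S T i))))"

text \<open>The coordinates may reach their estimates at different levels \<open>T i\<close>; by
  \<open>refines_meeting\<close> all of them can be moved to a common later level.\<close>

lemma thinI:
  assumes "\<And>i c. real (card (meeting (S (T i) i) c r)) \<le> \<beta> i * real (card (S (T i) i))" "\<And>i. T i \<le> T'"
  shows "thin T' r (\<Prod>i\<in>UNIV. \<beta> i)"
  unfolding thin_def
proof
  fix c :: "'m \<Rightarrow> real"
  have "real (card (meeting (S T' i) (c i) r)) \<le> \<beta> i * real (card (S T' i))" for i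
    using ref[OF assms(2)[of i], of i] refines_meeting[OF family family _ assms(1)] by blast
  then have "(\<Prod>i\<in>UNIV. real (card (meeting (S T' i) (c i) r))) \<le> (\<Prod>i\<in>UNIV. \<beta> i * real (card (S T' i)))"
    by (intro prod_mono) auto
  then show "(\<Prod>i\<in>UNIV. real (card (meeting (S T' i) (c i) r))) \<le> (\<Prod>i\<in>UNIV. \<beta> i) * (\<Prod>i\<in>UNIV. real (card (S T' i)))"
    by (simp add: prod.distrib)
qed

lemma thin_mono:
  assumes "thin T r \<beta>" "T \<le> T'"
  shows "thin T' r \<beta>"
  unfolding thin_def
proof
  fix c :: "'m \<Rightarrow> real"
  have "\<forall>i. \<exists>n. refines n (S T i) (S T' i)" using ref[OF assms(2)] by blast
  then obtain n where n: "\<And>i. refines (n i) (S T i) (S T' i)" by metis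
  have card: "real (card (S T' i)) = real (n i) * real (card (S T i))" for i
    using refines_card[OF family family n] by simp
  have "real (card (meeting (S T' i) (c i) r)) \<le> real (n i) * real (card (meeting (S T i) (c i) r))" for i
  proof -
    \<comment> \<open>Only the product is known to be small, so each coordinate is transported with
      its actual proportion.\<close>
    define \<gamma> where "\<gamma> = real (card (meeting (S T i) (c i) r)) / real (card (S T i))"
    have pos: "real (card (S T i)) > 0" using cantor_familyD(6)[OF family] by simp
    have "real (card (meeting (S T' i) (c i) r)) \<le> \<gamma> * real (card (S T' i))"
      by (rule refines_meeting[OF family family n]) (use pos in \<open>simp add: \<gamma>_def\<close>)
    then show ?thesis using pos by (simp add: \<gamma>_def card mult.commute)
  qed
  then have "(\<Prod>i\<in>UNIV. real (card (meeting (S T' i) (c i) r))) \<le> (\<Prod>i\<in>UNIV. real (n i) * real (card (meeting (S T i) (c i) r)))"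
    by (intro prod_mono) auto
  also have "\<dots> = (\<Prod>i\<in>UNIV. real (n i)) * (\<Prod>i\<in>UNIV. real (card (meeting (S T i) (c i) r)))"
    by (rule prod.distrib)
  also have "\<dots> \<le> (\<Prod>i\<in>UNIV. real (n i)) * (\<beta> * (\<Prod>i\<in>UNIV. real (card (S T i))))"
    using assms(1) by (intro mult_left_mono prod_nonneg) (auto simp: thin_def)
  also have "\<dots> = \<beta> * (\<Prod>i\<in>UNIV. real (card (S T' i)))"
    by (simp add: card prod.distrib)
  finally show "(\<Prod>i\<in>UNIV. real (card (meeting (S T' i) (c i) r))) \<le> \<beta> * (\<Prod>i\<in>UNIV. real (card (S T' i)))" .
qed

definition boxes :: "nat \<Rightarrow> ('m \<Rightarrow> real set) set" where
  "boxes T = {g. \<forall>i. g i \<in> S T i}"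

lemma boxes_PiE: "boxes T = PiE UNIV (S T)"
  by (auto simp: boxes_def PiE_def Pi_def)

lemma finite_boxes: "finite (boxes T)"
  unfolding boxes_PiE using cantor_familyD(1)[OF family] by (intro finite_PiE) auto

lemma card_boxes: "real (card (boxes T)) = (\<Prod>i\<in>UNIV. real (card (S T i)))"
  by (simp add: boxes_PiE card_PiE)

lemma card_boxes_pos: "0 < (\<Prod>i\<in>UNIV. real (card (S T i)))"
  using cantor_familyD(6)[OF family] by (intro prod_pos) auto

lemma card_boxes_meeting:
  "real (card {g\<in>boxes T. \<forall>i. g i \<inter> {c i - r..c i + r} \<noteq> {}}) = (\<Prod>i\<in>UNIV. real (card (meeting (S T i) (c i) r)))"
proof -
  have "{g\<in>boxes T. \<forall>i. g i \<inter> {c i - r..c i + r} \<noteq> {}} = PiE UNIV (\<lambda>i. meeting (S T i) (c i) r)"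
    by (auto simp: boxes_def PiE_def Pi_def meeting_def)
  then show ?thesis by (simp add: card_PiE)
qed

text \<open>Every box is charged to a covering cube that its limit point lies in.\<close>

lemma card_boxes_le_cover:
  fixes c :: "'k \<Rightarrow> real^'m"
  assumes X: "finite X" and B: "B \<subseteq> boxes T"
    and cover: "\<And>g. g \<in> B \<Longrightarrow> \<exists>x\<in>X. \<exists>y. (\<forall>i. y $ i \<in> g i) \<and> dist (c x) y \<le> r x"
    and thin: "\<And>x. x \<in> X \<Longrightarrow> thin T (r x) (\<beta> x)"
  shows "real (card B) \<le> (\<Sum>x\<in>X. \<beta> x) * (\<Prod>i\<in>UNIV. real (card (S T i)))"
proof -
  define M where "M x = {g\<in>boxes T. \<forall>i. g i \<inter> {c x $ i - r x..c x $ i + r x} \<noteq> {}}" for x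
  have "B \<subseteq> (\<Union>x\<in>X. M x)"
  proof
    fix g assume g: "g \<in> B"
    then obtain x y where xy: "x \<in> X" "\<And>i. y $ i \<in> g i" "dist (c x) y \<le> r x" using cover by blast
    have "\<bar>c x $ i - y $ i\<bar> \<le> r x" for i
      using component_le_norm_cart[of "c x - y" i] xy(3) by (simp add: dist_norm)
    then have "y $ i \<in> g i \<inter> {c x $ i - r x..c x $ i + r x}" for i
      using xy(2)[of i] by (auto simp: abs_le_iff) (smt (verit))+
    then show "g \<in> (\<Union>x\<in>X. M x)" using g B xy(1) unfolding M_def by blast
  qed
  then have "card B \<le> card (\<Union>x\<in>X. M x)"
    using X finite_boxes by (intro card_mono) (auto simp: M_def)
  also have "\<dots> \<le> (\<Sum>x\<in>X. card (M x))" by (rule card_UN_le[OF X])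
  finally have "real (card B) \<le> (\<Sum>x\<in>X. real (card (M x)))" by (metis of_nat_le_iff of_nat_sum)
  also have "\<dots> \<le> (\<Sum>x\<in>X. \<beta> x * (\<Prod>i\<in>UNIV. real (card (S T i))))"
    using thin unfolding M_def card_boxes_meeting thin_def by (intro sum_mono) blast
  finally show ?thesis by (simp add: sum_distrib_right)
qed

text \<open>The mass distribution principle without a mass: compactness leaves finitely many balls
  of a cheap cover, one level is late enough for all their radii, and charging every box of that
  level to a ball gives 1 \<le> sum of \<rho>^\<sigma>.\<close>

lemma hausdorff_measure_limit_set:
  assumes \<sigma>: "\<sigma> \<ge> 0" and R: "R > 0" and thin: "\<And>r. 0 < r \<Longrightarrow> r \<le> R \<Longrightarrow> \<exists>T. thin T r (r powr \<sigma>)"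
  shows "hausdorff_measure \<sigma> limit_set \<noteq> 0"
proof
  assume "hausdorff_measure \<sigma> limit_set = 0"
  from hausdorff_null_cover[OF this \<sigma> R, of 1] obtain U \<rho> where
    U: "limit_set \<subseteq> (\<Union>n::nat. U n)" "\<And>n. bounded (U n)" "\<And>n. diameter (U n) < \<rho> n" "\<And>n. 0 < \<rho> n" "\<And>n. \<rho> n < R"
    and sum: "(\<Sum>n. if U n = {} then 0 else ennreal (\<rho> n powr \<sigma>)) < ennreal 1" by auto
  define c where "c n = (SOME x. x \<in> U n)" for n
  define I where "I = {n. U n \<noteq> {}}"
  have sub: "U n \<subseteq> ball (c n) (\<rho> n)" if "n \<in> I" for n
  proof
    fix x assume "x \<in> U n"
    moreover have "c n \<in> U n" using that unfolding I_def c_def by (simp add: some_in_eq)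
    ultimately have "dist (c n) x \<le> diameter (U n)" using U(2) by (intro diameter_bounded_bound)
    then show "x \<in> ball (c n) (\<rho> n)" using U(3)[of n] by simp
  qed
  have "limit_set \<subseteq> (\<Union>n\<in>I. ball (c n) (\<rho> n))"
  proof
    fix x assume "x \<in> limit_set"
    then obtain n where n: "x \<in> U n" using U(1) by blast
    then have "n \<in> I" by (auto simp: I_def)
    then show "x \<in> (\<Union>n\<in>I. ball (c n) (\<rho> n))" using sub n by blast
  qed
  then obtain X where X: "X \<subseteq> I" "finite X" "limit_set \<subseteq> (\<Union>n\<in>X. ball (c n) (\<rho> n))"
    by (rule compactE_image[OF compact_limit_set _ , rotated]) auto
  have "\<forall>n. \<exists>T. thin T (\<rho> n) (\<rho> n powr \<sigma>)" using thin U(4,5) less_imp_le by blast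
  then obtain T where T: "\<And>n. thin (T n) (\<rho> n) (\<rho> n powr \<sigma>)" by metis
  \<comment> \<open>Inserting 0 keeps the maximum meaningful for an empty index set.\<close>
  define T' where "T' = Max (insert 0 (T ` X))"
  have T': "thin T' (\<rho> n) (\<rho> n powr \<sigma>)" if "n \<in> X" for n
    using that X by (intro thin_mono[OF T]) (auto simp: T'_def)
  have "real (card (boxes T')) \<le> (\<Sum>n\<in>X. \<rho> n powr \<sigma>) * (\<Prod>i\<in>UNIV. real (card (S T' i)))"
  proof (rule card_boxes_le_cover[OF X(2) order.refl _ T'])
    fix g assume "g \<in> boxes T'"
    then obtain y where y: "y \<in> limit_set" "\<And>i. y $ i \<in> g i" using limit_set_meets_box[of g T'] by (auto simp: boxes_def)
    then obtain n where "n \<in> X" "y \<in> ball (c n) (\<rho> n)" using X(3) by blast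
    then show "\<exists>n\<in>X. \<exists>y. (\<forall>i. y $ i \<in> g i) \<and> dist (c n) y \<le> \<rho> n" using y by (auto intro!: bexI[of _ n] exI[of _ y])
  qed
  then have "1 \<le> (\<Sum>n\<in>X. \<rho> n powr \<sigma>)" using card_boxes_pos[of T'] by (simp add: card_boxes)
  then have "ennreal 1 \<le> ennreal (\<Sum>n\<in>X. \<rho> n powr \<sigma>)" by (rule ennreal_leI)
  also have "\<dots> = (\<Sum>n\<in>X. ennreal (\<rho> n powr \<sigma>))" by (rule sum_ennreal[symmetric]) simp
  also have "\<dots> = (\<Sum>n\<in>X. if U n = {} then 0 else ennreal (\<rho> n powr \<sigma>))"
    using X(1) by (intro sum.cong) (auto simp: I_def)
  also have "\<dots> \<le> (\<Sum>n. if U n = {} then 0 else ennreal (\<rho> n powr \<sigma>))"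
    by (rule sum_le_suminf) (use X(2) in auto)
  finally show False using sum by simp
qed


text \<open>By Baire, some piece of any countable cover is dense in a nonempty relatively open part
  of the limit set. Thinness with exponent \<kappa> > s forces roughly r^-\<kappa> points at mutual
  distance r there, and these yield a packing with large sum. One suitable scale below each \<delta>
  is enough, so thinness is required only along arbitrarily small radii.\<close>

lemma packing_measure_limit_set:
  assumes s: "0 \<le> s" "s < \<kappa>"
    and small: "\<And>e. e > 0 \<Longrightarrow> \<exists>t. \<forall>i. \<forall>J\<in>S t i. diameter J < e"
    and thin: "\<And>e. e > 0 \<Longrightarrow> \<exists>r T. 0 < r \<and> r < e \<and> thin T r (r powr \<kappa>)"
  shows "packing_measure s limit_set \<noteq> 0"
proof -
  \<comment> \<open>Stated for sets that are merely dense in the open part, since Baire gives no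
    more.\<close>
  have premeasure: "1 \<le> packing_premeasure s A"
    if op: "open O'" and x0: "x0 \<in> limit_set \<inter> O'" and dense: "limit_set \<inter> O' \<subseteq> closure A" for A O' x0
    unfolding packing_premeasure_def
  proof (rule INF_greatest)
    fix \<delta> :: real assume "\<delta> \<in> {0<..}"
    then have \<delta>: "\<delta> > 0" by simp
    obtain \<rho> where \<rho>: "\<rho> > 0" "ball x0 \<rho> \<subseteq> O'" using op x0 by (meson IntD2 openE)
    have "\<rho> / CARD('m) > 0" using \<rho> by simp
    then obtain t where t: "\<And>i J. J \<in> S t i \<Longrightarrow> diameter J < \<rho> / CARD('m)" using small by blast
    have "\<forall>i. \<exists>J. J \<in> S t i \<and> x0 $ i \<in> J" using x0 by (auto simp: limit_set_def limit_def)
    then obtain f where f: "\<And>i. f i \<in> S t i" "\<And>i. x0 $ i \<in> f i" by metis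
    \<comment> \<open>The part of the limit set inside one box around \<open>x0\<close>, which is
      small enough to stay in the given open set.\<close>
    define K where "K = {y\<in>limit_set. \<forall>i. y $ i \<in> f i}"
    have KO: "K \<subseteq> limit_set \<inter> O'"
    proof
      fix y assume y: "y \<in> K"
      have "\<bar>(x0 - y) $ i\<bar> < \<rho> / CARD('m)" for i
      proof -
        have "bounded (f i)" using cantor_familyD(4)[OF family f(1)] compact_imp_bounded by blast
        then have "dist (x0 $ i) (y $ i) \<le> diameter (f i)"
          using f y by (intro diameter_bounded_bound) (auto simp: K_def)
        also have "\<dots> < \<rho> / CARD('m)" using t f by blast
        finally show ?thesis by (simp add: dist_real_def)
      qed
      then have "(\<Sum>i\<in>UNIV. \<bar>(x0 - y) $ i\<bar>) < (\<Sum>i\<in>(UNIV::'m set). \<rho> / CARD('m))" by (intro sum_strict_mono) auto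
      then have "dist x0 y < \<rho>" using norm_le_l1_cart[of "x0 - y"] by (simp add: dist_norm)
      then show "y \<in> limit_set \<inter> O'" using \<rho> y by (auto simp: K_def)
    qed
    define M where "M = (\<Prod>i\<in>UNIV. real (card (S t i)))"
    have M: "M > 0" unfolding M_def by (rule card_boxes_pos)
    have "((\<lambda>r. r powr (\<kappa> - s)) \<longlongrightarrow> 0) (at_right 0)"
      using s tendsto_powr2 by (intro tendsto_eq_intros) (auto simp: eventually_at_filter)
    \<comment> \<open>The factor M appears because only one of the M boxes of level \<open>t\<close>
      is used; 2 powr s comes from packing radii r/4, whose doubles are r/2.\<close>
    then have "eventually (\<lambda>r. r powr (\<kappa> - s) < 1 / (2 powr s * M)) (at_right 0)"
      by (rule order_tendstoD) (use M in simp)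
    then obtain e where e: "e > 0" "\<And>r. 0 < r \<Longrightarrow> r < e \<Longrightarrow> r powr (\<kappa> - s) < 1 / (2 powr s * M)"
      by (auto simp: eventually_at_right_field)
    obtain r T0 where r: "0 < r" "r < min e \<delta>" and T0: "thin T0 r (r powr \<kappa>)" using thin[of "min e \<delta>"] e \<delta> by auto
    define T where "T = max T0 t"
    have T: "thin T r (r powr \<kappa>)" using T0 by (rule thin_mono) (simp add: T_def)
    define sep where "sep X \<longleftrightarrow> X \<subseteq> K \<and> finite X \<and> (\<forall>x\<in>X. \<forall>y\<in>X. x \<noteq> y \<longrightarrow> r < dist x y)" for X
    have "\<exists>b. \<forall>X. sep X \<longrightarrow> card X < b"
    proof -
      have "limit_set \<subseteq> (\<Union>c\<in>limit_set. ball c (r/2))" using r by auto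
      then obtain C where C0: "C \<subseteq> limit_set" "finite C" "limit_set \<subseteq> (\<Union>c\<in>C. ball c (r/2))"
        by (rule compactE_image[OF compact_limit_set _, rotated]) auto
      then have C: "finite C" "K \<subseteq> (\<Union>c\<in>C. ball c (r/2))" by (auto simp: K_def)
      have "card X < Suc (card C)" if X: "sep X" for X
      proof -
        have "\<forall>x\<in>X. \<exists>c\<in>C. dist c x < r/2" using X C by (force simp: sep_def)
        then obtain g where g: "\<And>x. x \<in> X \<Longrightarrow> g x \<in> C \<and> dist (g x) x < r/2" by metis
        have "inj_on g X"
        proof (rule inj_onI, rule ccontr)
          fix x y assume xy: "x \<in> X" "y \<in> X" "g x = g y" "x \<noteq> y"
          have "dist x y \<le> dist (g x) x + dist (g x) y" by (rule dist_triangle3)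
          also have "\<dots> < r" using g[OF xy(1)] g[OF xy(2)] xy(3) by simp
          finally show False using X xy unfolding sep_def by force
        qed
        then have "card X \<le> card C" using g C by (intro card_inj_on_le[of g]) auto
        then show ?thesis by simp
      qed
      then show ?thesis by blast
    qed
    then obtain b where b: "\<And>X. sep X \<Longrightarrow> card X < b" by blast
    \<comment> \<open>A separated set of greatest cardinality is an r-net of \<open>K\<close>, so
      its points can serve as centres in the counting of boxes.\<close>
    have "sep {}" by (simp add: sep_def)
    then obtain X where X: "sep X" "\<And>Y. sep Y \<Longrightarrow> card Y \<le> card X"
      using ex_has_greatest_nat[of sep "{}" card b] b by (meson less_imp_le)
    have near: "\<exists>x\<in>X. dist x y \<le> r" if y: "y \<in> K" for y
    proof (rule ccontr)
      assume *: "\<not> (\<exists>x\<in>X. dist x y \<le> r)"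
      then have "y \<notin> X" using r by force
      have "sep (insert y X)" using X(1) y * by (auto simp: sep_def dist_commute not_le)
      then have "card (insert y X) \<le> card X" by (rule X(2))
      then show False using \<open>y \<notin> X\<close> X(1) by (simp add: sep_def)
    qed
    have finX: "finite X" "X \<subseteq> K" using X by (auto simp: sep_def)
    \<comment> \<open>By uniform refinement these are exactly the fraction 1/M of all boxes of level
      \<open>T\<close>.\<close>
    define B where "B = {g\<in>boxes T. \<forall>i. g i \<subseteq> f i}"
    have "t \<le> T" by (simp add: T_def)
    then have "\<forall>i. \<exists>n. refines n (S t i) (S T i)" using ref by blast
    then obtain n where n: "\<And>i. refines (n i) (S t i) (S T i)" by metis
    have cardB: "real (card B) * M = (\<Prod>i\<in>UNIV. real (card (S T i)))"
    proof -
      have "B = PiE UNIV (\<lambda>i. {J\<in>S T i. J \<subseteq> f i})" by (auto simp: B_def boxes_def PiE_def Pi_def)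
      then have "card B = (\<Prod>i\<in>UNIV. n i)"
        using n f(1) by (simp add: card_PiE refines_def)
      then show ?thesis using refines_card[OF family family n] by (simp add: M_def prod.distrib)
    qed
    have "real (card B) \<le> (\<Sum>x\<in>X. r powr \<kappa>) * (\<Prod>i\<in>UNIV. real (card (S T i)))"
    proof (rule card_boxes_le_cover[where c = "\<lambda>x. x" and r = "\<lambda>_. r", OF finX(1) _ _ T])
      show "B \<subseteq> boxes T" by (auto simp: B_def)
      fix g assume g: "g \<in> B"
      then obtain y where y: "y \<in> limit_set" "\<And>i. y $ i \<in> g i" using limit_set_meets_box[of g T] by (auto simp: boxes_def B_def)
      then have "y \<in> K" using g by (auto simp: K_def B_def)
      then show "\<exists>x\<in>X. \<exists>y. (\<forall>i. y $ i \<in> g i) \<and> dist x y \<le> r" using near y by blast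
    qed
    also have "\<dots> = real (card X) * r powr \<kappa> * (real (card B) * M)" by (simp add: cardB)
    finally have "real (card B) * 1 \<le> real (card B) * (real (card X) * r powr \<kappa> * M)" by (simp add: mult_ac)
    moreover have "real (card B) > 0" using cardB card_boxes_pos[of T] M by (metis zero_less_mult_pos2)
    ultimately have cardX: "1 \<le> real (card X) * r powr \<kappa> * M" by (simp add: mult_le_cancel_left_pos)
    \<comment> \<open>Moving each centre by less than r/8 into \<open>A\<close> leaves mutual
      distances above 3r/4, more than enough for disjoint balls of radius r/4.\<close>
    have "\<forall>x\<in>X. \<exists>a\<in>A. dist a x < r / 8"
    proof
      fix x assume "x \<in> X"
      then have "x \<in> closure A" using finX KO dense by auto
      moreover have "r / 8 > 0" using r by simp
      ultimately show "\<exists>a\<in>A. dist a x < r / 8" unfolding closure_approachable by blast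
    qed
    then obtain h where h: "\<And>x. x \<in> X \<Longrightarrow> h x \<in> A \<and> dist (h x) x < r / 8" by metis
    have hsep: "r / 2 < dist (h x) (h y)" if "x \<in> X" "y \<in> X" "x \<noteq> y" for x y
    proof -
      have "r < dist x y" using that X(1) by (auto simp: sep_def)
      moreover have "dist x y \<le> dist (h x) x + dist (h x) (h y) + dist (h y) y"
        by (smt (verit) dist_commute dist_triangle)
      ultimately show ?thesis using h[OF that(1)] h[OF that(2)] r by linarith
    qed
    have inj: "inj_on (\<lambda>x. (h x, r / 4)) X"
      using hsep r by (force intro!: inj_onI)
    define P where "P = (\<lambda>x. (h x, r / 4)) ` X"
    have "is_packing \<delta> A P"
    proof -
      have "cball (h x) (r / 4) \<inter> cball (h y) (r / 4) = {}" if "x \<in> X" "y \<in> X" "x \<noteq> y" for x y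
        using hsep[OF that] by (intro disjoint_cballI) auto
      then have "disjoint_family_on (\<lambda>(x, r). cball x r) P"
        unfolding disjoint_family_on_def P_def by fastforce
      then show ?thesis using finX h r by (auto simp: is_packing_def P_def intro!: countable_finite)
    qed
    then have "(\<Sum>\<^sub>\<infinity>(x, r)\<in>P. ennreal ((2 * r) powr s)) \<le> (SUP B\<in>{B. is_packing \<delta> A B}. \<Sum>\<^sub>\<infinity>(x, r)\<in>B. ennreal ((2 * r) powr s))"
      by (intro SUP_upper) auto
    moreover have "(\<Sum>\<^sub>\<infinity>(x, r)\<in>P. ennreal ((2 * r) powr s)) = ennreal (real (card X) * (r / 2) powr s)"
    proof -
      have "(\<Sum>\<^sub>\<infinity>(x, r)\<in>P. ennreal ((2 * r) powr s)) = (\<Sum>(x, r)\<in>P. ennreal ((2 * r) powr s))"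
        using finX by (intro infsum_finite) (simp add: P_def)
      also have "\<dots> = (\<Sum>x\<in>X. ennreal ((r / 2) powr s))"
        unfolding P_def using inj by (subst sum.reindex) auto
      also have "\<dots> = ennreal (real (card X) * (r / 2) powr s)"
        by (subst ennreal_mult) (simp_all only: sum_constant ennreal_of_nat_eq_real_of_nat, simp_all)
      finally show ?thesis .
    qed
    moreover have "1 \<le> ennreal (real (card X) * (r / 2) powr s)"
    proof -
      have "real (card X) * r powr \<kappa> * M = real (card X) * (r powr s * (r powr (\<kappa> - s) * M))"
        using r by (simp add: powr_add[symmetric])
      also have "\<dots> \<le> real (card X) * (r powr s * (1 / (2 powr s * M) * M))"
        using e(2)[of r] r M by (intro mult_left_mono mult_right_mono) auto
      also have "\<dots> = real (card X) * (r / 2) powr s" using M r by (simp add: powr_divide)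
      finally have "1 \<le> real (card X) * (r / 2) powr s" using cardX by linarith
      then show ?thesis using ennreal_leI by fastforce
    qed
    ultimately show "1 \<le> (SUP B\<in>{B. is_packing \<delta> A B}. \<Sum>\<^sub>\<infinity>(x, r)\<in>B. ennreal ((2 * r) powr s))"
      by order
  qed
  have "1 \<le> packing_measure s limit_set"
    unfolding packing_measure_def
  proof (rule INF_greatest)
    fix F assume "F \<in> {F::nat \<Rightarrow> (real^'m) set. limit_set \<subseteq> (\<Union>n. F n)}"
    then have F: "limit_set \<subseteq> (\<Union>n. F n)" by simp
    \<comment> \<open>Otherwise the relatively open complements of the closures would all be dense,
      although their intersection is empty because the \<open>F n\<close> cover.\<close>
    have "\<exists>n. \<not> limit_set \<subseteq> closure (limit_set - closure (F n))"
    proof (rule ccontr)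
      assume *: "\<not> ?thesis"
      have "limit_set \<subseteq> closure (\<Inter>(range (\<lambda>n. limit_set - closure (F n))))"
      proof (rule Baire)
        show "closed limit_set" using compact_limit_set compact_imp_closed by blast
        fix U assume "U \<in> range (\<lambda>n. limit_set - closure (F n))"
        then obtain n where U: "U = limit_set - closure (F n)" by auto
        have "U = limit_set \<inter> (- closure (F n))" using U by auto
        then have "openin (top_of_set limit_set) U"
          by (metis closed_closure open_Compl openin_open_Int)
        moreover have "limit_set \<subseteq> closure U" using * unfolding U by blast
        ultimately show "openin (top_of_set limit_set) U \<and> limit_set \<subseteq> closure U" by blast
      qed auto
      moreover have "\<Inter>(range (\<lambda>n. limit_set - closure (F n))) = {}"
        using F closure_subset by blast
      ultimately have "limit_set \<subseteq> closure {}" by (simp only:)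
      then show False using limit_set_nonempty by simp
    qed
    then obtain n x0 where x0: "x0 \<in> limit_set" "x0 \<notin> closure (limit_set - closure (F n))" by blast
    have "1 \<le> packing_premeasure s (F n)"
    proof (rule premeasure)
      show "open (- closure (limit_set - closure (F n)))" by auto
      show "x0 \<in> limit_set \<inter> - closure (limit_set - closure (F n))" using x0 by auto
      show "limit_set \<inter> - closure (limit_set - closure (F n)) \<subseteq> closure (F n)"
        using closure_subset[of "limit_set - closure (F n)"] by blast
    qed
    also have "\<dots> = (\<Sum>k\<in>{n}. packing_premeasure s (F k))" by simp
    also have "\<dots> \<le> (\<Sum>n. packing_premeasure s (F n))" by (rule sum_le_suminf) auto
    finally show "1 \<le> (\<Sum>n. packing_premeasure s (F n))" .
  qed
  then show ?thesis by auto
qed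

end

section \<open>Neighbourhoods of rationals\<close>

lemma card_separated:
  fixes f :: "'a \<Rightarrow> real"
  assumes d: "d > 0" and L: "L \<ge> 0" and range: "\<And>x. x \<in> P \<Longrightarrow> a \<le> f x \<and> f x \<le> a + L"
    and sep: "\<And>x y. x \<in> P \<Longrightarrow> y \<in> P \<Longrightarrow> x \<noteq> y \<Longrightarrow> d \<le> \<bar>f x - f y\<bar>"
  shows "finite P" "real (card P) \<le> 1 + L / d"
proof -
  define g where "g x = \<lfloor>(f x - a) / d\<rfloor>" for x
  have inj: "inj_on g P"
  proof (rule inj_onI, rule ccontr)
    fix x y assume xy: "x \<in> P" "y \<in> P" "g x = g y" "x \<noteq> y"
    have "\<bar>(f x - a) / d - (f y - a) / d\<bar> < 1" using xy(3) unfolding g_def by linarith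
    moreover have "(f x - a) / d - (f y - a) / d = (f x - f y) / d" by (simp add: diff_divide_distrib)
    ultimately have "\<bar>f x - f y\<bar> < d" using d by (simp add: abs_divide)
    then show False using sep[OF xy(1,2,4)] by simp
  qed
  have sub: "g ` P \<subseteq> {0..\<lfloor>L / d\<rfloor>}"
  proof safe
    fix x assume "x \<in> P"
    then have "0 \<le> (f x - a) / d" "(f x - a) / d \<le> L / d"
      using range[of x] d by (auto intro!: divide_right_mono)
    then show "g x \<in> {0..\<lfloor>L / d\<rfloor>}" by (auto simp: g_def floor_mono)
  qed
  show fin: "finite P" using inj sub finite_imageD finite_subset by blast
  have "card P = card (g ` P)" using inj by (simp add: card_image)
  also have "\<dots> \<le> card {0..\<lfloor>L / d\<rfloor>}" using sub by (intro card_mono) auto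
  finally have *: "card P \<le> nat (\<lfloor>L / d\<rfloor> + 1)" by simp
  have "0 \<le> L / d" using d L by simp
  then have "real (nat (\<lfloor>L / d\<rfloor> + 1)) \<le> L / d + 1" by (simp add: of_nat_nat)
  then show "real (card P) \<le> 1 + L / d" using * by (simp add: le_trans[OF of_nat_mono] add.commute)
qed

lemma rational_gap:
  fixes p p' :: int and q q' :: nat
  assumes "coprime p (int q)" "coprime p' (int q')" "q \<ge> 1" "q' \<ge> 1" "(p, q) \<noteq> (p', q')"
  shows "1 / (real q * real q') \<le> \<bar>of_int p / real q - of_int p' / real q'\<bar>"
proof -
  have "p * int q' \<noteq> p' * int q"
  proof
    assume eq: "p * int q' = p' * int q"
    have "int q dvd p * int q'" using eq by simp
    then have "int q dvd int q'" using assms(1) by (simp add: coprime_commute coprime_dvd_mult_right_iff)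
    moreover have "int q' dvd p' * int q" using eq by (metis dvd_triv_right)
    then have "int q' dvd int q" using assms(2) by (simp add: coprime_commute coprime_dvd_mult_right_iff)
    ultimately have "q = q'" by (simp add: dvd_antisym)
    then show False using eq assms by auto
  qed
  then have "1 \<le> \<bar>p * int q' - p' * int q\<bar>" by linarith
  then have "1 \<le> \<bar>of_int (p * int q' - p' * int q) :: real\<bar>" by linarith
  moreover have "of_int p / real q - of_int p' / real q' = of_int (p * int q' - p' * int q) / (real q * real q')"
    using assms by (simp add: field_simps)
  ultimately show ?thesis using assms by (simp add: abs_divide abs_mult divide_right_mono)
qed

text \<open>Summation by parts against a majorant \<open>T\<close> of the partial sums. The
  subtracted term keeps the slack at \<open>n\<close>, which the induction needs; in the application
  it is nonnegative and dropped.\<close>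

lemma Abel_sum_le:
  fixes s T \<psi> :: "nat \<Rightarrow> real"
  assumes "\<And>n. (\<Sum>k\<le>n. s k) \<le> T n" "\<And>n. \<psi> (Suc n) \<le> \<psi> n"
  shows "(\<Sum>k\<le>n. s k * \<psi> k) \<le> T 0 * \<psi> 0 + (\<Sum>k<n. (T (Suc k) - T k) * \<psi> (Suc k)) - (T n - (\<Sum>k\<le>n. s k)) * \<psi> n"
proof (induction n)
  case 0
  then show ?case by (simp add: algebra_simps)
next
  case (Suc n)
  have "(T n - (\<Sum>k\<le>n. s k)) * \<psi> (Suc n) \<le> (T n - (\<Sum>k\<le>n. s k)) * \<psi> n"
    using assms(1)[of n] assms(2)[of n] by (intro mult_left_mono) auto
  with Suc show ?case by (simp add: algebra_simps)
qed

text \<open>Only reduced fractions are listed, unlike in \<open>W_set\<close>: each rational occurs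
  once per centre and \<open>rational_gap\<close> applies. \<open>E_setI\<close> returns to
  arbitrary pairs.\<close>

definition near_rationals :: "(nat \<Rightarrow> real) \<Rightarrow> nat \<Rightarrow> real set" where
  "near_rationals \<psi> Q = (\<Union>q\<in>{Q..}. \<Union>p\<in>{p::int. coprime p (int q)}. ball (of_int p / real q) (\<psi> q))"

lemma near_rationalsI:
  "q \<ge> Q \<Longrightarrow> coprime p (int q) \<Longrightarrow> \<bar>x - of_int p / real q\<bar> < \<psi> q \<Longrightarrow> x \<in> near_rationals \<psi> Q"
  unfolding near_rationals_def by (auto simp: dist_real_def abs_minus_commute intro!: bexI[of _ q] exI[of _ p])

lemma near_rationalsE:
  assumes "x \<in> near_rationals \<psi> Q"
  obtains p q where "q \<ge> Q" "coprime p (int q)" "\<bar>x - of_int p / real q\<bar> < \<psi> q"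
  using assms unfolding near_rationals_def by (auto simp: dist_real_def abs_minus_commute)

lemma near_rationals_antimono: "Q \<le> R \<Longrightarrow> near_rationals \<psi> R \<subseteq> near_rationals \<psi> Q"
  unfolding near_rationals_def by (intro UN_mono) auto

lemma open_near_rationals: "open (near_rationals \<psi> Q)"
  unfolding near_rationals_def by auto

lemma near_rationals_sets [measurable, simp]: "near_rationals \<psi> Q \<in> sets borel"
  using open_near_rationals by (rule borel_open)

locale approx_fun =
  fixes \<psi> :: "nat \<Rightarrow> real"
  assumes pos: "q \<ge> 1 \<Longrightarrow> \<psi> q > 0"
    and dec: "1 \<le> q \<Longrightarrow> q \<le> r \<Longrightarrow> \<psi> r \<le> \<psi> q"
    and lim: "(\<lambda>q. real q ^ 2 * \<psi> q) \<longlonglongrightarrow> 0"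
    and summ: "summable (\<lambda>q. real q * \<psi> q)"
begin

definition tail :: "nat \<Rightarrow> real" where "tail Q = (\<Sum>n. real (n + Q) * \<psi> (n + Q))"

lemma nonneg: "0 \<le> real q * \<psi> q"
  using pos[of q] by (cases "q = 0") auto

lemma tail_tendsto: "tail \<longlonglongrightarrow> 0"
  unfolding tail_def using suminf_exist_split2[OF summ] by simp

lemma sum_le_tail: "(\<Sum>k<n. real (Suc k + Q) * \<psi> (Suc k + Q)) \<le> tail Q"
proof -
  have "(\<Sum>k<n. real (Suc k + Q) * \<psi> (Suc k + Q)) \<le> (\<Sum>k<Suc n. real (k + Q) * \<psi> (k + Q))"
    using nonneg[of Q] by (subst sum.lessThan_Suc_shift) simp
  also have "\<dots> \<le> tail Q" unfolding tail_def
    by (intro sum_le_suminf summable_ignore_initial_segment summ) (auto intro: nonneg simp del: of_nat_add)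
  finally show ?thesis .
qed

text \<open>Counting numerators separately for each q would give an error 1 per denominator, ruinous
  for short intervals. Counted together, the reduced fractions with denominators up to n are 1/n^2
  apart, so there are at most 1 + n^2 L of them; Abel summation with the monotone \<psi> turns this
  into one boundary term and the tail of the series of q \<psi>(q).\<close>

lemma emeasure_near_rationals:
  assumes ab: "a \<le> b" and Q: "Q \<ge> 1"
  \<comment> \<open>A ball may reach the interval from outside, so fractions within \<psi>(Q) of its
    ends are counted as well.\<close>
  defines "L \<equiv> b - a + 2 * \<psi> Q"
  shows "emeasure lborel ({a..b} \<inter> near_rationals \<psi> Q)
     \<le> ennreal (2 * ((1 + real Q ^ 2 * L) * \<psi> Q + 2 * L * tail Q))"
proof -
  have L: "L \<ge> 0" using ab pos[OF Q] by (simp add: L_def)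
  define P where "P q = {p::int. coprime p (int q) \<and> a - \<psi> Q \<le> of_int p / real q \<and> of_int p / real q \<le> b + \<psi> Q}" for q
  define s where "s k = real (card (P (k + Q)))" for k
  have count: "finite (SIGMA k:{..n}. P (k + Q)) \<and> real (card (SIGMA k:{..n}. P (k + Q))) \<le> 1 + real (n + Q) ^ 2 * L" for n
  proof -
    define f :: "nat \<times> int \<Rightarrow> real" where "f = (\<lambda>(k, p). of_int p / real (k + Q))"
    have 1: "1 / real (n + Q) ^ 2 > 0" using Q by simp
    have 2: "a - \<psi> Q \<le> f x \<and> f x \<le> (a - \<psi> Q) + L" if "x \<in> (SIGMA k:{..n}. P (k + Q))" for x
      using that by (auto simp: f_def P_def L_def)
    have 3: "1 / real (n + Q) ^ 2 \<le> \<bar>f x - f y\<bar>" if "x \<in> (SIGMA k:{..n}. P (k + Q))" "y \<in> (SIGMA k:{..n}. P (k + Q))" "x \<noteq> y" for x y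
    proof -
      obtain k p k' p' where xy: "x = (k, p)" "y = (k', p')" by (cases x, cases y)
      have "1 / real (n + Q) ^ 2 \<le> 1 / (real (k + Q) * real (k' + Q))"
        unfolding power2_eq_square using that Q xy by (intro divide_left_mono mult_mono mult_pos_pos) auto
      also have "\<dots> \<le> \<bar>f x - f y\<bar>"
        unfolding xy f_def prod.case using that xy Q by (intro rational_gap) (auto simp: P_def)
      finally show ?thesis .
    qed
    from card_separated[where P = "SIGMA k:{..n}. P (k + Q)" and f = f and a = "a - \<psi> Q", OF 1 L 2 3] show ?thesis by (simp add: mult.commute)
  qed
  have finP: "finite (P (k + Q))" for k
  proof -
    have "Pair k ` P (k + Q) \<subseteq> (SIGMA j:{..k}. P (j + Q))" by auto
    then have "finite (Pair k ` P (k + Q))" using count[of k] finite_subset by blast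
    then show ?thesis by (rule finite_imageD) (auto simp: inj_on_def)
  qed
  have S: "(\<Sum>k\<le>n. s k) \<le> 1 + real (n + Q) ^ 2 * L" for n
    using count[of n] finP by (simp add: s_def card_SigmaI)
  have abel: "(\<Sum>k\<le>n. s k * \<psi> (k + Q)) \<le> (1 + real Q ^ 2 * L) * \<psi> Q + 2 * L * tail Q" for n
  proof -
    have "(\<Sum>k\<le>n. s k * \<psi> (k + Q)) \<le> (1 + real (0 + Q) ^ 2 * L) * \<psi> (0 + Q) +
        (\<Sum>k<n. ((1 + real (Suc k + Q) ^ 2 * L) - (1 + real (k + Q) ^ 2 * L)) * \<psi> (Suc k + Q))
         - ((1 + real (n + Q) ^ 2 * L) - (\<Sum>k\<le>n. s k)) * \<psi> (n + Q)"
      by (rule Abel_sum_le[where \<psi> = "\<lambda>k. \<psi> (k + Q)"]) (use S Q in \<open>auto intro: dec\<close>)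
    also have "\<dots> \<le> (1 + real (0 + Q) ^ 2 * L) * \<psi> (0 + Q) +
        (\<Sum>k<n. ((1 + real (Suc k + Q) ^ 2 * L) - (1 + real (k + Q) ^ 2 * L)) * \<psi> (Suc k + Q))"
      using S[of n] pos[of "n + Q"] Q by (simp add: mult_nonneg_nonneg)
    also have "\<dots> \<le> (1 + real Q ^ 2 * L) * \<psi> Q + (\<Sum>k<n. 2 * L * (real (Suc k + Q) * \<psi> (Suc k + Q)))"
    proof -
      have "((1 + real (Suc k + Q) ^ 2 * L) - (1 + real (k + Q) ^ 2 * L)) * \<psi> (Suc k + Q) \<le> 2 * L * (real (Suc k + Q) * \<psi> (Suc k + Q))" for k
      proof -
        have "(1 + real (Suc k + Q) ^ 2 * L) - (1 + real (k + Q) ^ 2 * L) = (2 * real (Suc k + Q) - 1) * L"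
          by (simp add: power2_eq_square algebra_simps)
        also have "\<dots> \<le> 2 * real (Suc k + Q) * L" using L by (intro mult_right_mono) auto
        finally have "((1 + real (Suc k + Q) ^ 2 * L) - (1 + real (k + Q) ^ 2 * L)) * \<psi> (Suc k + Q) \<le> 2 * real (Suc k + Q) * L * \<psi> (Suc k + Q)"
          using pos[of "Suc k + Q"] by (intro mult_right_mono) auto
        then show ?thesis by (simp only: mult_ac)
      qed
      then show ?thesis by (intro add_mono sum_mono) auto
    qed
    also have "\<dots> = (1 + real Q ^ 2 * L) * \<psi> Q + 2 * L * (\<Sum>k<n. real (Suc k + Q) * \<psi> (Suc k + Q))"
      by (simp add: sum_distrib_left)
    also have "\<dots> \<le> (1 + real Q ^ 2 * L) * \<psi> Q + 2 * L * tail Q"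
      using L by (intro add_left_mono mult_left_mono sum_le_tail) auto
    finally show ?thesis .
  qed
  define A where "A k = (\<Union>p\<in>P (k + Q). ball (of_int p / real (k + Q)) (\<psi> (k + Q)))" for k
  have "{a..b} \<inter> near_rationals \<psi> Q \<subseteq> (\<Union>k. A k)"
  proof
    fix x assume x: "x \<in> {a..b} \<inter> near_rationals \<psi> Q"
    then obtain p q where pq: "q \<ge> Q" "coprime p (int q)" "\<bar>x - of_int p / real q\<bar> < \<psi> q"
      by (auto elim: near_rationalsE)
    have "\<psi> q \<le> \<psi> Q" using pq Q by (intro dec) auto
    then have "p \<in> P q" using pq x by (auto simp: P_def)
    then have "x \<in> A (q - Q)" using pq by (auto simp: A_def dist_real_def abs_minus_commute)
    then show "x \<in> (\<Union>k. A k)" by blast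
  qed
  then have "emeasure lborel ({a..b} \<inter> near_rationals \<psi> Q) \<le> emeasure lborel (\<Union>k. A k)"
    by (intro emeasure_mono) (auto simp: A_def)
  also have "\<dots> \<le> (\<Sum>k. emeasure lborel (A k))"
    by (intro emeasure_subadditive_countably) (auto simp: A_def)
  also have "\<dots> \<le> (\<Sum>k. ennreal (2 * (s k * \<psi> (k + Q))))"
  proof (intro suminf_le)
    fix k
    have \<psi>0: "\<psi> (k + Q) > 0" using Q by (intro pos) auto
    have "emeasure lborel (A k) \<le> (\<Sum>p\<in>P (k + Q). emeasure lborel (ball (of_int p / real (k + Q)) (\<psi> (k + Q))))"
      unfolding A_def by (intro emeasure_subadditive_finite finP) auto
    also have "\<dots> = (\<Sum>p\<in>P (k + Q). ennreal (2 * \<psi> (k + Q)))"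
      using \<psi>0 by (intro sum.cong) (auto simp: ball_eq_greaterThanLessThan)
    also have "\<dots> = ennreal (2 * (s k * \<psi> (k + Q)))"
      using \<psi>0 by (simp add: s_def ennreal_mult' ennreal_of_nat_eq_real_of_nat mult_ac)
    finally show "emeasure lborel (A k) \<le> ennreal (2 * (s k * \<psi> (k + Q)))" .
  qed auto
  also have "\<dots> \<le> ennreal (2 * ((1 + real Q ^ 2 * L) * \<psi> Q + 2 * L * tail Q))"
    unfolding suminf_eq_SUP
  proof (rule SUP_least)
    fix n
    have s0: "0 \<le> s k * \<psi> (k + Q)" for k using pos[of "k + Q"] Q by (auto simp: s_def)
    have "(\<Sum>k<n. ennreal (2 * (s k * \<psi> (k + Q)))) = ennreal (2 * (\<Sum>k<n. s k * \<psi> (k + Q)))"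
      using s0 by (subst sum_ennreal) (auto simp: sum_distrib_left)
    also have "\<dots> \<le> ennreal (2 * (\<Sum>k\<le>n. s k * \<psi> (k + Q)))"
      using s0 by (intro ennreal_leI mult_left_mono sum_mono2) auto
    also have "\<dots> \<le> ennreal (2 * ((1 + real Q ^ 2 * L) * \<psi> Q + 2 * L * tail Q))"
      by (intro ennreal_leI mult_left_mono abel) auto
    finally show "(\<Sum>k<n. ennreal (2 * (s k * \<psi> (k + Q)))) \<le> ennreal (2 * ((1 + real Q ^ 2 * L) * \<psi> Q + 2 * L * tail Q))" .
  qed
  finally show ?thesis .
qed

lemma eventually_square_le:
  assumes "\<delta> > 0"
  shows "eventually (\<lambda>q. real q ^ 2 * \<psi> q \<le> \<delta>) sequentially"
  using order_tendstoD(2)[OF lim assms] by (auto elim: eventually_mono)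

lemma eventually_tail_le:
  assumes "\<delta> > 0"
  shows "eventually (\<lambda>q. tail q \<le> \<delta>) sequentially"
  using order_tendstoD(2)[OF tail_tendsto assms] by (auto elim: eventually_mono)

lemma initial_interval:
  assumes "a < b"
  shows "\<exists>Q\<ge>1. emeasure lborel ({a..b} \<inter> near_rationals \<psi> Q) \<le> ennreal ((b - a) / 8)"
proof -
  define D where "D = min 1 (b - a)"
  have D: "D > 0" "D \<le> 1" "D \<le> b - a" using assms by (auto simp: D_def)
  \<comment> \<open>The three error terms are at most 1, 2 and 4 times (b-a)/128, and twice their
    sum stays below (b-a)/8. The two bounds in \<open>D\<close> serve the term \<psi>(Q) and the
    terms proportional to L.\<close>
  define \<delta> where "\<delta> = D / 128"
  have \<delta>: "\<delta> > 0" "\<delta> \<le> 1" using D by (auto simp: \<delta>_def)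
  have "eventually (\<lambda>q. real q ^ 2 * \<psi> q \<le> \<delta> \<and> tail q \<le> \<delta> \<and> q \<ge> 1) sequentially"
    using eventually_square_le[OF \<delta>(1)] eventually_tail_le[OF \<delta>(1)] eventually_ge_at_top[of 1]
    by eventually_elim auto
  then obtain Q where Q: "real Q ^ 2 * \<psi> Q \<le> \<delta>" "tail Q \<le> \<delta>" "Q \<ge> 1"
    using eventually_happens by force
  have "\<psi> Q > 0" using pos Q by auto
  have "1 * \<psi> Q \<le> real Q ^ 2 * \<psi> Q" using Q \<open>\<psi> Q > 0\<close> by (intro mult_right_mono) auto
  then have \<psi>: "\<psi> Q \<le> \<delta>" using Q by linarith
  define L where "L = b - a + 2 * \<psi> Q"
  have L: "L \<ge> 0" "L \<le> 2 * (b - a)" using \<psi> \<open>\<psi> Q > 0\<close> D by (auto simp: L_def \<delta>_def)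
  have "(1 + real Q ^ 2 * L) * \<psi> Q + 2 * L * tail Q = \<psi> Q + L * (real Q ^ 2 * \<psi> Q) + 2 * L * tail Q"
    by (simp add: algebra_simps)
  also have "\<dots> \<le> \<delta> + L * \<delta> + 2 * L * \<delta>"
    using \<psi> Q L by (intro add_mono mult_left_mono) auto
  also have "\<dots> \<le> (b - a) / 128 + 2 * (b - a) * (1/128) + 2 * (2 * (b - a)) * (1 / 128)"
    using L D by (intro add_mono mult_mono) (auto simp: \<delta>_def)
  also have "\<dots> = 7 / 128 * (b - a)" by (simp add: field_simps)
  also have "\<dots> \<le> 8 / 128 * (b - a)" using assms by (intro mult_right_mono) auto
  finally have "2 * ((1 + real Q ^ 2 * L) * \<psi> Q + 2 * L * tail Q) \<le> (b - a) / 8" by simp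
  then show ?thesis
    using emeasure_near_rationals[of a b Q] assms Q unfolding L_def
    by (meson ennreal_leI less_imp_le order_trans)
qed

section \<open>Short intervals beside rationals\<close>

definition child :: "real \<Rightarrow> int \<times> nat \<Rightarrow> real set" where
  "child \<epsilon> = (\<lambda>(p, q). {of_int p / real q + (1 - \<epsilon>) * \<psi> q .. of_int p / real q + (1 - \<epsilon> / 2) * \<psi> q})"

text \<open>A child has length \<epsilon>\<psi>(q)/2, so the bound is one eighth of it, as
  \<open>good_family\<close> demands. A different fraction p'/q' is at least 1/(q q') away from p/q,
  too far to interfere unless q' \<ge> 1/(2q\<psi>(q)). Beyond that threshold \<psi> is already tiny
  compared with \<psi>(q).\<close>

lemma eventually_child_good:
  assumes \<epsilon>: "0 < \<epsilon>" "\<epsilon> < 1"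
  shows "eventually (\<lambda>q. \<forall>p. coprime p (int q) \<longrightarrow>
    emeasure lborel (child \<epsilon> (p, q) \<inter> near_rationals \<psi> (Suc q)) \<le> ennreal (\<epsilon> * \<psi> q / 16)) sequentially"
proof -
  \<comment> \<open>It makes 4\<delta>^2 at most \<epsilon>/10000, and 1/10000 + 3/200 is below
    1/32, half of the required 1/16.\<close>
  define \<delta> where "\<delta> = \<epsilon> / 200"
  have \<delta>: "\<delta> > 0" using \<epsilon> by (simp add: \<delta>_def)
  have "eventually (\<lambda>q. real q ^ 2 * \<psi> q \<le> \<delta> \<and> tail q \<le> \<delta>) sequentially"
    using eventually_square_le[OF \<delta>] eventually_tail_le[OF \<delta>] by eventually_elim auto
  then obtain q0 where q0: "\<And>q. q \<ge> q0 \<Longrightarrow> real q ^ 2 * \<psi> q \<le> \<delta> \<and> tail q \<le> \<delta>"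
    by (auto simp: eventually_sequentially)
  show ?thesis unfolding eventually_sequentially
  proof (intro exI[of _ "max q0 1"] allI impI)
    fix q and p :: int assume q: "q \<ge> max q0 1" and cop: "coprime p (int q)"
    have \<psi>q: "\<psi> q > 0" using pos q by auto
    define Q where "Q = nat \<lceil>1 / (2 * real q * \<psi> q)\<rceil>"
    have Qge: "1 / (2 * real q * \<psi> q) \<le> real Q" unfolding Q_def by linarith
    have "real q \<le> 1 / (2 * real q * \<psi> q)"
      using q0[of q] q \<psi>q \<epsilon> by (simp add: field_simps power2_eq_square \<delta>_def)
    then have Qq: "q \<le> Q" using Qge by linarith
    then have Q: "Q \<ge> q0" "Q \<ge> 1" using q by auto
    have Qlt: "real r < 1 / (2 * real q * \<psi> q)" if "r < Q" for r
      using that unfolding Q_def by linarith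
    define u v where "u = of_int p / real q + (1 - \<epsilon>) * \<psi> q" and "v = of_int p / real q + (1 - \<epsilon> / 2) * \<psi> q"
    have uv: "child \<epsilon> (p, q) = {u..v}" "v - u = \<epsilon> * \<psi> q / 2"
      by (auto simp: child_def u_def v_def algebra_simps)
    have uv': "u \<le> v" using uv(2) \<epsilon> \<psi>q by (smt (verit) divide_pos_pos mult_pos_pos)
    have "{u..v} \<inter> near_rationals \<psi> (Suc q) \<subseteq> {u..v} \<inter> near_rationals \<psi> Q"
    proof
      fix x assume x: "x \<in> {u..v} \<inter> near_rationals \<psi> (Suc q)"
      then obtain p' q' where pq': "q' \<ge> Suc q" "coprime p' (int q')" "\<bar>x - of_int p' / real q'\<bar> < \<psi> q'"
        by (auto elim: near_rationalsE)
      have "q' \<ge> Q"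
      proof (rule ccontr)
        assume "\<not> q' \<ge> Q"
        then have "real q' < 1 / (2 * real q * \<psi> q)" using Qlt by auto
        then have 1: "2 * \<psi> q < 1 / (real q * real q')" using q \<psi>q pq' by (simp add: field_simps)
        have "1 / (real q * real q') \<le> \<bar>of_int p / real q - of_int p' / real q'\<bar>"
          using cop pq' q by (intro rational_gap) auto
        moreover have "\<psi> q' \<le> \<psi> q" using q pq' by (intro dec) auto
        moreover have "\<bar>x - of_int p / real q\<bar> \<le> \<psi> q"
        proof -
          have "0 \<le> (1 - \<epsilon>) * \<psi> q" "(1 - \<epsilon> / 2) * \<psi> q \<le> 1 * \<psi> q"
            using \<epsilon> \<psi>q by (auto intro!: mult_nonneg_nonneg mult_right_mono)
          then show ?thesis using x by (auto simp: u_def v_def)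
        qed
        ultimately show False using 1 pq'(3) by linarith
      qed
      then show "x \<in> {u..v} \<inter> near_rationals \<psi> Q" using x pq' by (auto intro: near_rationalsI)
    qed
    then have "emeasure lborel ({u..v} \<inter> near_rationals \<psi> (Suc q)) \<le> emeasure lborel ({u..v} \<inter> near_rationals \<psi> Q)"
      by (intro emeasure_mono) auto
    also define L where "L = v - u + 2 * \<psi> Q"
    have "emeasure lborel ({u..v} \<inter> near_rationals \<psi> Q) \<le> ennreal (2 * ((1 + real Q ^ 2 * L) * \<psi> Q + 2 * L * tail Q))"
      unfolding L_def by (rule emeasure_near_rationals[OF uv' Q(2)])
    also have "\<dots> \<le> ennreal (\<epsilon> * \<psi> q / 16)"
    proof (rule ennreal_leI)
      have \<psi>Q: "\<psi> Q > 0" using pos Q by auto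
      \<comment> \<open>Smallness is used twice: Q^2 \<psi>(Q) \<le> \<delta> with Q \<ge>
        1/(2q\<psi>(q)), then q^2 \<psi>(q) \<le> \<delta>. This matters because one ball of radius
        \<psi>(Q) must not fill a child.\<close>
      have 1: "\<psi> Q \<le> 4 * \<delta> ^ 2 * \<psi> q"
      proof -
        have "1 / (2 * real q * \<psi> q) > 0" using q \<psi>q by auto
        then have "(1 / (2 * real q * \<psi> q)) ^ 2 * \<psi> Q \<le> real Q ^ 2 * \<psi> Q"
          using Qge \<psi>Q by (intro mult_right_mono power_mono) auto
        also have "\<dots> \<le> \<delta>" using q0 Q by auto
        finally have "\<psi> Q \<le> 4 * \<delta> * (real q ^ 2 * \<psi> q) * \<psi> q"
          using q \<psi>q by (simp add: field_simps power2_eq_square)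
        also have "\<dots> \<le> 4 * \<delta> * \<delta> * \<psi> q"
          using q0[of q] q \<psi>q \<delta> by (intro mult_right_mono mult_left_mono) auto
        finally show ?thesis by (simp add: power2_eq_square)
      qed
      have "\<delta> ^ 2 = \<epsilon> * \<epsilon> / 40000" by (simp add: \<delta>_def power2_eq_square)
      also have "\<dots> \<le> \<epsilon> / 40000" using \<epsilon> by (simp add: mult_left_le)
      finally have 2: "4 * \<delta> ^ 2 * \<psi> q \<le> \<epsilon> / 10000 * \<psi> q" using \<psi>q by (intro mult_right_mono) auto
      have 3: "\<psi> Q \<le> \<epsilon> * \<psi> q / 10000" using 1 2 by simp
      then have L: "0 \<le> L" "L \<le> \<epsilon> * \<psi> q" using uv uv' \<psi>Q by (auto simp: L_def)
      have "(1 + real Q ^ 2 * L) * \<psi> Q + 2 * L * tail Q = \<psi> Q + L * (real Q ^ 2 * \<psi> Q) + 2 * L * tail Q"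
        by (simp add: algebra_simps)
      also have "\<dots> \<le> \<epsilon> * \<psi> q / 10000 + L * \<delta> + 2 * L * \<delta>"
        using 3 q0[of Q] Q L by (intro add_mono mult_left_mono) auto
      also have "\<dots> = \<epsilon> * \<psi> q / 10000 + 3 * L * \<delta>" by simp
      also have "\<dots> \<le> \<epsilon> * \<psi> q / 10000 + 3 * (\<epsilon> * \<psi> q) * (1/200)"
        using L \<epsilon> \<delta> by (intro add_left_mono mult_mono) (auto simp: \<delta>_def)
      also have "\<dots> \<le> \<epsilon> * \<psi> q / 32" using \<epsilon> \<psi>q by simp
      finally show "2 * ((1 + real Q ^ 2 * L) * \<psi> Q + 2 * L * tail Q) \<le> \<epsilon> * \<psi> q / 16" by simp
    qed
    finally show "emeasure lborel (child \<epsilon> (p, q) \<inter> near_rationals \<psi> (Suc q)) \<le> ennreal (\<epsilon> * \<psi> q / 16)"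
      using uv by simp
  qed
qed


lemma child_bounds:
  assumes "x \<in> child \<epsilon> (p, q)" "0 < \<epsilon>" "\<epsilon> < 1" "q \<ge> 1"
  shows "(1 - \<epsilon>) * \<psi> q \<le> x - of_int p / real q" "x - of_int p / real q < \<psi> q"
    "0 \<le> x - of_int p / real q"
proof -
  have \<psi>: "\<psi> q > 0" using pos assms by auto
  show 1: "(1 - \<epsilon>) * \<psi> q \<le> x - of_int p / real q" using assms(1) by (auto simp: child_def)
  have "(1 - \<epsilon> / 2) * \<psi> q < 1 * \<psi> q" using \<psi> assms by (intro mult_strict_right_mono) auto
  then show "x - of_int p / real q < \<psi> q" using assms(1) by (auto simp: child_def)
  have "0 \<le> (1 - \<epsilon>) * \<psi> q" using \<psi> assms by auto
  then show "0 \<le> x - of_int p / real q" using 1 by linarith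
qed

text \<open>For r \<ge> q the gap between fractions suffices. For r < q the point \<open>y\<close>,
  which avoids all balls from Q on and is within 2/q^2 of \<open>x\<close>, is used: if
  \<epsilon>\<psi>(r) \<ge> 2/q^2, passing from \<open>y\<close> to \<open>x\<close> costs at most
  \<epsilon>\<psi>(r). If \<psi>(r) is smaller, the gap works again unless r is comparable with q,
  and then r^2 \<psi>(r) is small.\<close>

lemma child_avoids:
  assumes \<epsilon>: "0 < \<epsilon>" "\<epsilon> < 1" and Q: "Q \<ge> 1"
    and small: "\<And>r. r \<ge> q1 \<Longrightarrow> real r ^ 2 * \<psi> r \<le> \<epsilon> / 32"
    and q: "q \<ge> q1" "\<epsilon> * real q / 4 > real q1" "q \<ge> 1" "q \<le> N" "N < 16 * q"
    and y: "y \<notin> near_rationals \<psi> Q" "\<bar>y - of_int p / real q\<bar> < 1 / (real q * real N)"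
    and x: "x \<in> child \<epsilon> (p, q)" and cop: "coprime p (int q)"
    and r: "coprime p' (int r)" "Q \<le> r" "r \<le> N"
  shows "(1 - \<epsilon>) * \<psi> r \<le> \<bar>x - of_int p' / real r\<bar>"
proof (cases "(p', r) = (p, q)")
  case True
  then show ?thesis using child_bounds[OF x \<epsilon> q(3)] by auto
next
  case False
  have r1: "r \<ge> 1" using Q r by auto
  have \<psi>r: "\<psi> r > 0" and \<psi>q: "\<psi> q > 0" using pos r1 q by auto
  have q0: "real q > 0" and r0: "real r > 0" using q r1 by auto
  have xp: "\<bar>x - of_int p / real q\<bar> \<le> \<psi> q" using child_bounds[OF x \<epsilon> q(3)] by auto
  have \<psi>q_le: "\<psi> q \<le> 1 / (32 * real q ^ 2)"
  proof -
    have "real q ^ 2 * \<psi> q \<le> 1 / 32" using small[OF q(1)] \<epsilon> by linarith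
    then show ?thesis using q0 by (simp add: field_simps)
  qed
  have gap: "1 / (real q * real r) \<le> \<bar>of_int p / real q - of_int p' / real r\<bar>"
    using False cop r r1 q by (intro rational_gap) auto
  have le: "(1 - \<epsilon>) * \<psi> r \<le> \<psi> r" using \<epsilon> \<psi>r by (simp add: mult_left_le_one_le)
  have key: ?thesis if "\<psi> q + \<psi> r \<le> 1 / (real q * real r)"
    using that gap xp le by linarith
  consider "r \<ge> q" | "r < q" "\<epsilon> * \<psi> r \<ge> 2 / real q ^ 2" | "r < q" "\<epsilon> * \<psi> r < 2 / real q ^ 2" by linarith
  then show ?thesis
  proof cases
    case 1
    have "\<psi> q + \<psi> r \<le> 2 * \<psi> q" using dec[OF q(3) 1] by simp
    also have "\<dots> \<le> 1 / (16 * real q ^ 2)" using \<psi>q_le by simp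
    also have "\<dots> = 1 / (real q * (16 * real q))" by (simp add: power2_eq_square)
    also have "\<dots> \<le> 1 / (real q * real r)"
      using q r r0 q0 by (intro divide_left_mono mult_left_mono mult_pos_pos) auto
    finally show ?thesis by (rule key)
  next
    case 2
    have "1 / (real q * real N) \<le> 1 / (real q * real q)"
      using q q0 by (intro divide_left_mono mult_left_mono mult_pos_pos) auto
    then have "\<bar>y - of_int p / real q\<bar> \<le> 1 / real q ^ 2" using y(2) by (simp add: power2_eq_square)
    moreover have "\<bar>x - of_int p / real q\<bar> \<le> 1 / real q ^ 2"
    proof -
      have "1 / (32 * real q ^ 2) \<le> 1 / real q ^ 2" using q0 by (simp add: field_simps)
      then show ?thesis using xp \<psi>q_le by linarith
    qed
    ultimately have "\<bar>x - y\<bar> \<le> 2 / real q ^ 2" by linarith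
    moreover have "\<psi> r \<le> \<bar>y - of_int p' / real r\<bar>"
      using y(1) near_rationalsI[OF r(2,1)] by (meson not_le)
    ultimately have "\<psi> r - \<epsilon> * \<psi> r \<le> \<bar>x - of_int p' / real r\<bar>" using 2 by linarith
    then show ?thesis by (simp add: algebra_simps)
  next
    case 3
    have "\<psi> q \<le> \<psi> r" using dec[OF r1, of q] 3 by simp
    show ?thesis
    proof (cases "2 * \<psi> r \<le> 1 / (real q * real r)")
      case True
      then show ?thesis using \<open>\<psi> q \<le> \<psi> r\<close> by (intro key) linarith
    next
      case False
      then have "\<epsilon> * (1 / (real q * real r)) < \<epsilon> * (2 * \<psi> r)"
        using \<epsilon> by (intro mult_strict_left_mono) auto
      then have "\<epsilon> / (real q * real r) < 2 * (\<epsilon> * \<psi> r)" by simp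
      also have "\<dots> < 4 / real q ^ 2" using 3 by linarith
      \<comment> \<open>Failure of the gap estimate forces r to be large, hence beyond
        \<open>q1\<close>, where the decay of r^2 \<psi>(r) contradicts that failure.\<close>
      finally have big: "\<epsilon> * real q / 4 < real r" using q0 r0 by (simp add: field_simps power2_eq_square)
      then have "r \<ge> q1" using q by linarith
      then have "real r ^ 2 * \<psi> r \<le> \<epsilon> / 32" by (rule small)
      then have "2 * \<psi> r \<le> \<epsilon> / 16 / real r ^ 2" using r0 by (simp add: field_simps)
      also have "\<dots> = (\<epsilon> / 16 / real r) * (1 / real r)" by (simp add: power2_eq_square)
      also have "\<dots> \<le> (1 / real q) * (1 / real r)"
        using big q0 r0 \<epsilon> by (intro mult_right_mono) (auto simp: field_simps)
      finally show ?thesis using False by simp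
    qed
  qed
qed

text \<open>Any o(n) bound for the harmonic sum would serve; this one follows by telescoping square
  roots.\<close>

lemma sum_inverse_le_sqrt: "(\<Sum>q=1..n. 1 / real q) \<le> 2 * sqrt n"
proof (induction n)
  case (Suc n)
  have "1 / real (Suc n) \<le> 2 * (sqrt (Suc n) - sqrt n)"
  proof -
    have "(sqrt (Suc n) - sqrt n) * (sqrt (Suc n) + sqrt n) = 1"
      by (simp add: algebra_simps)
    moreover have "sqrt (Suc n) + sqrt n \<le> 2 * real (Suc n)"
    proof -
      have "sqrt (Suc n) \<le> real (Suc n)" by (rule real_le_lsqrt) (auto simp: power2_eq_square)
      moreover from this have "sqrt n \<le> real (Suc n)" by (rule order_trans[rotated]) simp
      ultimately have "sqrt (Suc n) + sqrt n \<le> real (Suc n) + real (Suc n)" by (rule add_mono)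
      then show ?thesis by simp
    qed
    moreover have "sqrt (Suc n) - sqrt n \<ge> 0" by simp
    ultimately have "1 \<le> (sqrt (Suc n) - sqrt n) * (2 * real (Suc n))"
      by (metis mult_left_mono)
    then show ?thesis by (simp add: field_simps)
  qed
  then show ?case using Suc by simp
qed simp

text \<open>This is where 16 comes from: points with a Dirichlet approximation of denominator at
  most N/16 have measure at most (N/16) * 2(b-a)/N = (b-a)/8 up to an error of order N^(-1/2), so
  they spare most of the interval.\<close>

lemma eventually_small_denominators:
  fixes a b :: real
  assumes ab: "a < b"
  shows "eventually (\<lambda>N. emeasure lborel (\<Union>q\<in>{1..N div 16}. \<Union>p\<in>{\<lfloor>q * a\<rfloor> - 1..\<lceil>q * b\<rceil> + 1}.
      cball (of_int p / real q) (1 / (real q * real N))) \<le> ennreal ((b - a) / 4)) sequentially"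
proof -
  have "(\<lambda>N. 20 * (1 / sqrt (real N))) \<longlonglongrightarrow> 20 * 0"
    by (intro tendsto_mult tendsto_const tendsto_divide_0[OF tendsto_const] filterlim_at_top_imp_at_infinity
       filterlim_compose[OF sqrt_at_top] filterlim_real_sequentially)
  then have "eventually (\<lambda>N. 20 * (1 / sqrt (real N)) < (b - a) / 8) sequentially"
    by (rule order_tendstoD) (use ab in simp)
  then show ?thesis using eventually_ge_at_top[of 1]
  proof eventually_elim
    case (elim N)
    have N: "real N > 0" using elim by simp
    define M where "M = N div 16"
    have "emeasure lborel (\<Union>q\<in>{1..M}. \<Union>p\<in>{\<lfloor>q * a\<rfloor> - 1..\<lceil>q * b\<rceil> + 1}.
      cball (of_int p / real q) (1 / (real q * real N)))
       \<le> (\<Sum>q\<in>{1..M}. emeasure lborel (\<Union>p\<in>{\<lfloor>q * a\<rfloor> - 1..\<lceil>q * b\<rceil> + 1}.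
      cball (of_int p / real q) (1 / (real q * real N))))"
      by (intro emeasure_subadditive_finite) auto
    also have "\<dots> \<le> (\<Sum>q\<in>{1..M}. ennreal (2 * (b - a) / real N + 10 / real N * (1 / real q)))"
    proof (rule sum_mono)
      fix q assume q: "q \<in> {1..M}"
      then have q0: "real q > 0" by simp
      have "emeasure lborel (\<Union>p\<in>{\<lfloor>q * a\<rfloor> - 1..\<lceil>q * b\<rceil> + 1}. cball (of_int p / real q) (1 / (real q * real N)))
        \<le> (\<Sum>p\<in>{\<lfloor>q * a\<rfloor> - 1..\<lceil>q * b\<rceil> + 1}. emeasure lborel (cball (of_int p / real q) (1 / (real q * real N))))"
        by (intro emeasure_subadditive_finite) auto
      also have "\<dots> = (\<Sum>p\<in>{\<lfloor>q * a\<rfloor> - 1..\<lceil>q * b\<rceil> + 1}. ennreal (2 / (real q * real N)))"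
        using q0 N by (intro sum.cong refl) (subst cball_eq_atLeastAtMost, simp add: field_simps)
      also have "\<dots> = ennreal (real (nat (\<lceil>q * b\<rceil> - \<lfloor>q * a\<rfloor> + 3)) * (2 / (real q * real N)))"
      proof -
        have "card {\<lfloor>q * a\<rfloor> - 1..\<lceil>q * b\<rceil> + 1} = nat (\<lceil>q * b\<rceil> - \<lfloor>q * a\<rfloor> + 3)"
          by (simp add: algebra_simps)
        then show ?thesis
          by (subst ennreal_mult) (simp_all only: sum_constant ennreal_of_nat_eq_real_of_nat, simp_all)
      qed
      also have "\<dots> \<le> ennreal ((real q * (b - a) + 5) * (2 / (real q * real N)))"
      proof (intro ennreal_leI mult_right_mono)
        have "real q * a \<le> real q * b" using ab by (intro mult_left_mono) auto
        then have "real (nat (\<lceil>q * b\<rceil> - \<lfloor>q * a\<rfloor> + 3)) \<le> real q * b - real q * a + 5" by linarith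
        then show "real (nat (\<lceil>q * b\<rceil> - \<lfloor>q * a\<rfloor> + 3)) \<le> real q * (b - a) + 5" by (simp add: algebra_simps)
      qed simp
      also have "(real q * (b - a) + 5) * (2 / (real q * real N)) = 2 * (b - a) / real N + 10 / real N * (1 / real q)"
        using q0 N by (simp add: field_simps)
      finally show "emeasure lborel (\<Union>p\<in>{\<lfloor>q * a\<rfloor> - 1..\<lceil>q * b\<rceil> + 1}. cball (of_int p / real q) (1 / (real q * real N)))
        \<le> ennreal (2 * (b - a) / real N + 10 / real N * (1 / real q))" .
    qed
    also have "\<dots> = ennreal (\<Sum>q\<in>{1..M}. 2 * (b - a) / real N + 10 / real N * (1 / real q))"
      using ab by (intro sum_ennreal) auto
    also have "\<dots> \<le> ennreal ((b - a) / 4)"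
    proof (rule ennreal_leI)
      have "(\<Sum>q\<in>{1..M}. 2 * (b - a) / real N + 10 / real N * (1 / real q)) =
         real M * (2 * (b - a) / real N) + 10 / real N * (\<Sum>q=1..M. 1 / real q)"
        by (simp add: sum.distrib sum_distrib_left)
      also have "\<dots> \<le> (real N / 16) * (2 * (b - a) / real N) + 10 / real N * (2 * sqrt N)"
      proof (intro add_mono mult_right_mono mult_left_mono)
        show "real M \<le> real N / 16" unfolding M_def by linarith
        have "2 * sqrt M \<le> 2 * sqrt N" by (simp add: M_def)
        then show "(\<Sum>q=1..M. 1 / real q) \<le> 2 * sqrt N" using sum_inverse_le_sqrt[of M] by linarith
      qed (use ab in auto)
      also have "\<dots> = (b - a) / 8 + 20 * (1 / sqrt N)"
      proof -
        have "sqrt N / real N = 1 / sqrt N" using N by (metis real_div_sqrt less_imp_le divide_divide_eq_right mult_1 inverse_eq_divide divide_inverse_commute inverse_divide)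
        then show ?thesis using N by (simp add: field_simps)
      qed
      also have "\<dots> \<le> (b - a) / 4" using elim(1) by linarith
      finally show "(\<Sum>q\<in>{1..M}. 2 * (b - a) / real N + 10 / real N * (1 / real q)) \<le> (b - a) / 4" .
    qed
    finally show ?case by (simp add: M_def)
  qed
qed


text \<open>Dirichlet's theorem gives each point of the middle half a fraction p/q with q \<le> N at
  distance below 1/(qN). Removing one eighth of the length for \<open>near_rationals\<close> and one
  quarter for small denominators leaves one eighth to be covered by balls of length at most 32/N^2.
  Hence the count N^2(b-a)/256, with 256 = 8 * 32.\<close>

lemma eventually_children:
  assumes ab: "a < b" and Q: "Q \<ge> 1" and \<epsilon>: "0 < \<epsilon>" "\<epsilon> < 1"
    and good: "emeasure lborel ({a..b} \<inter> near_rationals \<psi> Q) \<le> ennreal ((b - a) / 8)"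
  shows "eventually (\<lambda>N. \<exists>P. finite P \<and> real N ^ 2 * (b - a) / 256 \<le> real (card P) \<and>
    (\<forall>(p, q)\<in>P. coprime p (int q) \<and> N < 16 * q \<and> q \<le> N \<and> Q \<le> q \<and> child \<epsilon> (p, q) \<subseteq> {a..b} \<and>
       emeasure lborel (child \<epsilon> (p, q) \<inter> near_rationals \<psi> (Suc q)) \<le> ennreal (\<epsilon> * \<psi> q / 16) \<and>
       (\<forall>x\<in>child \<epsilon> (p, q). \<forall>p' r. coprime p' (int r) \<longrightarrow> Q \<le> r \<longrightarrow> r \<le> N \<longrightarrow>
          (1 - \<epsilon>) * \<psi> r \<le> \<bar>x - of_int p' / real r\<bar>))) sequentially"
proof -
  have "\<epsilon> / 32 > 0" using \<epsilon> by simp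
  from eventually_square_le[OF this] obtain q1 where
    q1: "\<And>q. q \<ge> q1 \<Longrightarrow> real q ^ 2 * \<psi> q \<le> \<epsilon> / 32" by (auto simp: eventually_sequentially)
  obtain q2 where q2: "\<And>q p. q \<ge> q2 \<Longrightarrow> coprime p (int q) \<Longrightarrow>
    emeasure lborel (child \<epsilon> (p, q) \<inter> near_rationals \<psi> (Suc q)) \<le> ennreal (\<epsilon> * \<psi> q / 16)"
    using eventually_child_good[OF \<epsilon>] by (auto simp: eventually_sequentially)
  have "(\<lambda>q::nat. 2 / real q ^ 2) \<longlonglongrightarrow> 0"
    using tendsto_mult[OF lim_1_over_n lim_1_over_n, THEN tendsto_mult_left, of 2] by (simp add: power2_eq_square)
  then have "eventually (\<lambda>q. 2 / real q ^ 2 < (b - a) / 4) sequentially"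
    by (rule order_tendstoD) (use ab in simp)
  then obtain q3 where q3: "\<And>q. q \<ge> q3 \<Longrightarrow> 2 / real q ^ 2 < (b - a) / 4" by (auto simp: eventually_sequentially)
  obtain q4 :: nat where q4: "4 * real q1 / \<epsilon> < real q4" using reals_Archimedean2 by blast
  \<comment> \<open>The entries provide, in turn: decay of q^2 \<psi>(q) from \<open>q1\<close>, the
    next invariant from \<open>q2\<close>, children close enough to \<open>y\<close> from
    \<open>q3\<close>, and \<epsilon>q/4 > q1 from \<open>q4\<close>. Every denominator used exceeds
    N/16, so N \<ge> 16 q0 suffices.\<close>
  define q0 where "q0 = max (max q1 q2) (max (max q3 q4) (max Q 1))"
  show ?thesis
    using eventually_small_denominators[OF ab] eventually_ge_at_top[of "16 * q0"] eventually_ge_at_top[of 1]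
  proof eventually_elim
    case (elim N)
    have N: "real N > 0" using elim by simp
    \<comment> \<open>The margins of (b-a)/4 keep the children inside the interval although only
      \<open>y\<close> is known to lie in [c,d].\<close>
    define c d where "c = a + (b - a) / 4" and "d = b - (b - a) / 4"
    define P where "P = {(p :: int, q :: nat). coprime p (int q) \<and> N div 16 < q \<and> q \<le> N \<and>
       (\<exists>y\<in>{c..d} - near_rationals \<psi> Q. \<bar>y - of_int p / real q\<bar> < 1 / (real q * real N))}"
    have q: "q \<ge> q0" "N < 16 * q" "q \<ge> 1" "q \<le> N" if "(p, q) \<in> P" for p q
    proof -
      have *: "N div 16 < q" "q \<le> N" using that by (auto simp: P_def)
      then show "N < 16 * q" "q \<le> N" by linarith+
      then show "q \<ge> q0" "q \<ge> 1" using elim by linarith+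
    qed
    have inv_le: "1 / (real q * real N) \<le> 1 / real q ^ 2" if "(p, q) \<in> P" for p q
      unfolding power2_eq_square using q[OF that] by (intro divide_left_mono mult_left_mono mult_pos_pos) auto
    have finP: "finite P"
    proof (rule card_separated(1))
      show "1 / real N ^ 2 > 0" using N by simp
      show "c - 1 \<le> (\<lambda>(p, q). of_int p / real q) x \<and> (\<lambda>(p, q). of_int p / real q) x \<le> (c - 1) + (d - c + 2)"
        if xP: "x \<in> P" for x
      proof -
        obtain p q where x: "x = (p, q)" by (cases x)
        then obtain y where y: "y \<in> {c..d}" "\<bar>y - of_int p / real q\<bar> < 1 / (real q * real N)"
          using xP by (auto simp: P_def)
        have "1 / (real q * real N) \<le> 1 / (1 * 1)"
          using q[of p q] xP x elim by (intro divide_left_mono mult_mono) auto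
        then show ?thesis using x y by auto
      qed
      show "1 / real N ^ 2 \<le> \<bar>(\<lambda>(p, q). of_int p / real q) x - (\<lambda>(p, q). of_int p / real q) y\<bar>"
        if "x \<in> P" "y \<in> P" "x \<noteq> y" for x y
      proof -
        obtain p q p' q' where xy: "x = (p, q)" "y = (p', q')" by (cases x, cases y)
        have qs: "q \<ge> 1" "q' \<ge> 1" "q \<le> N" "q' \<le> N" using q that xy by blast+
        have "1 / real N ^ 2 \<le> 1 / (real q * real q')"
          unfolding power2_eq_square using qs by (intro divide_left_mono mult_mono mult_pos_pos) auto
        also have "\<dots> \<le> \<bar>of_int p / real q - of_int p' / real q'\<bar>"
          using that xy qs by (intro rational_gap) (auto simp: P_def)
        finally show ?thesis by (simp add: xy)
      qed
      show "0 \<le> d - c + 2" using ab by (simp add: c_def d_def)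
    qed
    define D where "D = (\<Union>q\<in>{1..N div 16}. \<Union>p\<in>{\<lfloor>q * a\<rfloor> - 1..\<lceil>q * b\<rceil> + 1}.
      cball (of_int p / real q) (1 / (real q * real N)))"
    define V where "V = (\<Union>(p, q)\<in>P. ball (of_int p / real q) (1 / (real q * real N)))"
    have cover: "{c..d} \<subseteq> ({a..b} \<inter> near_rationals \<psi> Q) \<union> (D \<union> V)"
    proof
      fix y assume y: "y \<in> {c..d}"
      have "a \<le> c" "d \<le> b" using ab by (simp_all add: c_def d_def)
      then have yab: "y \<in> {a..b}" using y by auto
      have "N > 0" using N by simp
      then obtain p k where pk: "coprime p k" "0 < k" "k \<le> int N" "\<bar>of_int k * y - of_int p\<bar> < 1 / N"
        by (rule Dirichlet_approx_coprime)
      define q where "q = nat k"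
      have kq: "k = int q" using pk by (simp add: q_def)
      have q1: "q \<ge> 1" "q \<le> N" using pk kq by auto
      have "y - of_int p / real q = (of_int k * y - of_int p) / real q" using q1 kq by (simp add: field_simps)
      then have "\<bar>y - of_int p / real q\<bar> = \<bar>of_int k * y - of_int p\<bar> / real q" by (simp add: abs_divide)
      also have "\<dots> < 1 / N / real q" using pk q1 by (intro divide_strict_right_mono) auto
      finally have *: "\<bar>y - of_int p / real q\<bar> < 1 / (real q * real N)" by (simp add: mult.commute)
      show "y \<in> ({a..b} \<inter> near_rationals \<psi> Q) \<union> (D \<union> V)"
      proof (cases "q \<le> N div 16")
        case True
        have "1 / real N \<le> 1" using elim by simp
        then have "\<bar>real q * y - of_int p\<bar> < 1" using pk(4) kq by simp
        moreover have "real q * a \<le> real q * y" "real q * y \<le> real q * b" using yab by (auto intro!: mult_left_mono)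
        ultimately have "p \<in> {\<lfloor>q * a\<rfloor> - 1..\<lceil>q * b\<rceil> + 1}" by (auto; linarith)
        then have "y \<in> D" unfolding D_def using True q1 *
          by (intro UN_I[of q] UN_I[of p]) (auto simp: dist_real_def abs_minus_commute)
        then show ?thesis by simp
      next
        case False
        show ?thesis
        proof (cases "y \<in> near_rationals \<psi> Q")
          case True then show ?thesis using yab by simp
        next
          case nF: False
          have "(p, q) \<in> P" unfolding P_def using False nF y * pk(1) kq q1 by auto
          then have "y \<in> V" unfolding V_def using * by (auto simp: dist_real_def abs_minus_commute intro!: bexI[of _ "(p, q)"])
          then show ?thesis by simp
        qed
      qed
    qed
    have VV: "emeasure lborel V \<le> ennreal (real (card P) * (32 / real N ^ 2))"
    proof -
      have "emeasure lborel V \<le> (\<Sum>x\<in>P. emeasure lborel (case x of (p, q) \<Rightarrow> ball (of_int p / real q) (1 / (real q * real N))))"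
        unfolding V_def by (intro emeasure_subadditive_finite finP) (auto split: prod.splits)
      also have "\<dots> \<le> (\<Sum>x\<in>P. ennreal (32 / real N ^ 2))"
      proof (rule sum_mono)
        fix x assume x: "x \<in> P"
        obtain p q where xx: "x = (p, q)" by (cases x)
        have qq: "q \<ge> 1" "real N \<le> 16 * real q" using q[of p q] x xx by auto
        have "2 / (real q * real N) \<le> 32 / real N ^ 2"
          using qq N by (simp add: field_simps power2_eq_square)
        moreover have "emeasure lborel (ball (of_int p / real q) (1 / (real q * real N))) = ennreal (2 / (real q * real N))"
          using qq N by (simp add: ball_eq_greaterThanLessThan field_simps)
        ultimately show "emeasure lborel (case x of (p, q) \<Rightarrow> ball (of_int p / real q) (1 / (real q * real N))) \<le> ennreal (32 / real N ^ 2)"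
          by (simp add: xx ennreal_leI)
      qed
      also have "\<dots> = ennreal (real (card P) * (32 / real N ^ 2))"
        by (subst ennreal_mult) (simp_all only: sum_constant ennreal_of_nat_eq_real_of_nat, simp_all)
      finally show ?thesis .
    qed
    have DV: "D \<in> sets borel" "V \<in> sets borel"
      unfolding D_def V_def using finP by (auto intro!: sets.finite_UN split: prod.splits)
    have cd: "c \<le> d" "d - c = (b - a) / 2" using ab by (simp_all add: c_def d_def field_simps)
    then have "ennreal ((b - a) / 2) = emeasure lborel {c..d}" by simp
    also have "\<dots> \<le> emeasure lborel (({a..b} \<inter> near_rationals \<psi> Q) \<union> (D \<union> V))"
      using DV by (intro emeasure_mono cover) auto
    also have "\<dots> \<le> emeasure lborel ({a..b} \<inter> near_rationals \<psi> Q) + (emeasure lborel D + emeasure lborel V)"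
      using DV by (intro order_trans[OF emeasure_subadditive] add_left_mono emeasure_subadditive) auto
    also have "\<dots> \<le> ennreal ((b - a) / 8) + (ennreal ((b - a) / 4) + ennreal (real (card P) * (32 / real N ^ 2)))"
      using good elim VV by (intro add_mono) (auto simp: D_def)
    also have "\<dots> = ennreal ((b - a) / 8 + ((b - a) / 4 + real (card P) * (32 / real N ^ 2)))"
      using ab by (simp add: ennreal_plus[symmetric] del: ennreal_plus)
    finally have "(b - a) / 2 \<le> (b - a) / 8 + ((b - a) / 4 + real (card P) * (32 / real N ^ 2))"
      using ab by (subst (asm) ennreal_le_iff) auto
    then have "(b - a) / 8 \<le> real (card P) * (32 / real N ^ 2)" by linarith
    then have card: "real N ^ 2 * (b - a) / 256 \<le> real (card P)" using N by (simp add: field_simps)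
    have elts: "coprime p (int q) \<and> N < 16 * q \<and> q \<le> N \<and> Q \<le> q \<and> child \<epsilon> (p, q) \<subseteq> {a..b} \<and>
       emeasure lborel (child \<epsilon> (p, q) \<inter> near_rationals \<psi> (Suc q)) \<le> ennreal (\<epsilon> * \<psi> q / 16) \<and>
       (\<forall>x\<in>child \<epsilon> (p, q). \<forall>p' r. coprime p' (int r) \<longrightarrow> Q \<le> r \<longrightarrow> r \<le> N \<longrightarrow>
          (1 - \<epsilon>) * \<psi> r \<le> \<bar>x - of_int p' / real r\<bar>)" if pq: "(p, q) \<in> P" for p q
    proof (intro conjI ballI allI impI)
      note qq = q[OF pq]
      show cop: "coprime p (int q)" using pq by (auto simp: P_def)
      show "N < 16 * q" "q \<le> N" by fact+
      show "Q \<le> q" using qq by (simp add: q0_def)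
      show "emeasure lborel (child \<epsilon> (p, q) \<inter> near_rationals \<psi> (Suc q)) \<le> ennreal (\<epsilon> * \<psi> q / 16)"
        using qq cop by (intro q2) (auto simp: q0_def)
      obtain y where y: "y \<in> {c..d}" "y \<notin> near_rationals \<psi> Q" "\<bar>y - of_int p / real q\<bar> < 1 / (real q * real N)"
        using pq by (auto simp: P_def)
      show "child \<epsilon> (p, q) \<subseteq> {a..b}"
      proof
        fix x assume "x \<in> child \<epsilon> (p, q)"
        note cb = child_bounds[OF this \<epsilon> qq(3)]
        have "real q ^ 2 * \<psi> q \<le> 1" using q1[of q] qq \<epsilon> by (auto simp: q0_def)
        then have "\<psi> q \<le> 1 / real q ^ 2" using qq by (simp add: field_simps)
        then have "\<bar>x - y\<bar> \<le> 2 / real q ^ 2" using cb y(3) inv_le[OF pq] by linarith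
        also have "\<dots> \<le> (b - a) / 4" using q3[of q] qq by (simp add: q0_def)
        finally have "\<bar>x - y\<bar> \<le> (b - a) / 4" .
        then have "a \<le> x" "x \<le> b" using y(1) unfolding c_def d_def atLeastAtMost_iff by linarith+
        then show "x \<in> {a..b}" by simp
      qed
      fix x p' r assume x: "x \<in> child \<epsilon> (p, q)" and r: "coprime p' (int r)" "Q \<le> r" "r \<le> N"
      have "real q4 \<le> real q" using qq by (simp add: q0_def)
      then have "4 * real q1 / \<epsilon> < real q" using q4 by linarith
      then have big: "\<epsilon> * real q / 4 > real q1" using \<epsilon> by (simp add: field_simps)
      show "(1 - \<epsilon>) * \<psi> r \<le> \<bar>x - of_int p' / real r\<bar>"
        by (rule child_avoids[OF \<epsilon> Q q1 _ big _ _ _ y(2,3) x cop r]) (use qq in \<open>auto simp: q0_def\<close>)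
    qed
    show ?case
    proof (intro exI[of _ P] conjI finP card ballI)
      fix x assume "x \<in> P"
      then show "case x of (p, q) \<Rightarrow> coprime p (int q) \<and> N < 16 * q \<and> q \<le> N \<and> Q \<le> q \<and> child \<epsilon> (p, q) \<subseteq> {a..b} \<and>
       emeasure lborel (child \<epsilon> (p, q) \<inter> near_rationals \<psi> (Suc q)) \<le> ennreal (\<epsilon> * \<psi> q / 16) \<and>
       (\<forall>x\<in>child \<epsilon> (p, q). \<forall>p' r. coprime p' (int r) \<longrightarrow> Q \<le> r \<longrightarrow> r \<le> N \<longrightarrow>
          (1 - \<epsilon>) * \<psi> r \<le> \<bar>x - of_int p' / real r\<bar>)"
        by (cases x) (simp only: prod.case, rule elts, simp)
    qed
  qed
qed

end

section \<open>Refining a family of intervals\<close>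

context approx_fun
begin

section \<open>From reduced fractions to membership in \<open>E_set\<close>\<close>

lemma tendsto_0: "\<psi> \<longlonglongrightarrow> 0"
proof -
  have "(\<lambda>q. real q ^ 2 * \<psi> q * (1 / real q) * (1 / real q)) \<longlonglongrightarrow> 0 * 0 * 0"
    by (intro tendsto_mult lim lim_1_over_n)
  then have "(\<lambda>q. real q ^ 2 * \<psi> q * (1 / real q) * (1 / real q)) \<longlonglongrightarrow> 0" by simp
  then show ?thesis
    by (rule Lim_transform_eventually)
       (use eventually_gt_at_top[of 0] in eventually_elim, simp add: power2_eq_square)
qed

text \<open>A rational with denominator \<open>q0\<close> is at least 1/(q0 q) away from all other
  reduced fractions, more than 1/q^2 as soon as q > q0.\<close>

lemma not_rational:
  assumes io: "\<And>M. \<exists>p q. q \<ge> M \<and> coprime p (int q) \<and> \<bar>x - of_int p / real q\<bar> < \<psi> q"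
    and cop: "coprime p0 (int q0)" and q0: "q0 \<ge> 1"
  shows "x \<noteq> of_int p0 / real q0"
proof
  assume x: "x = of_int p0 / real q0"
  have "eventually (\<lambda>q. real q ^ 2 * \<psi> q \<le> 1) sequentially" by (rule eventually_square_le) simp
  then obtain M where M: "\<And>q. q \<ge> M \<Longrightarrow> real q ^ 2 * \<psi> q \<le> 1" by (auto simp: eventually_sequentially)
  obtain p q where pq: "q \<ge> max M (Suc q0)" "coprime p (int q)" "\<bar>x - of_int p / real q\<bar> < \<psi> q"
    using io by blast
  have q: "real q > 0" "real q0 > 0" using pq q0 by auto
  have "1 / (real q0 * real q) \<le> \<bar>x - of_int p / real q\<bar>"
    unfolding x using pq q0 cop by (intro rational_gap) auto
  also have "\<dots> < \<psi> q" by fact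
  also have "\<dots> \<le> 1 / (real q * real q)" using M[of q] pq q by (simp add: field_simps power2_eq_square)
  also have "\<dots> \<le> 1 / (real q0 * real q)"
    using pq q by (intro divide_left_mono mult_right_mono mult_pos_pos) auto
  finally show False by simp
qed

text \<open>The hypotheses speak of reduced fractions, the goal of all pairs. A pair (p,q) reduces
  to (p0,q0) with \<psi>(q) \<le> \<psi>(q0). A large q0 is excluded by \<open>avoid\<close>; a
  small q0 leaves finitely many fractions, which stay at positive distance because x is irrational,
  while \<psi>(q) tends to 0.\<close>

lemma E_setI:
  assumes x: "x \<in> {0..<1}"
    and io: "\<And>M. \<exists>p q. q \<ge> M \<and> coprime p (int q) \<and> \<bar>x - of_int p / real q\<bar> < \<psi> q"
    and avoid: "\<And>c. 0 < c \<Longrightarrow> c < 1 \<Longrightarrow> \<exists>M. \<forall>p q. q \<ge> M \<longrightarrow> coprime p (int q) \<longrightarrow> c * \<psi> q \<le> \<bar>x - of_int p / real q\<bar>"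
  shows "x \<in> E_set \<psi>"
proof -
  have "x \<in> W_set \<psi>"
  proof -
    have "infinite {(p :: int, q :: nat). q \<ge> 1 \<and> \<bar>x - of_int p / of_nat q\<bar> < \<psi> q}" (is "infinite ?A")
    proof
      assume "finite ?A"
      then have fin: "finite (snd ` ?A)" by simp
      obtain p q where pq: "q \<ge> Suc (Max (insert 0 (snd ` ?A)))" "\<bar>x - of_int p / real q\<bar> < \<psi> q"
        using io by blast
      have "q \<in> snd ` ?A" using pq by (force intro!: image_eqI[of _ _ "(p, q)"])
      then have "q \<le> Max (insert 0 (snd ` ?A))" using fin by (intro Max_ge) auto
      then show False using pq by simp
    qed
    then show ?thesis using x by (auto simp: W_set_def)
  qed
  moreover have "x \<notin> W_set (\<lambda>q. c * \<psi> q)" if c: "0 < c" "c < 1" for c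
  proof
    assume xW: "x \<in> W_set (\<lambda>q. c * \<psi> q)"
    obtain M where M: "\<And>p q. q \<ge> M \<Longrightarrow> coprime p (int q) \<Longrightarrow> c * \<psi> q \<le> \<bar>x - of_int p / real q\<bar>"
      using avoid[OF c] by blast
    define Z where "Z = (\<Union>q\<in>{1..<M}. {p::int. \<bar>x - of_int p / real q\<bar> < \<psi> q \<and> coprime p (int q)} \<times> {q})"
    have "finite {p::int. \<bar>x - of_int p / real q\<bar> < \<psi> q \<and> coprime p (int q)}" if "q \<ge> 1" for q
      by (rule finite_subset[OF _ finite_nearby_numerators[OF that, of x "\<psi> q"]]) auto
    then have finZ: "finite Z" unfolding Z_def by (intro finite_UN_I finite_cartesian_product) auto
    define \<delta> where "\<delta> = Min (insert 1 ((\<lambda>(p, q). \<bar>x - of_int p / real q\<bar>) ` Z))"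
    have "\<delta> > 0"
      unfolding \<delta>_def using finZ not_rational[OF io] by (subst Min_gr_iff) (auto simp: Z_def)
    then have "eventually (\<lambda>q. \<psi> q < \<delta>) sequentially" by (rule order_tendstoD[OF tendsto_0])
    then obtain M' where M': "\<And>q. q \<ge> M' \<Longrightarrow> \<psi> q < \<delta>" by (auto simp: eventually_sequentially)
    obtain q p where pq: "q \<ge> M'" "q \<ge> 1" "\<bar>x - of_int p / real q\<bar> < c * \<psi> q"
      using W_set_unbounded_denominators[OF xW, of M'] by auto
    define g where "g = gcd p (int q)"
    define p0 q0 where "p0 = p div g" and "q0 = nat (int q div g)"
    have g: "g > 0" "p = p0 * g" "int q = (int q div g) * g" using pq by (auto simp: g_def p0_def)
    have div_pos: "int q div g > 0" using g pq by (metis mult_pos_pos mult_zero_left not_less_iff_gr_or_eq of_nat_0_less_iff zero_less_mult_pos2 less_le_trans zero_less_one)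
    then have q0: "int q0 = int q div g" "q0 \<ge> 1" by (auto simp: q0_def)
    have cop: "coprime p0 (int q0)" unfolding q0(1) p0_def g_def using pq by (intro div_gcd_coprime) auto
    have "q0 \<le> q"
    proof -
      have "int q0 * 1 \<le> int q0 * g" using g by (intro mult_left_mono) auto
      then show ?thesis using g q0 by simp
    qed
    have eq: "of_int p / real q = of_int p0 / real q0"
    proof -
      have "real q = real q0 * of_int g" using g(3) q0(1) by (metis of_int_mult of_int_of_nat_eq)
      then show ?thesis using g by simp
    qed
    have \<psi>0: "c * \<psi> q \<le> c * \<psi> q0" using c dec[OF q0(2) \<open>q0 \<le> q\<close>] by simp
    have "q0 < M"
    proof (rule ccontr)
      assume "\<not> q0 < M"
      then have "c * \<psi> q0 \<le> \<bar>x - of_int p0 / real q0\<bar>" using cop by (intro M) auto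
      then show False using pq(3) \<psi>0 eq by simp
    qed
    moreover have "c * \<psi> q0 \<le> \<psi> q0" using c pos[OF q0(2)] by (simp add: mult_left_le_one_le)
    ultimately have "(p0, q0) \<in> Z" using pq(3) \<psi>0 eq cop q0 unfolding Z_def by auto
    then have "\<delta> \<le> \<bar>x - of_int p / real q\<bar>"
      unfolding \<delta>_def eq using finZ by (intro Min_le) (auto intro!: image_eqI[of _ _ "(p0, q0)"])
    also have "\<dots> < c * \<psi> q" by fact
    finally have "\<delta> < c * \<psi> q" .
    moreover have "c * \<psi> q \<le> \<psi> q" using c pos[OF pq(2)] by (simp add: mult_left_le_one_le)
    moreover have "\<psi> q < \<delta>" using M' pq by auto
    ultimately show False by linarith
  qed
  ultimately show ?thesis by (auto simp: E_set_def)
qed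

text \<open>The number Q is the first denominator still to be treated. The fraction 1/8 is what
  \<open>eventually_children\<close> can afford and what \<open>eventually_child_good\<close>
  restores.\<close>

definition good_family :: "nat \<Rightarrow> real set set \<Rightarrow> bool" where
  "good_family Q F \<longleftrightarrow> finite F \<and> F \<noteq> {} \<and> disjoint F \<and>
    (\<forall>J\<in>F. \<exists>a b. a < b \<and> J = {a..b} \<and> J \<subseteq> {0..<1} \<and>
       emeasure lborel (J \<inter> near_rationals \<psi> Q) \<le> ennreal ((b - a) / 8))"

text \<open>One refinement treats the block of denominators from Q to N: the first clause will give
  membership in \<open>W_set\<close>, the second exclusion from the sets with factor c once 1 -
  \<epsilon> \<ge> c.\<close>

definition approximates :: "real \<Rightarrow> nat \<Rightarrow> nat \<Rightarrow> real \<Rightarrow> bool" where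
  "approximates \<epsilon> Q N x \<longleftrightarrow>
    (\<exists>p q. coprime p (int q) \<and> Q \<le> q \<and> q \<le> N \<and> \<bar>x - of_int p / real q\<bar> < \<psi> q) \<and>
    (\<forall>p q. coprime p (int q) \<longrightarrow> Q \<le> q \<longrightarrow> q \<le> N \<longrightarrow> (1 - \<epsilon>) * \<psi> q \<le> \<bar>x - of_int p / real q\<bar>)"

lemma good_family_cantor: "good_family Q F \<Longrightarrow> cantor_family F"
  unfolding good_family_def cantor_family_def by fastforce

lemma child_interval:
  assumes "0 < \<epsilon>" "\<epsilon> < 1" "q \<ge> 1"
  obtains u v where "u < v" "child \<epsilon> (p, q) = {u..v}" "v - u = \<epsilon> * \<psi> q / 2"
proof
  define u v where "u = of_int p / real q + (1 - \<epsilon>) * \<psi> q" and "v = of_int p / real q + (1 - \<epsilon> / 2) * \<psi> q"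
  show uv: "v - u = \<epsilon> * \<psi> q / 2" by (simp add: u_def v_def algebra_simps)
  have "\<epsilon> * \<psi> q / 2 > 0" using assms pos by simp
  then show "u < v" using uv by linarith
  show "child \<epsilon> (p, q) = {u..v}" by (simp add: child_def u_def v_def)
qed

text \<open>The constant \<open>B\<close> compares counting with length. Here 3072 = 512 * 6: each
  interval gets at least N^2/512 children per unit of the common length bound, so \<open>F'\<close>
  has at least 6N^2/B members, and 6 absorbs the count of fractions 1/N^2 apart in a window. The new
  constant reproduces 3072 since children have diameter at least \<epsilon>\<psi>(N)/2.\<close>

lemma eventually_refinement:
  assumes F: "good_family Q F" and Q: "Q \<ge> 1" and \<epsilon>: "0 < \<epsilon>" "\<epsilon> < 1" and B: "B > 0"
    and len: "\<And>J. J \<in> F \<Longrightarrow> 3072 \<le> diameter J * real (card F) * B"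
  shows "eventually (\<lambda>N. \<exists>F' n. refines n F F' \<and> good_family (Suc N) F' \<and>
     (\<forall>J\<in>F'. 3072 \<le> diameter J * real (card F') * (1024 * B / (\<epsilon> * \<psi> N * real N ^ 2))) \<and>
     (\<forall>J\<in>F'. diameter J \<le> 1 / real N ^ 2) \<and>
     (\<forall>c r. 0 \<le> r \<longrightarrow> real (card (meeting F' c r)) \<le> B * max r (1 / real N ^ 2) * real (card F')) \<and>
     (\<forall>J\<in>F'. \<forall>x\<in>J. approximates \<epsilon> Q N x)) sequentially"
proof -
  have cF: "cantor_family F" by (rule good_family_cantor[OF F])
  have card: "real (card F) > 0" using cantor_familyD(6)[OF cF] by simp
  \<comment> \<open>A common lower bound for the lengths: the surplus children of longer intervals
    are thrown away so that all intervals keep the same number.\<close>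
  define l where "l = 3072 / (real (card F) * B)"
  have l: "l > 0" using card B by (simp add: l_def)
  have len': "l \<le> diameter J" if "J \<in> F" for J
    using len[OF that] card B by (simp add: l_def field_simps)
  define admissible where "admissible N J = (\<lambda>(p, q). coprime p (int q) \<and> N < 16 * q \<and> q \<le> N \<and> Q \<le> q \<and> child \<epsilon> (p, q) \<subseteq> J \<and>
       emeasure lborel (child \<epsilon> (p, q) \<inter> near_rationals \<psi> (Suc q)) \<le> ennreal (\<epsilon> * \<psi> q / 16) \<and>
       (\<forall>x\<in>child \<epsilon> (p, q). \<forall>p' r. coprime p' (int r) \<longrightarrow> Q \<le> r \<longrightarrow> r \<le> N \<longrightarrow>
          (1 - \<epsilon>) * \<psi> r \<le> \<bar>x - of_int p' / real r\<bar>))" for N J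
  have ev1: "eventually (\<lambda>N. \<forall>J\<in>F. \<exists>P. finite P \<and> real N ^ 2 * diameter J / 256 \<le> real (card P) \<and>
      (\<forall>x\<in>P. admissible N J x)) sequentially"
  proof (rule eventually_ball_finite)
    show "finite F" by (rule cantor_familyD(1)[OF cF])
    show "\<forall>J\<in>F. eventually (\<lambda>N. \<exists>P. finite P \<and> real N ^ 2 * diameter J / 256 \<le> real (card P) \<and> (\<forall>x\<in>P. admissible N J x)) sequentially"
    proof
      fix J assume "J \<in> F"
      then obtain a b where J: "a < b" "J = {a..b}" "emeasure lborel (J \<inter> near_rationals \<psi> Q) \<le> ennreal ((b - a) / 8)"
        using F by (auto simp: good_family_def)
      have "diameter J = b - a" using J by simp
      then show "eventually (\<lambda>N. \<exists>P. finite P \<and> real N ^ 2 * diameter J / 256 \<le> real (card P) \<and> (\<forall>x\<in>P. admissible N J x)) sequentially"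
        unfolding admissible_def using eventually_children[OF J(1) Q \<epsilon>] J by simp
    qed
  qed
  \<comment> \<open>With N^2 l/256 \<ge> 2, rounding down to \<open>n\<close> loses at most half,
    which turns 256 into 512.\<close>
  obtain n0 :: nat where n0: "512 / l < real n0" using reals_Archimedean2 by blast
  \<comment> \<open>As N < 16q, this gives \<psi>(q) \<le> 1/(8N^2): children are much shorter than
    the gaps 1/N^2 and therefore disjoint.\<close>
  have "eventually (\<lambda>q. real q ^ 2 * \<psi> q \<le> 1 / 2048) sequentially" by (rule eventually_square_le) simp
  then obtain q0 where q0: "\<And>q. q \<ge> q0 \<Longrightarrow> real q ^ 2 * \<psi> q \<le> 1 / 2048" by (auto simp: eventually_sequentially)
  show ?thesis
    using ev1 eventually_ge_at_top[of "max n0 1"] eventually_ge_at_top[of "16 * q0"]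
  proof eventually_elim
    case (elim N)
    have N: "real N \<ge> 1" using elim by simp
    have \<psi>N: "\<psi> N > 0" using pos elim by auto
    have Nl: "512 \<le> real N ^ 2 * l"
    proof -
      have "512 \<le> real n0 * l" using n0 l by (simp add: field_simps)
      also have "\<dots> \<le> real N * l" using elim l by (intro mult_right_mono) auto
      also have "\<dots> \<le> real N ^ 2 * l" using N l by (intro mult_right_mono) (auto simp: power2_eq_square)
      finally show ?thesis .
    qed
    define n where "n = nat \<lfloor>real N ^ 2 * l / 256\<rfloor>"
    have n_le: "real n \<le> real N ^ 2 * l / 256" using Nl unfolding n_def by (intro of_nat_floor) linarith
    have n_ge: "real N ^ 2 * l / 512 \<le> real n" using Nl unfolding n_def by linarith
    have "\<forall>J\<in>F. \<exists>P. finite P \<and> card P = n \<and> (\<forall>x\<in>P. admissible N J x)"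
    proof
      fix J assume J: "J \<in> F"
      then obtain P where P: "finite P" "real N ^ 2 * diameter J / 256 \<le> real (card P)" "\<forall>x\<in>P. admissible N J x"
        using elim by blast
      have "real N ^ 2 * l / 256 \<le> real N ^ 2 * diameter J / 256"
        using len'[OF J] by (intro divide_right_mono mult_left_mono) auto
      then have "n \<le> card P" using n_le P by simp
      then obtain P' where P': "P' \<subseteq> P" "card P' = n" "finite P'" using obtain_subset_with_card_n by metis
      then show "\<exists>P. finite P \<and> card P = n \<and> (\<forall>x\<in>P. admissible N J x)" using P by blast
    qed
    then obtain P where P: "\<And>J. J \<in> F \<Longrightarrow> finite (P J)" "\<And>J. J \<in> F \<Longrightarrow> card (P J) = n"
      "\<And>J x. J \<in> F \<Longrightarrow> x \<in> P J \<Longrightarrow> admissible N J x" by metis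
    define G where "G = (\<Union>J\<in>F. P J)"
    define F' where "F' = child \<epsilon> ` G"
    have finG: "finite G" using P(1) cantor_familyD(1)[OF cF] by (auto simp: G_def)
    have G: "coprime p (int q)" "N < 16 * q" "q \<le> N" "Q \<le> q" "q \<ge> 1" "\<psi> q \<le> 1 / (8 * real N ^ 2)" "\<psi> q > 0"
      "emeasure lborel (child \<epsilon> (p, q) \<inter> near_rationals \<psi> (Suc q)) \<le> ennreal (\<epsilon> * \<psi> q / 16)"
      "\<And>x p' r. x\<in>child \<epsilon> (p, q) \<Longrightarrow> coprime p' (int r) \<Longrightarrow> Q \<le> r \<Longrightarrow> r \<le> N \<Longrightarrow>
          (1 - \<epsilon>) * \<psi> r \<le> \<bar>x - of_int p' / real r\<bar>"
      if pq: "(p, q) \<in> G" for p q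
    proof -
      obtain J where "J \<in> F" "admissible N J (p, q)" using pq P(3) by (auto simp: G_def)
      then have adm: "coprime p (int q)" "N < 16 * q" "q \<le> N" "Q \<le> q"
         "emeasure lborel (child \<epsilon> (p, q) \<inter> near_rationals \<psi> (Suc q)) \<le> ennreal (\<epsilon> * \<psi> q / 16)"
         "\<forall>x\<in>child \<epsilon> (p, q). \<forall>p' r. coprime p' (int r) \<longrightarrow> Q \<le> r \<longrightarrow> r \<le> N \<longrightarrow>
            (1 - \<epsilon>) * \<psi> r \<le> \<bar>x - of_int p' / real r\<bar>" by (auto simp: admissible_def)
      show "coprime p (int q)" "N < 16 * q" "q \<le> N" "Q \<le> q"
         "emeasure lborel (child \<epsilon> (p, q) \<inter> near_rationals \<psi> (Suc q)) \<le> ennreal (\<epsilon> * \<psi> q / 16)" by fact+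
      show q1: "q \<ge> 1" using adm Q by simp
      then show \<psi>q: "\<psi> q > 0" by (rule pos)
      have "real N ^ 2 * \<psi> q \<le> (16 * real q) ^ 2 * \<psi> q"
        using adm(2) \<psi>q by (intro mult_right_mono power_mono) auto
      also have "\<dots> = 256 * (real q ^ 2 * \<psi> q)" by (simp add: power2_eq_square)
      also have "\<dots> \<le> 1 / 8" using q0[of q] elim adm(2) by auto
      finally show "\<psi> q \<le> 1 / (8 * real N ^ 2)" using N by (simp add: field_simps)
      show "(1 - \<epsilon>) * \<psi> r \<le> \<bar>x - of_int p' / real r\<bar>"
        if "x\<in>child \<epsilon> (p, q)" "coprime p' (int r)" "Q \<le> r" "r \<le> N" for x p' r
        using adm(6) that by blast
    qed
    define frac where "frac = (\<lambda>(p :: int, q :: nat). of_int p / real q :: real)"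
    have sep: "1 / real N ^ 2 \<le> \<bar>frac x - frac y\<bar>" if xyG: "x \<in> G" "y \<in> G" "x \<noteq> y" for x y
    proof -
      obtain p q p' q' where xy: "x = (p, q)" "y = (p', q')" by (cases x, cases y)
      have qs: "q \<ge> 1" "q' \<ge> 1" "q \<le> N" "q' \<le> N" "coprime p (int q)" "coprime p' (int q')" using G xyG xy by blast+
      have "1 / real N ^ 2 \<le> 1 / (real q * real q')"
        unfolding power2_eq_square using qs by (intro divide_left_mono mult_mono mult_pos_pos) auto
      also have "\<dots> \<le> \<bar>of_int p / real q - of_int p' / real q'\<bar>"
        using xyG xy qs by (intro rational_gap) auto
      finally show ?thesis by (simp add: xy frac_def)
    qed
    have loc: "0 \<le> z - frac x" "z - frac x < 1 / (8 * real N ^ 2)" if "x \<in> G" "z \<in> child \<epsilon> x" for x z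
    proof -
      obtain p q where x: "x = (p, q)" by (cases x)
      have G': "(p, q) \<in> G" "z \<in> child \<epsilon> (p, q)" using that x by auto
      show "0 \<le> z - frac x" "z - frac x < 1 / (8 * real N ^ 2)"
        using child_bounds[OF G'(2) \<epsilon> G(5)[OF G'(1)]] G(6)[OF G'(1)] by (auto simp: x frac_def)
    qed
    have dj: "child \<epsilon> x \<inter> child \<epsilon> y = {}" if "x \<in> G" "y \<in> G" "x \<noteq> y" for x y
    proof (rule ccontr)
      assume "child \<epsilon> x \<inter> child \<epsilon> y \<noteq> {}"
      then obtain z where z: "z \<in> child \<epsilon> x" "z \<in> child \<epsilon> y" by auto
      have "1 / (8 * real N ^ 2) \<le> 1 / real N ^ 2" using N by (intro divide_left_mono) auto
      then show False using loc[OF that(1) z(1)] loc[OF that(2) z(2)] sep[OF that] by linarith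
    qed
    have interval: "\<exists>u v. u < v \<and> child \<epsilon> x = {u..v} \<and> v - u = \<epsilon> * \<psi> (snd x) / 2" if "x \<in> G" for x
    proof -
      obtain p q where x: "x = (p, q)" by (cases x)
      have "q \<ge> 1" using G(5) that x by blast
      then show ?thesis using child_interval[OF \<epsilon>, of q p] x by (metis snd_conv)
    qed
    have ne: "child \<epsilon> x \<noteq> {}" if "x \<in> G" for x using interval[OF that] by auto
    have inj: "inj_on (child \<epsilon>) G" using dj ne by (intro inj_onI) (metis Int_absorb)
    have diam: "diameter (child \<epsilon> x) = \<epsilon> * \<psi> (snd x) / 2" if "x \<in> G" for x
      using interval[OF that] by auto
    have ref: "refines n F F'"
      unfolding refines_def
    proof (intro conjI ballI)
      fix J' assume "J' \<in> F'"
      then obtain x J where "J' = child \<epsilon> x" "x \<in> P J" "J \<in> F" by (auto simp: F'_def G_def)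
      then show "\<exists>J\<in>F. J' \<subseteq> J" using P(3)[of J x] by (auto simp: admissible_def split: prod.splits)
    next
      fix J assume J: "J \<in> F"
      have sub: "child \<epsilon> x \<subseteq> J1" if "J1 \<in> F" "x \<in> P J1" for x J1
        using P(3)[OF that] by (auto simp: admissible_def split: prod.splits)
      have "{J'\<in>F'. J' \<subseteq> J} = child \<epsilon> ` P J"
      proof (intro equalityI subsetI)
        fix J' assume "J' \<in> {J'\<in>F'. J' \<subseteq> J}"
        then obtain x J1 where x: "J' = child \<epsilon> x" "x \<in> P J1" "J1 \<in> F" "J' \<subseteq> J" by (auto simp: F'_def G_def)
        have "x \<in> G" using x by (auto simp: G_def)
        then have "J1 = J" using refines_unique_parent[OF cF x(3) J _ _ x(4)] sub[OF x(3,2)] ne x(1) by blast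
        then show "J' \<in> child \<epsilon> ` P J" using x by blast
      qed (use sub J in \<open>auto simp: F'_def G_def\<close>)
      also have "card \<dots> = n"
        using P(2)[OF J] J by (subst card_image[OF inj_on_subset[OF inj]]) (auto simp: G_def)
      finally show "card {J'\<in>F'. J' \<subseteq> J} = n" .
    qed
    have "n > 0"
    proof -
      have "real n > 0" using n_ge Nl by linarith
      then show ?thesis by simp
    qed
    have goodF': "good_family (Suc N) F'"
      unfolding good_family_def
    proof (intro conjI ballI)
      show "finite F'" using finG by (simp add: F'_def)
      show "F' \<noteq> {}"
      proof -
        obtain J where "J \<in> F" using cantor_familyD(2)[OF cF] by blast
        then have "P J \<noteq> {}" using P(2) \<open>n > 0\<close> by fastforce
        then show ?thesis using \<open>J \<in> F\<close> by (auto simp: F'_def G_def)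
      qed
      show "disjoint F'"
      proof (rule pairwiseI)
        fix J1 J2 assume "J1 \<in> F'" "J2 \<in> F'" "J1 \<noteq> J2"
        then obtain x y where "x \<in> G" "y \<in> G" "J1 = child \<epsilon> x" "J2 = child \<epsilon> y" "x \<noteq> y" by (auto simp: F'_def)
        then show "disjnt J1 J2" using dj by (simp add: disjnt_def)
      qed
      fix J' assume J': "J' \<in> F'"
      then obtain x where x: "x \<in> G" "J' = child \<epsilon> x" by (auto simp: F'_def)
      obtain u v where uv: "u < v" "child \<epsilon> x = {u..v}" "v - u = \<epsilon> * \<psi> (snd x) / 2" using interval[OF x(1)] by blast
      obtain J where J: "J \<in> F" "J' \<subseteq> J" using ref J' by (auto simp: refines_def)
      have "J \<subseteq> {0..<1}" using F J(1) by (auto simp: good_family_def)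
      then have sub01: "J' \<subseteq> {0..<1}" using J by blast
      obtain p q where xpq: "x = (p, q)" by (cases x)
      have pqG: "(p, q) \<in> G" using x xpq by simp
      have "emeasure lborel (J' \<inter> near_rationals \<psi> (Suc N)) \<le> emeasure lborel (J' \<inter> near_rationals \<psi> (Suc q))"
      proof (rule emeasure_mono)
        show "J' \<inter> near_rationals \<psi> (Suc N) \<subseteq> J' \<inter> near_rationals \<psi> (Suc q)"
          using near_rationals_antimono[of "Suc q" "Suc N" \<psi>] G(3)[OF pqG] by auto
        show "J' \<inter> near_rationals \<psi> (Suc q) \<in> sets lborel" using x(2) uv(2) by simp
      qed
      also have "\<dots> \<le> ennreal (\<epsilon> * \<psi> q / 16)" using G(8)[OF pqG] x(2) xpq by simp
      also have "\<epsilon> * \<psi> q / 16 = (v - u) / 8" using uv(3) xpq by simp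
      finally show "\<exists>a b. a < b \<and> J' = {a..b} \<and> J' \<subseteq> {0..<1} \<and>
         emeasure lborel (J' \<inter> near_rationals \<psi> (Suc N)) \<le> ennreal ((b - a) / 8)"
        using uv x(2) sub01 by blast
    qed
    have cF': "cantor_family F'" by (rule good_family_cantor[OF goodF'])
    have cardF': "real (card F') = real n * real (card F)" using refines_card[OF cF cF' ref] by simp
    have cardF'_ge: "real N ^ 2 * 6 / B \<le> real (card F')"
    proof -
      have "real N ^ 2 * 6 / B = real N ^ 2 * l / 512 * real (card F)" using card B by (simp add: l_def field_simps)
      also have "\<dots> \<le> real (card F')" unfolding cardF' using n_ge by (intro mult_right_mono) auto
      finally show ?thesis .
    qed
    have 3: "3072 \<le> diameter J * real (card F') * (1024 * B / (\<epsilon> * \<psi> N * real N ^ 2))" if "J \<in> F'" for J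
    proof -
      obtain x where x: "x \<in> G" "J = child \<epsilon> x" using \<open>J \<in> F'\<close> by (auto simp: F'_def)
      obtain p q where xpq: "x = (p, q)" by (cases x)
      have "\<psi> N \<le> \<psi> q" using G(3,5) x xpq by (intro dec) auto
      then have "\<epsilon> * \<psi> N / 2 \<le> diameter J" using diam[OF x(1)] x xpq \<epsilon> by simp
      moreover have "0 \<le> \<epsilon> * \<psi> N / 2" using \<epsilon> \<psi>N by simp
      ultimately have "\<epsilon> * \<psi> N / 2 \<le> diameter J" "0 \<le> diameter J" by linarith+
      then have "(\<epsilon> * \<psi> N / 2) * (real N ^ 2 * 6 / B) * (1024 * B / (\<epsilon> * \<psi> N * real N ^ 2)) \<le> diameter J * real (card F') * (1024 * B / (\<epsilon> * \<psi> N * real N ^ 2))"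
        using cardF'_ge \<epsilon> \<psi>N B by (intro mult_right_mono mult_mono) auto
      moreover have "(\<epsilon> * \<psi> N / 2) * (real N ^ 2 * 6 / B) * (1024 * B / (\<epsilon> * \<psi> N * real N ^ 2)) = 3072"
        using \<epsilon> \<psi>N B N by (simp add: field_simps)
      ultimately show ?thesis by simp
    qed
    have 4: "diameter J \<le> 1 / real N ^ 2" if "J \<in> F'" for J
    proof -
      obtain x where x: "x \<in> G" "J = child \<epsilon> x" using \<open>J \<in> F'\<close> by (auto simp: F'_def)
      obtain p q where xpq: "x = (p, q)" by (cases x)
      have \<psi>q: "\<psi> q \<le> 1 / (8 * real N ^ 2)" "\<psi> q > 0" using G(6,7) x xpq by auto
      have "\<epsilon> * \<psi> q \<le> 1 * \<psi> q" using \<epsilon> \<psi>q by (intro mult_right_mono) auto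
      moreover have "diameter J = \<epsilon> * \<psi> q / 2" using diam[OF x(1)] x xpq by simp
      ultimately have "diameter J \<le> \<psi> q" using \<psi>q by linarith
      also have "\<dots> \<le> 1 / real N ^ 2" by (rule order_trans[OF \<psi>q(1)]) (use N in \<open>intro divide_left_mono, auto\<close>)
      finally show ?thesis .
    qed
    have 5: "real (card (meeting F' c r)) \<le> B * max r (1 / real N ^ 2) * real (card F')" if r: "0 \<le> r" for c r
    proof -
      define H where "H = {x\<in>G. child \<epsilon> x \<inter> {c-r..c+r} \<noteq> {}}"
      have finH: "finite H" using finG by (simp add: H_def)
      have "meeting F' c r = child \<epsilon> ` H" by (auto simp: meeting_def F'_def H_def)
      then have "card (meeting F' c r) \<le> card H" using finH by (simp add: card_image_le)
      moreover have "real (card H) \<le> 1 + (2 * r + 1 / (8 * real N ^ 2)) / (1 / real N ^ 2)"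
      proof (rule card_separated(2))
        show "1 / real N ^ 2 > 0" using N by simp
        show "0 \<le> 2 * r + 1 / (8 * real N ^ 2)" using r by simp
        show "c - r - 1 / (8 * real N ^ 2) \<le> frac x \<and> frac x \<le> c - r - 1 / (8 * real N ^ 2) + (2 * r + 1 / (8 * real N ^ 2))"
          if xH: "x \<in> H" for x
        proof -
          obtain z where z: "z \<in> child \<epsilon> x" "z \<in> {c-r..c+r}" "x \<in> G" using xH unfolding H_def by blast
          then show ?thesis using loc[OF z(3,1)] by auto
        qed
        show "1 / real N ^ 2 \<le> \<bar>frac x - frac y\<bar>" if "x \<in> H" "y \<in> H" "x \<noteq> y" for x y
          using sep that by (simp add: H_def)
      qed
      moreover have "1 + (2 * r + 1 / (8 * real N ^ 2)) / (1 / real N ^ 2) = 9 / 8 + 2 * (r * real N ^ 2)"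
        using N by (simp add: field_simps)
      moreover define X where "X = max (r * real N ^ 2) 1"
      have "9 / 8 + 2 * (r * real N ^ 2) \<le> 6 * X" unfolding X_def by linarith
      moreover have "6 * X \<le> B * max r (1 / real N ^ 2) * real (card F')"
      proof -
        have "max r (1 / real N ^ 2) = X / real N ^ 2"
        proof -
          have "max r (1 / real N ^ 2) * real N ^ 2 = X"
            unfolding X_def using N by (simp add: max_mult_distrib_right)
          then show ?thesis using N by (metis nonzero_mult_div_cancel_right power_not_zero not_one_le_zero)
        qed
        then have "6 * X = B * max r (1 / real N ^ 2) * (real N ^ 2 * 6 / B)" using N B by simp
        also have "\<dots> \<le> B * max r (1 / real N ^ 2) * real (card F')"
          using cardF'_ge B r by (intro mult_left_mono) auto
        finally show ?thesis .
      qed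
      ultimately show ?thesis by linarith
    qed
    have 6: "approximates \<epsilon> Q N x" if J: "J \<in> F'" "x \<in> J" for J x
    proof -
      obtain y where y: "y \<in> G" "J = child \<epsilon> y" using J by (auto simp: F'_def)
      obtain p q where xpq: "y = (p, q)" by (cases y)
      have pqG: "(p, q) \<in> G" and xc: "x \<in> child \<epsilon> (p, q)" using y xpq J by auto
      have "\<bar>x - of_int p / real q\<bar> < \<psi> q" using child_bounds[OF xc \<epsilon> G(5)[OF pqG]] by simp
      then show ?thesis unfolding approximates_def using G(1,3,4)[OF pqG] G(9)[OF pqG xc] by blast
    qed
    show ?case using ref goodF' 3 4 5 6 by (intro exI[of _ F'] exI[of _ n]) auto
  qed
qed

end

section \<open>The tower of exactly approximable points\<close>

locale approx_system =
  fixes \<psi> :: "'m::finite \<Rightarrow> nat \<Rightarrow> real" and idx :: "nat \<Rightarrow> 'm" and s \<eta> :: real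
  assumes approx: "approx_fun (\<psi> i)"
    and idx_recurrent: "\<exists>u\<ge>t. idx u = i"
    and s: "0 \<le> s" "s \<le> 1" and \<eta>: "\<eta> > 0"
    and large_often: "\<exists>N\<ge>M. 1 \<le> \<psi> i N powr s * real N ^ 2"
begin

abbreviation good_family where "good_family i \<equiv> approx_fun.good_family (\<psi> i)"
abbreviation approximates where "approximates i \<equiv> approx_fun.approximates (\<psi> i)"

definition eps :: "nat \<Rightarrow> real" where "eps t = 1 / (real t + 2)"

lemma eps: "0 < eps t" "eps t < 1"
  by (auto simp: eps_def)

text \<open>For coordinate i, \<open>h i\<close> is the first untreated denominator and
  \<open>B i\<close> the density constant; \<open>N\<close> is the last denominator bound, which has
  to grow.\<close>

definition valid :: "('m \<Rightarrow> real set set) \<Rightarrow> ('m \<Rightarrow> nat) \<Rightarrow> ('m \<Rightarrow> real) \<Rightarrow> nat \<Rightarrow> bool" where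
  "valid S h B N \<longleftrightarrow> N \<ge> 1 \<and> (\<forall>i. good_family i (h i) (S i) \<and> h i \<ge> 1 \<and> B i > 0 \<and>
     (\<forall>J\<in>S i. 3072 \<le> diameter J * real (card (S i)) * B i))"

text \<open>The bound on 1024 / eps t * B j concerns all coordinates, not only the refined one: it
  lets every constant be absorbed at scales up to N'^-2. The new \<open>B'\<close> of the refined
  coordinate is as large as 1/(\<psi>(N') N'^2) allows and is absorbed by the choice at the next
  stage.\<close>

definition step where
  "step t S h B (N::nat) S' h' B' N' \<longleftrightarrow>
     N < N' \<and> h (idx t) \<le> N' \<and> (\<forall>j. 1024 / eps t * B j \<le> real N' powr (2 * \<eta>)) \<and>
     1 \<le> \<psi> (idx t) N' powr s * real N' ^ 2 \<and>
     (\<exists>n. refines n (S (idx t)) (S' (idx t))) \<and> (\<forall>j. j \<noteq> idx t \<longrightarrow> S' j = S j) \<and>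
     h' = h(idx t := Suc N') \<and>
     B' = B(idx t := 1024 * B (idx t) / (eps t * \<psi> (idx t) N' * real N' ^ 2)) \<and>
     (\<forall>J\<in>S' (idx t). diameter J \<le> 1 / real N' ^ 2) \<and>
     (\<forall>c r. 0 \<le> r \<longrightarrow> real (card (meeting (S' (idx t)) c r)) \<le> B (idx t) * max r (1 / real N' ^ 2) * real (card (S' (idx t)))) \<and>
     (\<forall>J\<in>S' (idx t). \<forall>x\<in>J. approximates (idx t) (eps t) (h (idx t)) N' x)"

lemma step_exists:
  assumes v: "valid S h B N"
  shows "\<exists>S' h' B' N'. valid S' h' B' N' \<and> step t S h B N S' h' B' N'"
proof -
  define i where "i = idx t"
  interpret A: approx_fun "\<psi> i" by (rule approx)
  have vi: "good_family j (h j) (S j)" "h j \<ge> 1" "B j > 0" "\<And>J. J \<in> S j \<Longrightarrow> 3072 \<le> diameter J * real (card (S j)) * B j" for j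
    using v by (auto simp: valid_def)
  define C where "C = (\<Sum>j\<in>UNIV. 1024 / eps t * B j)"
  have Cj: "1024 / eps t * B j \<le> C" for j
    unfolding C_def using vi(3) eps[of t] by (intro member_le_sum) (auto intro!: mult_nonneg_nonneg less_imp_le)
  have C0: "C > 0" unfolding C_def using vi(3) eps[of t] by (intro sum_pos) auto
  have "eventually (\<lambda>N. \<exists>F' n. refines n (S i) F' \<and> good_family i (Suc N) F' \<and>
     (\<forall>J\<in>F'. 3072 \<le> diameter J * real (card F') * (1024 * B i / (eps t * \<psi> i N * real N ^ 2))) \<and>
     (\<forall>J\<in>F'. diameter J \<le> 1 / real N ^ 2) \<and>
     (\<forall>c r. 0 \<le> r \<longrightarrow> real (card (meeting F' c r)) \<le> B i * max r (1 / real N ^ 2) * real (card F')) \<and>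
     (\<forall>J\<in>F'. \<forall>x\<in>J. approximates i (eps t) (h i) N x)) sequentially"
    (is "eventually ?refinable _")
    by (rule A.eventually_refinement[OF vi(1,2) eps vi(3)]) (rule vi(4))
  then obtain M0 where M0: "\<forall>N\<ge>M0. ?refinable N"
    unfolding eventually_sequentially by (rule exE)
  obtain M1 :: nat where M1: "C powr (1 / (2 * \<eta>)) < real M1" using reals_Archimedean2 by blast
  obtain N' where N': "N' \<ge> max (max M0 M1) (max (Suc N) (h i))" "1 \<le> \<psi> i N' powr s * real N' ^ 2"
    using large_often by blast
  have N'1: "N' \<ge> M0" "N' \<ge> M1" "N < N'" "h i \<le> N'" "N' \<ge> 1" using N'(1) by auto
  obtain F' n where F': "refines n (S i) F'" "good_family i (Suc N') F'"
     "\<forall>J\<in>F'. 3072 \<le> diameter J * real (card F') * (1024 * B i / (eps t * \<psi> i N' * real N' ^ 2))"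
     "\<forall>J\<in>F'. diameter J \<le> 1 / real N' ^ 2"
     "\<forall>c r. 0 \<le> r \<longrightarrow> real (card (meeting F' c r)) \<le> B i * max r (1 / real N' ^ 2) * real (card F')"
     "\<forall>J\<in>F'. \<forall>x\<in>J. approximates i (eps t) (h i) N' x" using M0[rule_format, OF N'1(1)] by (elim exE conjE) (rule that)
  have "C \<le> real N' powr (2 * \<eta>)"
  proof -
    have "C = (C powr (1 / (2 * \<eta>))) powr (2 * \<eta>)" using C0 \<eta> by (simp add: powr_powr)
    also have "\<dots> \<le> real N' powr (2 * \<eta>)" using M1 N'1(2) \<eta> by (intro powr_mono2) auto
    finally show ?thesis .
  qed
  then have CN: "\<forall>j. 1024 / eps t * B j \<le> real N' powr (2 * \<eta>)" using Cj order_trans by blast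
  define B' where "B' = B(i := 1024 * B i / (eps t * \<psi> i N' * real N' ^ 2))"
  have "B' j > 0" for j using vi(3) eps[of t] A.pos[OF N'1(5)] N'1(5) by (auto simp: B'_def)
  then have "valid (S(i := F')) (h(i := Suc N')) B' N'"
    unfolding valid_def using vi F' N'1 by (auto simp: B'_def)
  moreover have "step t S h B N (S(i := F')) (h(i := Suc N')) B' N'"
    unfolding step_def i_def[symmetric] B'_def[symmetric] using F' N' N'1 CN by auto
  ultimately show ?thesis by blast
qed

lemma initial_exists: "\<exists>S h B. valid S h B 1"
proof -
  have "\<forall>i. \<exists>Q. Q \<ge> 1 \<and> emeasure lborel ({1/4..1/2} \<inter> near_rationals (\<psi> i) Q) \<le> ennreal ((1/2 - 1/4) / 8)"
    using approx_fun.initial_interval[OF approx, of "1/4" "1/2"] by auto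
  then obtain Q where Q: "\<And>i. Q i \<ge> 1" "\<And>i. emeasure lborel ({1/4..1/2} \<inter> near_rationals (\<psi> i) (Q i)) \<le> ennreal ((1/2 - 1/4) / 8)"
    by metis
  have "good_family i (Q i) {{1/4..1/2}}" for i
    unfolding approx_fun.good_family_def[OF approx]
  proof (intro conjI ballI)
    fix J :: "real set" assume "J \<in> {{1/4..1/2}}"
    then show "\<exists>a b. a < b \<and> J = {a..b} \<and> J \<subseteq> {0..<1} \<and> emeasure lborel (J \<inter> near_rationals (\<psi> i) (Q i)) \<le> ennreal ((b - a) / 8)"
      using Q(2)[of i] by (intro exI[of _ "1/4"] exI[of _ "1/2"]) auto
  qed auto
  \<comment> \<open>For one interval of length 1/4 the invariant requires 12288 = 4 * 3072.\<close>
  then have "valid (\<lambda>_. {{1/4..1/2}}) Q (\<lambda>_. 12288) 1"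
    using Q(1) by (auto simp: valid_def)
  then show ?thesis by blast
qed

lemma tower_exists:
  "\<exists>S h B N. \<forall>t. valid (S t) (h t) (B t) (N t) \<and>
     step t (S t) (h t) (B t) (N t) (S (Suc t)) (h (Suc t)) (B (Suc t)) (N (Suc t))"
proof -
  have "\<exists>f. \<forall>t. (case f t of (S, h, B, N) \<Rightarrow> valid S h B N) \<and>
     (case f t of (S, h, B, N) \<Rightarrow> case f (Suc t) of (S', h', B', N') \<Rightarrow> step t S h B N S' h' B' N')"
  proof (rule dependent_nat_choice)
    show "\<exists>x. case x of (S, h, B, N) \<Rightarrow> valid S h B N" using initial_exists by auto
    fix x :: "('m \<Rightarrow> real set set) \<times> ('m \<Rightarrow> nat) \<times> ('m \<Rightarrow> real) \<times> nat" and t :: nat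
    assume x: "case x of (S, h, B, N) \<Rightarrow> valid S h B N"
    obtain S h B N where xx: "x = (S, h, B, N)" by (cases x)
    then obtain S' h' B' N' where "valid S' h' B' N'" "step t S h B N S' h' B' N'" using step_exists x by blast
    then show "\<exists>y. (case y of (S, h, B, N) \<Rightarrow> valid S h B N) \<and>
       (case x of (S, h, B, N) \<Rightarrow> case y of (S', h', B', N') \<Rightarrow> step t S h B N S' h' B' N')"
      by (intro exI[of _ "(S', h', B', N')"]) (auto simp: xx)
  qed
  then obtain f where f: "\<And>t. (case f t of (S, h, B, N) \<Rightarrow> valid S h B N) \<and>
     (case f t of (S, h, B, N) \<Rightarrow> case f (Suc t) of (S', h', B', N') \<Rightarrow> step t S h B N S' h' B' N')" by blast
  show ?thesis
    by (rule exI[of _ "\<lambda>t. fst (f t)"], rule exI[of _ "\<lambda>t. fst (snd (f t))"],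
        rule exI[of _ "\<lambda>t. fst (snd (snd (f t)))"], rule exI[of _ "\<lambda>t. snd (snd (snd (f t)))"])
       (use f in \<open>simp add: case_prod_beta\<close>)
qed

end

locale approx_tower = approx_system \<psi> idx s \<eta>
  for \<psi> :: "'m::finite \<Rightarrow> nat \<Rightarrow> real" and idx s \<eta> +
  fixes S :: "nat \<Rightarrow> 'm \<Rightarrow> real set set" and h :: "nat \<Rightarrow> 'm \<Rightarrow> nat" and B :: "nat \<Rightarrow> 'm \<Rightarrow> real" and N :: "nat \<Rightarrow> nat"
  assumes valid: "valid (S t) (h t) (B t) (N t)"
    and step: "step t (S t) (h t) (B t) (N t) (S (Suc t)) (h (Suc t)) (B (Suc t)) (N (Suc t))"
begin

lemma stepD:
  "N t < N (Suc t)" "h t (idx t) \<le> N (Suc t)" "1024 / eps t * B t j \<le> real (N (Suc t)) powr (2 * \<eta>)"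
  "1 \<le> \<psi> (idx t) (N (Suc t)) powr s * real (N (Suc t)) ^ 2"
  "\<exists>n. refines n (S t (idx t)) (S (Suc t) (idx t))" "j \<noteq> idx t \<Longrightarrow> S (Suc t) j = S t j"
  "h (Suc t) = (h t)(idx t := Suc (N (Suc t)))"
  "B (Suc t) = (B t)(idx t := 1024 * B t (idx t) / (eps t * \<psi> (idx t) (N (Suc t)) * real (N (Suc t)) ^ 2))"
  "J \<in> S (Suc t) (idx t) \<Longrightarrow> diameter J \<le> 1 / real (N (Suc t)) ^ 2"
  "0 \<le> r \<Longrightarrow> real (card (meeting (S (Suc t) (idx t)) c r)) \<le> B t (idx t) * max r (1 / real (N (Suc t)) ^ 2) * real (card (S (Suc t) (idx t)))"
  "J \<in> S (Suc t) (idx t) \<Longrightarrow> x \<in> J \<Longrightarrow> approximates (idx t) (eps t) (h t (idx t)) (N (Suc t)) x"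
  using step[of t] unfolding step_def by blast+

lemma validD:
  "N t \<ge> 1" "good_family i (h t i) (S t i)" "h t i \<ge> 1" "B t i > 0"
  using valid[of t] unfolding valid_def by blast+

sublocale cantor_tower S
proof
  fix t i
  show fam: "cantor_family (S t i)" using approx_fun.good_family_cantor[OF approx validD(2)] .
  show "\<exists>n. refines n (S t i) (S (Suc t) i)"
    using stepD(5,6) refines_refl[OF fam] by (cases "i = idx t") auto
qed

lemma N_ge: "t \<le> N t"
proof (induction t)
  case (Suc t)
  then show ?case using stepD(1)[of t] by simp
qed simp

lemma N_mono: "t \<le> u \<Longrightarrow> N t \<le> N u"
  by (rule lift_Suc_mono_le[of N, OF less_imp_le[OF stepD(1)]])

text \<open>The minimal spacing guaranteed for the fractions selected at stage t; scales between
  \<open>R (Suc t)\<close> and \<open>R t\<close> belong to that stage.\<close>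

definition R :: "nat \<Rightarrow> real" where "R t = 1 / real (N (Suc t)) ^ 2"

lemma N_pos: "real (N t) > 0" using validD(1)[of t] by simp

lemma R_pos: "R t > 0" using N_pos by (simp add: R_def)

lemma R_le_1: "R t \<le> 1"
proof -
  have "1 \<le> real (N (Suc t))" using validD(1)[of "Suc t"] by simp
  then show ?thesis by (simp add: R_def)
qed

lemma R_antimono: "t \<le> u \<Longrightarrow> R u \<le> R t"
  unfolding R_def using N_pos[of "Suc t"] N_pos[of "Suc u"] N_mono[of "Suc t" "Suc u"]
  by (intro divide_left_mono power_mono mult_pos_pos) auto

lemma R_small:
  assumes "e > 0" shows "\<exists>t. \<forall>u\<ge>t. R u < e"
proof -
  obtain t :: nat where t: "1 / e < real t" using reals_Archimedean2 by blast
  have "R u < e" if "u \<ge> t" for u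
  proof -
    have "real t \<le> real (N (Suc u))" using N_ge[of "Suc u"] that by simp
    also have "\<dots> \<le> real (N (Suc u)) ^ 2" using validD(1)[of "Suc u"] by (simp add: power2_eq_square)
    finally have "1 / e < real (N (Suc u)) ^ 2" using t by linarith
    then show ?thesis using assms N_pos[of "Suc u"] by (simp add: R_def field_simps)
  qed
  then show ?thesis by blast
qed

lemma R_powr: "R t powr (- \<eta>) = real (N (Suc t)) powr (2 * \<eta>)"
proof -
  have "R t = real (N (Suc t)) powr (-2)"
    using N_pos[of "Suc t"] by (simp add: R_def powr_minus powr_numeral divide_inverse)
  then show ?thesis by (simp add: powr_powr)
qed

lemma next_update:
  "\<exists>u\<ge>t. idx u = i \<and> B u i = B t i \<and> h u i = h t i"
proof -
  define u where "u = (LEAST u. t \<le> u \<and> idx u = i)"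
  have u: "t \<le> u \<and> idx u = i" unfolding u_def by (rule LeastI_ex) (use idx_recurrent in blast)
  have notyet: "idx v \<noteq> i" if "t \<le> v" "v < u" for v
    using not_less_Least[of v "\<lambda>u. t \<le> u \<and> idx u = i"] that unfolding u_def by blast
  have "v \<le> u \<longrightarrow> B v i = B t i \<and> h v i = h t i" if "t \<le> v" for v
    using that
  proof (induction rule: dec_induct)
    case (step v)
    then show ?case using notyet[of v] by (auto simp: stepD(7,8))
  qed simp
  then show ?thesis using u by blast
qed

text \<open>The family that decides the count is the one at the next refinement of coordinate i.
  Until then \<open>B\<close> is unchanged, and the spacing there is at most \<open>R t\<close>, so
  the maximum in the window bound is r.\<close>

lemma count_next:
  "\<exists>T. \<forall>r\<ge>R t. \<forall>c. real (card (meeting (S T i) c r)) \<le> B t i * r * real (card (S T i))"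
proof -
  obtain u where u: "t \<le> u" "idx u = i" "B u i = B t i" using next_update by blast
  have "real (card (meeting (S (Suc u) i) c r)) \<le> B t i * r * real (card (S (Suc u) i))" if r: "R t \<le> r" for r c
  proof -
    have "R u \<le> r" using R_antimono[OF u(1)] r by simp
    moreover have "0 \<le> r" using r R_pos[of t] by simp
    ultimately show ?thesis using stepD(10)[of r u c] u by (simp add: R_def max_def split: if_splits)
  qed
  then show ?thesis by blast
qed

lemma B_le: "1024 / eps t * B t j \<le> R t powr (- \<eta>)"
  using stepD(3) by (simp add: R_powr)

lemma B_le': "B t j \<le> R t powr (- \<eta>)"
proof -
  have "1 * B t j \<le> 1024 / eps t * B t j"
    using eps[of t] validD(4)[of t j] by (intro mult_right_mono) (auto simp: field_simps)
  then show ?thesis using B_le[of t j] by simp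
qed

lemma R_powr_le:
  assumes "0 < r" "r \<le> R t" shows "R t powr (- \<eta>) \<le> r powr (- \<eta>)"
  using assms \<eta> by (intro powr_mono2') auto

text \<open>A coordinate not refined at stage t carries its constant over, and that constant was
  already bounded by \<open>R t powr (- \<eta>)\<close> when the new N was chosen.\<close>

lemma count_other:
  assumes r: "R (Suc t) \<le> r" "r \<le> R t" and i: "i \<noteq> idx t"
  shows "\<exists>T. \<forall>c. real (card (meeting (S T i) c r)) \<le> r powr (1 - \<eta>) * real (card (S T i))"
proof -
  have r0: "r > 0" using r R_pos[of "Suc t"] by simp
  obtain T where T: "\<And>c. real (card (meeting (S T i) c r)) \<le> B (Suc t) i * r * real (card (S T i))"
    using count_next[of "Suc t" i] r by blast
  have "B (Suc t) i * r = B t i * r" using i by (simp add: stepD(8))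
  also have "\<dots> \<le> R t powr (- \<eta>) * r" using B_le' r0 by (intro mult_right_mono) auto
  also have "\<dots> \<le> r powr (- \<eta>) * r" using R_powr_le r r0 by (intro mult_right_mono) auto
  also have "\<dots> = r powr (1 - \<eta>)" using r0 by (simp add: powr_diff powr_minus field_simps)
  finally have "B (Suc t) i * r * real (card (S T i)) \<le> r powr (1 - \<eta>) * real (card (S T i))" for T
    by (intro mult_right_mono) auto
  then show ?thesis using T order_trans by blast
qed

text \<open>Two bounds compete. Just after the refinement a window meets at most the proportion B R;
  the next refinement of the coordinate gives B R y with y = 1024 r/(\<epsilon>\<psi>(N)). Since
  min(1,y) \<le> y^s for 0 \<le> s \<le> 1, both are below B R y^s. The largeness condition
  \<psi>(N)^-s \<le> N^2 = 1/R then cancels R and leaves r^s up to constants.\<close>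

lemma count_current:
  assumes r: "R (Suc t) \<le> r" "r \<le> R t"
  shows "\<exists>T. \<forall>c. real (card (meeting (S T (idx t)) c r)) \<le> r powr (s - \<eta>) * real (card (S T (idx t)))"
proof -
  define i where "i = idx t"
  define M where "M = real (N (Suc t))"
  have M: "M \<ge> 1" using validD(1)[of "Suc t"] by (simp add: M_def)
  define a where "a = \<psi> i (N (Suc t))"
  have a: "a > 0" unfolding a_def by (rule approx_fun.pos[OF approx]) (rule validD(1))
  have RM: "R t = 1 / M ^ 2" by (simp add: R_def M_def)
  have r0: "r > 0" using r R_pos[of "Suc t"] by simp
  have Bt: "B t i > 0" by (rule validD(4))
  define y where "y = 1024 * r / (eps t * a)"
  have y: "y > 0" using r0 a eps[of t] by (simp add: y_def)
  have bound: "B t i * R t * y powr s \<le> r powr (s - \<eta>)"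
  proof -
    have "y powr s = (1024 / eps t) powr s * r powr s * a powr (- s)"
      using r0 a eps[of t] by (simp add: y_def powr_mult powr_divide powr_minus field_simps)
    also have "\<dots> \<le> (1024 / eps t) * r powr s * M ^ 2"
    proof (intro mult_mono)
      have "1024 / eps t \<ge> 1" using eps[of t] by (simp add: field_simps)
      then have "(1024 / eps t) powr s \<le> (1024 / eps t) powr 1" using s by (intro powr_mono) auto
      then show "(1024 / eps t) powr s \<le> 1024 / eps t" using eps[of t] by simp
      have "1 \<le> a powr s * M ^ 2" using stepD(4)[of t] by (simp add: a_def M_def i_def)
      then show "a powr (- s) \<le> M ^ 2" using a by (simp add: powr_minus field_simps)
    qed (use eps[of t] in auto)
    finally have "B t i * R t * y powr s \<le> B t i * R t * ((1024 / eps t) * r powr s * M ^ 2)"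
      using Bt R_pos[of t] by (intro mult_left_mono) auto
    also have "\<dots> = (1024 / eps t * B t i) * r powr s" using M by (simp add: RM)
    also have "\<dots> \<le> R t powr (- \<eta>) * r powr s" by (intro mult_right_mono B_le) auto
    also have "\<dots> \<le> r powr (- \<eta>) * r powr s" using R_powr_le r r0 by (intro mult_right_mono) auto
    also have "\<dots> = r powr (s - \<eta>)" by (simp add: powr_add[symmetric])
    finally show ?thesis .
  qed
  \<comment> \<open>The level depends on the bound used: \<open>Suc t\<close> when y \<ge> 1, the
    later level from \<open>count_next\<close> otherwise.\<close>
  have "\<exists>T. \<forall>c. real (card (meeting (S T i) c r)) \<le> B t i * R t * y powr s * real (card (S T i))"
  proof (cases "y \<ge> 1")
    case True
    have "real (card (meeting (S (Suc t) i) c r)) \<le> B t i * R t * y powr s * real (card (S (Suc t) i))" for c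
    proof -
      have "real (card (meeting (S (Suc t) i) c r)) \<le> B t i * R t * real (card (S (Suc t) i))"
        using stepD(10)[of r t c] r r0 by (simp add: R_def max_def i_def split: if_splits)
      also have "\<dots> \<le> B t i * R t * y powr s * real (card (S (Suc t) i))"
      proof -
        have "1 \<le> y powr s" using True s by (simp add: ge_one_powr_ge_zero)
        then have "B t i * R t * 1 \<le> B t i * R t * y powr s" using Bt R_pos[of t] by (intro mult_left_mono) auto
        then show ?thesis by (intro mult_right_mono) auto
      qed
      finally show ?thesis .
    qed
    then show ?thesis by blast
  next
    case False
    obtain T where T: "\<And>c. real (card (meeting (S T i) c r)) \<le> B (Suc t) i * r * real (card (S T i))"
      using count_next[of "Suc t" i] r by blast
    have "B (Suc t) i * r = B t i * R t * y"
      by (simp add: stepD(8) i_def y_def RM a_def M_def mult_ac)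
    also have "\<dots> \<le> B t i * R t * y powr s"
    proof -
      have "y powr 1 \<le> y powr s" using False y s by (intro powr_mono') auto
      then show ?thesis using Bt R_pos[of t] y by (intro mult_left_mono) auto
    qed
    finally have "B (Suc t) i * r * real (card (S T i)) \<le> B t i * R t * y powr s * real (card (S T i))"
      by (intro mult_right_mono) auto
    then show ?thesis using T order_trans by blast
  qed
  then obtain T where T: "\<And>c. real (card (meeting (S T i) c r)) \<le> B t i * R t * y powr s * real (card (S T i))" by blast
  have "B t i * R t * y powr s * real (card (S T i)) \<le> r powr (s - \<eta>) * real (card (S T i))"
    using bound by (intro mult_right_mono) auto
  then show ?thesis using T order_trans unfolding i_def by blast
qed

lemma thin_all_scales:
  assumes r: "0 < r" "r \<le> R 0" and \<sigma>: "\<sigma> \<le> real CARD('m) - 1 + s - real CARD('m) * \<eta>"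
  shows "\<exists>T. thin T r (r powr \<sigma>)"
proof -
  obtain t where t: "R (Suc t) \<le> r" "r \<le> R t"
  proof -
    obtain t1 where "\<forall>u\<ge>t1. R u < r" using R_small[OF r(1)] by blast
    then have "R t1 \<le> r" by (simp add: less_imp_le)
    then have ex: "\<exists>t. R t \<le> r" by blast
    \<comment> \<open>If the least index is 0 then r = R 0, and stage 0 still brackets r.\<close>
    define t0 where "t0 = (LEAST t. R t \<le> r)"
    have t0: "R t0 \<le> r" unfolding t0_def by (rule LeastI_ex[OF ex])
    show ?thesis
    proof (cases t0)
      case 0
      have "R (Suc 0) \<le> R 0" by (rule R_antimono) simp
      then show ?thesis using that[of 0] t0 0 r by simp
    next
      case (Suc t')
      have "\<not> R t' \<le> r" using not_less_Least[of t' "\<lambda>t. R t \<le> r"] Suc unfolding t0_def by simp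
      then show ?thesis using that[of t'] t0 Suc by simp
    qed
  qed
  define \<beta> where "\<beta> i = r powr (if i = idx t then s - \<eta> else 1 - \<eta>)" for i
  have "\<forall>i. \<exists>T. \<forall>c. real (card (meeting (S T i) c r)) \<le> \<beta> i * real (card (S T i))"
    using count_current[OF t] count_other[OF t] by (auto simp: \<beta>_def)
  then obtain T where T: "\<And>i c. real (card (meeting (S (T i) i) c r)) \<le> \<beta> i * real (card (S (T i) i))" by metis
  define T' where "T' = Max (range T)"
  have "thin T' r (\<Prod>i\<in>UNIV. \<beta> i)" by (rule thinI[OF T]) (simp add: T'_def)
  moreover have "(\<Prod>i\<in>UNIV. \<beta> i) \<le> r powr \<sigma>"
  proof -
    have "(\<Prod>i\<in>UNIV. \<beta> i) = r powr (\<Sum>i\<in>UNIV. if i = idx t then s - \<eta> else 1 - \<eta>)"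
      unfolding \<beta>_def using r by (subst powr_sum) auto
    also have "(\<Sum>i\<in>UNIV. if i = idx t then s - \<eta> else 1 - \<eta>) = (\<Sum>i\<in>(UNIV::'m set). (1 - \<eta>) + (if i = idx t then s - 1 else 0))"
      by (intro sum.cong) auto
    also have "\<dots> = (\<Sum>i\<in>(UNIV::'m set). 1 - \<eta>) + (\<Sum>i\<in>UNIV. if i = idx t then s - 1 else 0)"
      by (rule sum.distrib)
    also have "\<dots> = real CARD('m) - 1 + s - real CARD('m) * \<eta>"
      by (simp add: algebra_simps)
    also have "r powr \<dots> \<le> r powr \<sigma>" using r R_le_1[of 0] \<sigma> by (intro powr_mono') auto
    finally show ?thesis .
  qed
  ultimately have "thin T' r (r powr \<sigma>)"
    using card_boxes_pos[of T'] unfolding thin_def by (meson less_imp_le mult_right_mono order_trans)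
  then show ?thesis by blast
qed

text \<open>At r = R t the coordinate just refined is still evenly spread, so its proportion is at
  most B r and no factor r^s appears; the other coordinates are covered by
  \<open>count_other\<close> at the upper end of its range.\<close>

lemma thin_good_scales:
  assumes "e > 0"
  shows "\<exists>r T. 0 < r \<and> r < e \<and> thin T r (r powr (real CARD('m) * (1 - \<eta>)))"
proof -
  obtain t where t: "R t < e" using R_small[OF assms] by blast
  define r where "r = R t"
  have r: "0 < r" "r < e" using t R_pos by (auto simp: r_def)
  have "\<exists>T. \<forall>c. real (card (meeting (S T i) c r)) \<le> r powr (1 - \<eta>) * real (card (S T i))" for i
  proof (cases "i = idx t")
    case True
    have "B t i * r \<le> R t powr (- \<eta>) * r" using B_le' r by (intro mult_right_mono) auto
    also have "\<dots> = r powr (1 - \<eta>)" using r by (simp add: r_def powr_diff powr_minus field_simps)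
    finally have *: "B t i * r * real (card (S T i)) \<le> r powr (1 - \<eta>) * real (card (S T i))" for T
      by (intro mult_right_mono) auto
    have "real (card (meeting (S (Suc t) i) c r)) \<le> r powr (1 - \<eta>) * real (card (S (Suc t) i))" for c
      using stepD(10)[of r t c] r True *[of "Suc t"] by (auto simp: r_def R_def intro: order_trans)
    then show ?thesis by blast
  next
    case False
    then show ?thesis using R_antimono[of t "Suc t"] by (intro count_other) (auto simp: r_def)
  qed
  then obtain T where T: "\<And>i c. real (card (meeting (S (T i) i) c r)) \<le> r powr (1 - \<eta>) * real (card (S (T i) i))" by metis
  have "thin (Max (range T)) r (\<Prod>i\<in>(UNIV::'m set). r powr (1 - \<eta>))" by (rule thinI[OF T]) simp
  moreover have "(\<Prod>i\<in>(UNIV::'m set). r powr (1 - \<eta>)) = r powr (real CARD('m) * (1 - \<eta>))"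
    using r by (simp add: powr_powr[symmetric] powr_realpow[symmetric] mult.commute powr_gt_zero del: powr_realpow)
  ultimately show ?thesis using r by auto
qed

lemma level_diameter:
  assumes "u < t" "idx u = i" "J \<in> S t i"
  shows "diameter J \<le> R u"
proof -
  have "Suc u \<le> t" using assms by simp
  then obtain n where "refines n (S (Suc u) i) (S t i)" using ref by blast
  then obtain J' where J': "J' \<in> S (Suc u) i" "J \<subseteq> J'" using assms by (auto simp: refines_def)
  have "bounded J'" using cantor_familyD(4)[OF family J'(1)] compact_imp_bounded by blast
  then have "diameter J \<le> diameter J'" using J' by (intro diameter_subset)
  also have "\<dots> \<le> R u" using stepD(9)[of J' u] J' assms by (simp add: R_def)
  finally show ?thesis .
qed

lemma small_diameters:
  assumes "e > 0"
  shows "\<exists>t. \<forall>i. \<forall>J\<in>S t i. diameter J < e"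
proof -
  obtain t0 where t0: "\<And>u. u \<ge> t0 \<Longrightarrow> R u < e" using R_small[OF assms] by blast
  have "\<forall>i. \<exists>u\<ge>t0. idx u = i" using idx_recurrent by blast
  then obtain u where u: "\<And>i. u i \<ge> t0" "\<And>i. idx (u i) = i" by metis
  define t where "t = Suc (Max (range u))"
  have "diameter J < e" if "J \<in> S t i" for i J
  proof -
    have "u i < t" unfolding t_def by (simp add: less_Suc_eq_le)
    then have "diameter J \<le> R (u i)" using level_diameter u that by blast
    then show ?thesis using t0[OF u(1)] by (rule le_less_trans)
  qed
  then show ?thesis by blast
qed

section \<open>Exact approximability of the limit points\<close>

lemma h_mono: "t \<le> u \<Longrightarrow> h t i \<le> h u i"
proof (rule lift_Suc_mono_le[of "\<lambda>t. h t i"])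
  show "h n i \<le> h (Suc n) i" for n using stepD(2)[of n] by (auto simp: stepD(7))
qed

lemma h_large: "\<exists>u. M \<le> h u i"
proof -
  obtain u where u: "u \<ge> M" "idx u = i" using idx_recurrent by blast
  then have "h (Suc u) i = Suc (N (Suc u))" by (simp add: stepD(7))
  moreover have "Suc u \<le> N (Suc u)" by (rule N_ge)
  ultimately show ?thesis using u by (intro exI[of _ "Suc u"]) simp
qed

lemma limit_approximates:
  assumes "x \<in> limit (idx t)"
  shows "approximates (idx t) (eps t) (h t (idx t)) (N (Suc t)) x"
proof -
  obtain J where "J \<in> S (Suc t) (idx t)" "x \<in> J" using assms by (auto simp: limit_def)
  then show ?thesis by (rule stepD(11))
qed

text \<open>Each time coordinate i is refined, \<open>h\<close> moves to one past the new N, so its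
  blocks of denominators follow each other without gaps. Every large q lies in one block, and late
  blocks have 1 - eps t \<ge> c.\<close>

lemma limit_subset_E_set: "limit i \<subseteq> E_set (\<psi> i)"
proof
  fix x assume x: "x \<in> limit i"
  interpret A: approx_fun "\<psi> i" by (rule approx)
  show "x \<in> E_set (\<psi> i)"
  proof (rule A.E_setI)
    obtain J where J: "J \<in> S 0 i" "x \<in> J" using x by (auto simp: limit_def)
    then have "J \<subseteq> {0..<1}" using validD(2)[of i 0] by (auto simp: A.good_family_def)
    then show "x \<in> {0..<1}" using J by blast
  next
    fix M
    obtain u where u: "M \<le> h u i" using h_large by blast
    obtain t where t: "t \<ge> u" "idx t = i" using idx_recurrent by blast
    have "M \<le> h t i" using u h_mono[OF t(1)] order_trans by blast
    moreover have "approximates i (eps t) (h t i) (N (Suc t)) x" using limit_approximates[of x t] x t by simp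
    then obtain p q where "coprime p (int q)" "h t i \<le> q" "\<bar>x - of_int p / real q\<bar> < \<psi> i q"
      unfolding A.approximates_def by blast
    ultimately show "\<exists>p q. q \<ge> M \<and> coprime p (int q) \<and> \<bar>x - of_int p / real q\<bar> < \<psi> i q"
      using order_trans by blast
  next
    fix c :: real assume c: "0 < c" "c < 1"
    obtain u :: nat where u: "1 / (1 - c) < real u" using reals_Archimedean2 by blast
    have eps_c: "c \<le> 1 - eps t" if "t \<ge> u" for t
    proof -
      have "1 / (1 - c) < real t + 2" using u that by linarith
      then have "1 < (real t + 2) * (1 - c)" using c by (simp add: pos_divide_less_eq)
      then have "1 / (real t + 2) < 1 - c" by (simp add: pos_divide_less_eq mult.commute)
      then show ?thesis by (simp add: eps_def)
    qed
    show "\<exists>M. \<forall>p q. q \<ge> M \<longrightarrow> coprime p (int q) \<longrightarrow> c * \<psi> i q \<le> \<bar>x - of_int p / real q\<bar>"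
    proof (intro exI[of _ "h u i"] allI impI)
      fix p :: int and q assume q: "h u i \<le> q" and cop: "coprime p (int q)"
      \<comment> \<open>The value \<open>h v i\<close> jumps past q exactly at stage v - 1, hence
        coordinate i was refined there and q lies in that block.\<close>
      define v where "v = (LEAST v. q < h v i)"
      have "\<exists>v. q < h v i" using h_large[of "Suc q" i] by (auto simp: Suc_le_eq)
      then have v: "q < h v i" unfolding v_def by (rule LeastI_ex)
      have "u < v"
      proof (rule ccontr)
        assume "\<not> u < v"
        then have "h v i \<le> h u i" by (intro h_mono) simp
        then show False using q v by simp
      qed
      then obtain t where t: "v = Suc t" "u \<le> t" by (cases v) auto
      have "\<not> q < h t i" using not_less_Least[of t "\<lambda>v. q < h v i"] t unfolding v_def by simp
      then have qt: "h t i \<le> q" "q < h (Suc t) i" using v t by auto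
      then have idx: "idx t = i" by (auto simp: stepD(7) split: if_splits)
      then have "q \<le> N (Suc t)" using qt by (simp add: stepD(7))
      then have "(1 - eps t) * \<psi> i q \<le> \<bar>x - of_int p / real q\<bar>"
        using limit_approximates[of x t] x qt cop unfolding idx A.approximates_def by blast
      moreover have "q \<ge> 1" using qt validD(3)[of t i] by simp
      then have "c * \<psi> i q \<le> (1 - eps t) * \<psi> i q"
        using eps_c[OF t(2)] A.pos by (intro mult_right_mono) (auto intro: less_imp_le)
      ultimately show "c * \<psi> i q \<le> \<bar>x - of_int p / real q\<bar>" by linarith
    qed
  qed
qed

end

section \<open>The dimensions of the product\<close>

lemma packing_measure_mono:
  "A \<subseteq> C \<Longrightarrow> packing_measure s A \<le> packing_measure s C"
  unfolding packing_measure_def by (intro INF_superset_mono) auto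

lemma recurrent_enumeration: "\<exists>idx :: nat \<Rightarrow> 'm::finite. \<forall>i t. \<exists>u\<ge>t. idx u = i"
proof -
  obtain f :: "'m \<Rightarrow> nat" where f: "bij_betw f UNIV {0..<CARD('m)}"
    using ex_bij_betw_finite_nat[of "UNIV :: 'm set"] by auto
  define idx where "idx n = inv f (n mod CARD('m))" for n
  have "\<exists>u\<ge>t. idx u = i" for i t
  proof (intro exI[of _ "t * CARD('m) + f i"] conjI)
    have "t * 1 \<le> t * CARD('m)" by (intro mult_left_mono) (auto simp: Suc_le_eq)
    then show "t \<le> t * CARD('m) + f i" by linarith
    have "f i < CARD('m)" using bij_betwE[OF f] by auto
    moreover have "inj f" using f by (simp add: bij_betw_def)
    ultimately show "idx (t * CARD('m) + f i) = i" by (simp add: idx_def)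
  qed
  then show ?thesis by blast
qed

abbreviation E_product :: "('m::finite \<Rightarrow> nat \<Rightarrow> real) \<Rightarrow> (real^'m) set" where
  "E_product \<psi> \<equiv> {x. \<forall>i. x $ i \<in> E_set (\<psi> i)}"

lemma E_product_lower:
  fixes \<psi> :: "'m::finite \<Rightarrow> nat \<Rightarrow> real"
  assumes af: "\<And>i. approx_fun (\<psi> i)" and s: "0 \<le> s" "s \<le> 1" and \<eta>: "\<eta> > 0"
    and io: "\<And>i M. \<exists>N\<ge>M. 1 \<le> \<psi> i N powr s * real N ^ 2"
  shows "0 \<le> \<sigma> \<Longrightarrow> \<sigma> \<le> real CARD('m) - 1 + s - real CARD('m) * \<eta> \<Longrightarrow> hausdorff_measure \<sigma> (E_product \<psi>) \<noteq> 0"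
    and "0 \<le> \<sigma> \<Longrightarrow> \<sigma> < real CARD('m) * (1 - \<eta>) \<Longrightarrow> packing_measure \<sigma> (E_product \<psi>) \<noteq> 0"
proof -
  obtain idx :: "nat \<Rightarrow> 'm" where idx: "\<And>i t. \<exists>u\<ge>t. idx u = i" using recurrent_enumeration by blast
  have "approx_system \<psi> idx s \<eta>"
    unfolding approx_system_def using af idx s \<eta> io by blast
  then interpret approx_system \<psi> idx s \<eta> .
  obtain S h B N where tower: "\<And>t. valid (S t) (h t) (B t) (N t) \<and>
     step t (S t) (h t) (B t) (N t) (S (Suc t)) (h (Suc t)) (B (Suc t)) (N (Suc t))"
    using tower_exists by blast
  interpret approx_tower \<psi> idx s \<eta> S h B N
    by (intro approx_tower.intro approx_system_axioms approx_tower_axioms.intro) (use tower in blast)+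
  have sub: "limit_set \<subseteq> E_product \<psi>"
    using limit_subset_E_set by (auto simp: limit_set_def)
  show "hausdorff_measure \<sigma> (E_product \<psi>) \<noteq> 0" if "0 \<le> \<sigma>" "\<sigma> \<le> real CARD('m) - 1 + s - real CARD('m) * \<eta>"
    using hausdorff_measure_limit_set[OF that(1) R_pos thin_all_scales[OF _ _ that(2)]] hausdorff_measure_mono[OF sub, of \<sigma>]
    by auto
  show "packing_measure \<sigma> (E_product \<psi>) \<noteq> 0" if "0 \<le> \<sigma>" "\<sigma> < real CARD('m) * (1 - \<eta>)"
    using packing_measure_limit_set[OF that small_diameters thin_good_scales] packing_measure_mono[OF sub, of \<sigma>]
    by auto
qed

lemma hausdorff_dim_le:
  "0 \<le> s \<Longrightarrow> hausdorff_measure s A = 0 \<Longrightarrow> hausdorff_dim A \<le> ennreal s"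
  unfolding hausdorff_dim_def by (intro Inf_lower) auto

context approx_fun
begin

text \<open>The condition \<open>\<psi>(N)\<^sup>s N\<^sup>2 \<ge> 1\<close> infinitely often replaces the usual lower order of \<open>1/\<psi>\<close> at infinity.\<close>

lemma large_often:
  assumes s: "s = 0 \<or> 0 < s \<and> ennreal s < hausdorff_dim (E_set \<psi>)"
  shows "\<exists>N\<ge>M. 1 \<le> \<psi> N powr s * real N ^ 2"
proof (cases "s = 0")
  case True
  moreover have "1 \<le> real (max M 1) ^ 2" by (rule one_le_power) simp
  ultimately show ?thesis using pos[of "max M 1"] by (intro exI[of _ "max M 1"]) simp
next
  case False
  show ?thesis
  proof (rule ccontr)
    assume *: "\<not> ?thesis"
    \<comment> \<open>The surplus exponent u - s, together with \<psi>(q) \<le> q^-2, supplies the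
      extra decay q^(-2(u-s)) that makes the covering series converge.\<close>
    obtain s' where s': "ennreal s < s'" "s' < hausdorff_dim (E_set \<psi>)" using s False dense by blast
    then obtain u where u: "s' = ennreal u" "0 \<le> u" by (cases s') auto
    have su: "0 < s" "s < u" using s s' u False by (auto simp: ennreal_less_iff)
    have "eventually (\<lambda>q. real q ^ 2 * \<psi> q \<le> 1) sequentially" by (rule eventually_square_le) simp
    then have ev: "eventually (\<lambda>q. real q * \<psi> q powr u \<le> real q powr (- 1 - 2 * (u - s))) sequentially"
      using eventually_ge_at_top[of "max M 1"]
    proof eventually_elim
      case (elim q)
      have q: "real q > 0" "\<psi> q > 0" using elim pos by auto
      have "\<psi> q powr s * real q ^ 2 \<le> 1" using * elim(2) by (meson max.boundedE not_le less_imp_le)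
      then have 1: "\<psi> q powr s \<le> real q powr (-2)" using q by (simp add: powr_minus powr_numeral field_simps)
      have "\<psi> q \<le> real q powr (-2)" using elim(1) q by (simp add: powr_minus powr_numeral field_simps)
      then have "\<psi> q powr (u - s) \<le> (real q powr (-2)) powr (u - s)" using q su by (intro powr_mono2) auto
      then have 2: "\<psi> q powr (u - s) \<le> real q powr (- 2 * (u - s))" by (simp add: powr_powr)
      have "real q * \<psi> q powr u = real q powr 1 * (\<psi> q powr s * \<psi> q powr (u - s))"
        using q by (simp add: powr_add[symmetric])
      also have "\<dots> \<le> real q powr 1 * (real q powr (-2) * real q powr (- 2 * (u - s)))"
        using 1 2 by (intro mult_left_mono mult_mono) auto
      also have "\<dots> = real q powr (- 1 - 2 * (u - s))"
        unfolding powr_add[symmetric] by (rule arg_cong[where f = "\<lambda>z. real q powr z"]) simp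
      finally show ?case .
    qed
    have "summable (\<lambda>q. real q powr (- 1 - 2 * (u - s)))"
      using su by (simp add: summable_real_powr_iff)
    then have sm: "summable (\<lambda>q. real q * \<psi> q powr u)"
      by (rule summable_comparison_test_ev[rotated]) (rule eventually_mono[OF ev], simp add: abs_mult)
    have lim': "(\<lambda>q. real q * \<psi> q) \<longlonglongrightarrow> 0" by (rule summable_LIMSEQ_zero[OF summ])
    have "hausdorff_measure u (W_set \<psi>) = 0"
      using pos lim' u(2) sm by (rule hausdorff_measure_W_set)
    then have "hausdorff_measure u (E_set \<psi>) = 0"
      using hausdorff_measure_mono[of "E_set \<psi>" "W_set \<psi>" u] by (auto simp: E_set_def)
    then have "hausdorff_dim (E_set \<psi>) \<le> s'" using u by (simp add: hausdorff_dim_le)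
    then show False using s' by simp
  qed
qed

text \<open>For s > 1 and \<psi> \<le> 1, \<psi>^s is at most \<psi> = o(N^-2), against the
  largeness. It supplies the bound s \<le> 1 on which \<open>count_current\<close> relies.\<close>

lemma large_often_le_1:
  assumes "s \<ge> 0" "\<And>M. \<exists>N\<ge>M. 1 \<le> \<psi> N powr s * real N ^ 2"
  shows "s \<le> 1"
proof (rule ccontr)
  assume s: "\<not> s \<le> 1"
  have "eventually (\<lambda>q. real q ^ 2 * \<psi> q \<le> 1 / 2) sequentially" by (rule eventually_square_le) simp
  then obtain M where M: "\<And>q. q \<ge> M \<Longrightarrow> real q ^ 2 * \<psi> q \<le> 1 / 2" by (auto simp: eventually_sequentially)
  obtain N where N: "N \<ge> max M 1" "1 \<le> \<psi> N powr s * real N ^ 2" using assms(2) by blast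
  have \<psi>: "\<psi> N > 0" using pos N by auto
  have "1 * \<psi> N \<le> real N ^ 2 * \<psi> N" using N \<psi> by (intro mult_right_mono) auto
  then have "\<psi> N \<le> 1" using M[of N] N by simp
  then have "\<psi> N powr s \<le> \<psi> N powr 1" using s \<psi> by (intro powr_mono') auto
  then have "\<psi> N powr s \<le> \<psi> N" using \<psi> by simp
  then have "\<psi> N powr s * real N ^ 2 \<le> \<psi> N * real N ^ 2" by (rule mult_right_mono) simp
  moreover have "\<psi> N * real N ^ 2 \<le> 1 / 2" using M[of N] N(1) by (simp add: mult.commute)
  ultimately show False using N(2) by linarith
qed

end

lemma E_product_hausdorff_dim_le:
  fixes \<psi> :: "'m::finite \<Rightarrow> nat \<Rightarrow> real"
  shows "hausdorff_dim (E_product \<psi>) \<le> of_nat (CARD('m) - 1) + hausdorff_dim (E_set (\<psi> i))"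
proof (rule ennreal_le_epsilon)
  fix e :: real assume fin: "of_nat (CARD('m) - 1) + hausdorff_dim (E_set (\<psi> i)) < top" and e: "e > 0"
  have "hausdorff_dim (E_set (\<psi> i)) < hausdorff_dim (E_set (\<psi> i)) + ennreal e"
    using fin e by (simp add: ennreal_add_left_cancel_less[of _ 0, simplified] less_top)
  then obtain s where s: "0 \<le> s" "hausdorff_measure s (E_set (\<psi> i)) = 0" "ennreal s < hausdorff_dim (E_set (\<psi> i)) + ennreal e"
    unfolding hausdorff_dim_def by (subst (asm) Inf_less_iff) auto
  have "E_product \<psi> \<subseteq> {x. x $ i \<in> E_set (\<psi> i) \<and> (\<forall>j. x $ j \<in> {0..1})}"
    by (auto simp: E_set_def W_set_def less_imp_le)
  then have "hausdorff_measure (s + real (CARD('m) - 1)) (E_product \<psi>) = 0"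
    using hausdorff_measure_mono[of "E_product \<psi>" _ "s + real (CARD('m) - 1)"] hausdorff_measure_slab[OF s(2,1), of i]
    by (metis (no_types, lifting) le_zero_eq)
  then have "hausdorff_dim (E_product \<psi>) \<le> ennreal (s + real (CARD('m) - 1))"
    using s by (intro hausdorff_dim_le) auto
  also have "\<dots> = of_nat (CARD('m) - 1) + ennreal s"
    using s by (simp add: ennreal_of_nat_eq_real_of_nat add.commute del: of_nat_diff)
  also have "\<dots> \<le> of_nat (CARD('m) - 1) + (hausdorff_dim (E_set (\<psi> i)) + ennreal e)"
    using s by (intro add_left_mono) simp
  finally show "hausdorff_dim (E_product \<psi>) \<le> of_nat (CARD('m) - 1) + hausdorff_dim (E_set (\<psi> i)) + ennreal e"
    by (simp add: add.assoc)
qed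

lemma E_product_hausdorff_dim_ge:
  fixes \<psi> :: "'m::finite \<Rightarrow> nat \<Rightarrow> real"
  assumes af: "\<And>i. approx_fun (\<psi> i)"
  shows "of_nat (CARD('m) - 1) + (MIN i. hausdorff_dim (E_set (\<psi> i))) \<le> hausdorff_dim (E_product \<psi>)"
    (is "?k + ?d \<le> _")
  unfolding hausdorff_dim_def[of "E_product \<psi>"]
proof (rule Inf_greatest, rule ccontr)
  fix v assume "v \<in> {ennreal s |s. 0 \<le> s \<and> hausdorff_measure s (E_product \<psi>) = 0}" and lt: "\<not> ?k + ?d \<le> v"
  then obtain \<sigma> where \<sigma>: "v = ennreal \<sigma>" "0 \<le> \<sigma>" "hausdorff_measure \<sigma> (E_product \<psi>) = 0" by auto
  define m where "m = real CARD('m)"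
  have m: "m \<ge> 1" by (simp add: m_def Suc_le_eq)
  have km: "?k = ennreal (m - 1)" by (simp add: m_def ennreal_of_nat_eq_real_of_nat Suc_le_eq of_nat_diff)
  \<comment> \<open>The alternative s = 0 covers the case where the minimal dimension is 0 and
    nothing lies strictly below it.\<close>
  have "\<exists>s. 0 \<le> s \<and> \<sigma> < m - 1 + s \<and> (s = 0 \<or> ennreal s < ?d)"
  proof (cases "\<sigma> < m - 1")
    case True
    then show ?thesis by (intro exI[of _ 0]) auto
  next
    case False
    have "ennreal (m - 1) + ennreal (\<sigma> - (m - 1)) = ennreal \<sigma>" using m False by (subst ennreal_plus[symmetric]) auto
    then have "ennreal (m - 1) + ennreal (\<sigma> - (m - 1)) < ennreal (m - 1) + ?d" using lt \<sigma> km by (simp add: not_le)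
    then have "ennreal (\<sigma> - (m - 1)) < ?d" by (metis add_left_mono not_le)
    then obtain w where w: "ennreal (\<sigma> - (m - 1)) < w" "w < ?d" using dense by blast
    then obtain s where s: "w = ennreal s" "0 \<le> s" by (cases w) auto
    then have "\<sigma> - (m - 1) < s" using w False by (simp add: ennreal_less_iff)
    then show ?thesis using s w by (intro exI[of _ s]) auto
  qed
  then obtain s where s: "0 \<le> s" "\<sigma> < m - 1 + s" "s = 0 \<or> ennreal s < ?d" by blast
  have di: "?d \<le> hausdorff_dim (E_set (\<psi> i))" for i by (intro Min_le) auto
  have io: "\<exists>N\<ge>M. 1 \<le> \<psi> i N powr s * real N ^ 2" for i M
    by (rule approx_fun.large_often[OF af]) (use s di[of i] in force)
  have s1: "s \<le> 1" by (rule approx_fun.large_often_le_1[OF af s(1) io])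
  \<comment> \<open>The whole gap is spread evenly over the m coordinates, making \<sigma> equal to
    the admissible bound.\<close>
  define \<eta> where "\<eta> = (m - 1 + s - \<sigma>) / m"
  have \<eta>: "\<eta> > 0" "m * \<eta> = m - 1 + s - \<sigma>" using s m by (auto simp: \<eta>_def)
  have "hausdorff_measure \<sigma> (E_product \<psi>) \<noteq> 0"
    using \<eta>(2) \<sigma>(2) by (intro E_product_lower(1)[OF af s(1) s1 \<eta>(1) io]) (auto simp: m_def)
  then show False using \<sigma> by simp
qed

lemma E_product_packing_dim_ge:
  fixes \<psi> :: "'m::finite \<Rightarrow> nat \<Rightarrow> real"
  assumes af: "\<And>i. approx_fun (\<psi> i)"
  shows "of_nat CARD('m) \<le> packing_dim (E_product \<psi>)"
  unfolding packing_dim_def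
proof (rule Inf_greatest, rule ccontr)
  fix v assume "v \<in> {ennreal s |s. 0 \<le> s \<and> packing_measure s (E_product \<psi>) = 0}" and lt: "\<not> of_nat CARD('m) \<le> v"
  then obtain \<sigma> where \<sigma>: "v = ennreal \<sigma>" "0 \<le> \<sigma>" "packing_measure \<sigma> (E_product \<psi>) = 0" by auto
  define m where "m = real CARD('m)"
  have m: "m \<ge> 1" by (simp add: m_def Suc_le_eq)
  have "\<sigma> < m" using lt \<sigma> by (simp add: m_def ennreal_of_nat_eq_real_of_nat not_le ennreal_less_iff)
  \<comment> \<open>Only half of the gap is spent, since a strict inequality is needed here: m(1 -
    \<eta>) is the midpoint of \<sigma> and m.\<close>
  define \<eta> where "\<eta> = (m - \<sigma>) / (2 * m)"
  have \<eta>: "\<eta> > 0" "m * (1 - \<eta>) = (m + \<sigma>) / 2" using \<open>\<sigma> < m\<close> m by (auto simp: \<eta>_def field_simps)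
  have io: "\<exists>N\<ge>M. 1 \<le> \<psi> i N powr 0 * real N ^ 2" for i M
    by (rule approx_fun.large_often[OF af]) simp
  have "packing_measure \<sigma> (E_product \<psi>) \<noteq> 0"
    using \<eta>(2) \<open>\<sigma> < m\<close> \<sigma>(2) by (intro E_product_lower(2)[OF af _ _ \<eta>(1) io]) (auto simp: m_def)
  then show False using \<sigma> by simp
qed

theorem theorem1p1:
  fixes \<psi> :: "'m::finite \<Rightarrow> nat \<Rightarrow> real"
  assumes pos: "\<And>i q. q \<ge> 1 \<Longrightarrow> \<psi> i q > 0"
    and noninc: "\<And>i. antimono_on {1..} (\<psi> i)"
    and little_o: "\<And>i. \<psi> i \<in> o(\<lambda>q. 1 / real q ^ 2)"
    and summ: "\<And>i. summable (\<lambda>q. real q * \<psi> i q)"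
  shows "hausdorff_dim {x :: real ^ 'm. \<forall>i. x $ i \<in> E_set (\<psi> i)}
           = of_nat (CARD('m) - 1) + (MIN i. hausdorff_dim (E_set (\<psi> i)))
       \<and> packing_dim {x :: real ^ 'm. \<forall>i. x $ i \<in> E_set (\<psi> i)} = of_nat CARD('m)"
proof -
  have af: "approx_fun (\<psi> i)" for i
  proof
    show "(\<lambda>q. real q ^ 2 * \<psi> i q) \<longlonglongrightarrow> 0"
    proof -
      have "(\<lambda>q. \<psi> i q / (1 / real q ^ 2)) \<longlonglongrightarrow> 0" by (rule smalloD_tendsto[OF little_o])
      then show ?thesis by (simp add: mult.commute)
    qed
  qed (use pos summ noninc[of i] in \<open>auto simp: monotone_on_def\<close>)
  \<comment> \<open>The slab bound holds for each index; at one attaining the minimum it matches the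
    lower bound.\<close>
  have "(MIN i. hausdorff_dim (E_set (\<psi> i))) \<in> range (\<lambda>i. hausdorff_dim (E_set (\<psi> i)))"
    by (intro Min_in) auto
  then obtain i where i: "(MIN i. hausdorff_dim (E_set (\<psi> i))) = hausdorff_dim (E_set (\<psi> i))" by (rule imageE)
  have "bounded (E_product \<psi>)"
  proof (rule bounded_subset)
    show "E_product \<psi> \<subseteq> cbox 0 (\<chi> i. 1)"
      by (auto simp: mem_box_cart E_set_def W_set_def less_imp_le)
  qed simp
  then have "packing_dim (E_product \<psi>) \<le> of_nat CARD('m)"
    using packing_dim_bounded_le[of "E_product \<psi>"] by simp
  then show ?thesis
    using E_product_hausdorff_dim_le[of \<psi> i] E_product_hausdorff_dim_ge[of \<psi>, OF af]
      E_product_packing_dim_ge[of \<psi>, OF af] by (simp add: i order.antisym)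
qed

end
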